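(* Let $\mathfrak g=\mathfrak{osp}(m|2)$ with the base $\Sigma_{\mathfrak o_m}$, and let $\lambda\in\mathfrak h^*$. The module $L(\lambda)$ is bounded if and only if the $\mathfrak o_m$-module $L_{\mathfrak o_m}(\lambda_{\mathfrak o_m})$ is bounded. In this case the degree of $L(\lambda)$ is at most $2^{2m}\deg L_{\mathfrak o_m}(\lambda_{\mathfrak o_m})$.
   Context: The base field is $\mathbb C$. Let $s=\lfloor m/2\rfloor$. $\mathfrak h^*$ has the standard basis $\varepsilon_1,\dots,\varepsilon_s,\delta_1$; $\mathfrak g_0=\mathfrak o_m\times\mathfrak{sp}_2$ with the roots of $\mathfrak o_m$ in the span of the $\varepsilon_i$ and those of $\mathfrak{sp}_2$ being $\pm2\delta_1$. The base $\Sigma_{\mathfrak o_m}$ is $\{\delta_1-\varepsilon_1,\varepsilon_1-\varepsilon_2,\ldots,\varepsilon_{s-1}-\varepsilon_s,\varepsilon_s\}$ for $m=2s+1$ and $\{\delta_1-\varepsilon_1,\varepsilon_1-\varepsilon_2,\ldots,\varepsilon_{s-1}-\varepsilon_s,\varepsilon_{s-1}+\varepsilon_s\}$ for $m=2s$; i.e. the base with standard even positive roots and with positive odd roots $\delta_1\pm\varepsilon_i$ (together with $\delta_1$ if $m$ is odd); for $m=1$ it is $\{\delta_1\}$ and for $m=2$ it is $\{\delta_1-\varepsilon_1,\delta_1+\varepsilon_1\}$. $L(\lambda)$ is the simple highest weight $\mathfrak g$-module of highest weight $\lambda$ with respect to this base, $\lambda_{\mathfrak o_m}$ is the restriction of $\lambda$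 to $\mathfrak h\cap\mathfrak o_m$ (i.e. the $\varepsilon$-part of $\lambda$), and $L_{\mathfrak o_m}(\mu)$ is the simple highest weight $\mathfrak o_m$-module with highest weight $\mu$. A module is bounded if it is a weight module (direct sum of its weight spaces) whose weight multiplicities are uniformly bounded; its degree $\deg$ is the maximal weight multiplicity. *)

theory Defs
  imports Complex_Main "Jordan_Normal_Form.Matrix" "HOL-Library.Z2" "HOL-Library.FuncSet"
begin

section \<open>Matrix Lie superalgebras\<close>

text \<open>
  A matrix Lie superalgebra is given by its homogeneous components \<open>g 0\<close> (even) and
  \<open>g 1\<close> (odd), both subspaces of one space of square complex matrices; the underlying
  vector space is \<open>total_space g\<close>.
\<close>

definition total_space :: "(bit \<Rightarrow> complex mat set) \<Rightarrow> complex mat set" where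
  "total_space g = {X + Y | X Y. X \<in> g 0 \<and> Y \<in> g 1}"

definition koszul :: "bit \<Rightarrow> bit \<Rightarrow> complex" where
  "koszul p q = (if p = 1 \<and> q = 1 then -1 else 1)"

definition super_bracket :: "bit \<Rightarrow> bit \<Rightarrow> complex mat \<Rightarrow> complex mat \<Rightarrow> complex mat" where
  "super_bracket p q X Y = X * Y - koszul p q \<cdot>\<^sub>m (Y * X)"

text \<open>
  Weights are functionals on a Cartan subalgebra \<open>h\<close>. They are represented by functions on all
  matrices of which only the values on \<open>h\<close> matter.
\<close>

definition dual_space :: "complex mat set \<Rightarrow> (complex mat \<Rightarrow> complex) set" where
  "dual_space h = {\<mu>. (\<forall>X\<in>h. \<forall>Y\<in>h. \<mu> (X + Y) = \<mu> X + \<mu> Y) \<and>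
                      (\<forall>c. \<forall>X\<in>h. \<mu> (c \<cdot>\<^sub>m X) = c * \<mu> X)}"

definition root_space ::
  "(bit \<Rightarrow> complex mat set) \<Rightarrow> complex mat set \<Rightarrow> (complex mat \<Rightarrow> complex) \<Rightarrow> complex mat set" where
  "root_space g h \<alpha> = {X \<in> total_space g. \<forall>H\<in>h. H * X - X * H = \<alpha> H \<cdot>\<^sub>m X}"

definition nonneg_combinations ::
  "(complex mat \<Rightarrow> complex) set \<Rightarrow> (complex mat \<Rightarrow> complex) set" where
  "nonneg_combinations B =
     {(\<lambda>X. \<Sum>\<beta>\<in>B. of_nat (n \<beta>) * \<beta> X) | n :: (complex mat \<Rightarrow> complex) \<Rightarrow> nat. \<exists>\<beta>\<in>B. n \<beta> \<noteq> 0}"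

text \<open>
  The root vectors of positive roots with respect to a base \<open>B\<close>. Combinations that
  are not roots contribute only the zero matrix.
\<close>

definition positive_root_vectors ::
  "(bit \<Rightarrow> complex mat set) \<Rightarrow> complex mat set \<Rightarrow> (complex mat \<Rightarrow> complex) set \<Rightarrow> complex mat set" where
  "positive_root_vectors g h B = (\<Union>\<alpha>\<in>nonneg_combinations B. root_space g h \<alpha>)"


section \<open>Supermodules\<close>

text \<open>
  A module lives on a whole type \<open>'v\<close>, made a complex vector space by \<open>scale\<close>; \<open>P\<close> is its
  parity decomposition, and \<open>\<rho> X\<close> is the action of \<open>X\<close>, relevant only for \<open>X\<close> in \<open>total_space g\<close>.
\<close>

definition parity_decomposition ::
  "(complex \<Rightarrow> 'v::ab_group_add \<Rightarrow> 'v) \<Rightarrow> (bit \<Rightarrow> 'v set) \<Rightarrow> bool" where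
  "parity_decomposition scale P \<longleftrightarrow>
     (\<forall>p. module.subspace scale (P p)) \<and> P 0 \<inter> P 1 = {0} \<and>
     (\<forall>v. \<exists>a\<in>P 0. \<exists>b\<in>P 1. v = a + b)"

definition lie_supermodule ::
  "(bit \<Rightarrow> complex mat set) \<Rightarrow> (complex \<Rightarrow> 'v::ab_group_add \<Rightarrow> 'v) \<Rightarrow> (bit \<Rightarrow> 'v set) \<Rightarrow>
   (complex mat \<Rightarrow> 'v \<Rightarrow> 'v) \<Rightarrow> bool" where
  "lie_supermodule g scale P \<rho> \<longleftrightarrow>
     vector_space scale \<and>
     parity_decomposition scale P \<and>
     (\<forall>X\<in>total_space g. Vector_Spaces.linear scale scale (\<rho> X)) \<and>
     (\<forall>X\<in>total_space g. \<forall>Y\<in>total_space g. \<forall>v. \<rho> (X + Y) v = \<rho> X v + \<rho> Y v) \<and>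
     (\<forall>c. \<forall>X\<in>total_space g. \<forall>v. \<rho> (c \<cdot>\<^sub>m X) v = scale c (\<rho> X v)) \<and>
     (\<forall>p q. \<forall>X\<in>g p. \<forall>v\<in>P q. \<rho> X v \<in> P (p + q)) \<and>
     (\<forall>p q. \<forall>X\<in>g p. \<forall>Y\<in>g q. \<forall>v.
        \<rho> (super_bracket p q X Y) v = \<rho> X (\<rho> Y v) - scale (koszul p q) (\<rho> Y (\<rho> X v)))"

definition submodule ::
  "(bit \<Rightarrow> complex mat set) \<Rightarrow> (complex \<Rightarrow> 'v::ab_group_add \<Rightarrow> 'v) \<Rightarrow> (bit \<Rightarrow> 'v set) \<Rightarrow>
   (complex mat \<Rightarrow> 'v \<Rightarrow> 'v) \<Rightarrow> 'v set \<Rightarrow> bool" where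
  "submodule g scale P \<rho> U \<longleftrightarrow>
     module.subspace scale U \<and>
     (\<forall>X\<in>total_space g. \<forall>u\<in>U. \<rho> X u \<in> U) \<and>
     (\<forall>u\<in>U. \<exists>a\<in>U \<inter> P 0. \<exists>b\<in>U \<inter> P 1. u = a + b)"

definition simple_supermodule ::
  "(bit \<Rightarrow> complex mat set) \<Rightarrow> (complex \<Rightarrow> 'v::ab_group_add \<Rightarrow> 'v) \<Rightarrow> (bit \<Rightarrow> 'v set) \<Rightarrow>
   (complex mat \<Rightarrow> 'v \<Rightarrow> 'v) \<Rightarrow> bool" where
  "simple_supermodule g scale P \<rho> \<longleftrightarrow>
     lie_supermodule g scale P \<rho> \<and> (UNIV :: 'v set) \<noteq> {0} \<and>
     (\<forall>U. submodule g scale P \<rho> U \<longrightarrow> U = {0} \<or> U = UNIV)"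

definition weight_space ::
  "complex mat set \<Rightarrow> (complex \<Rightarrow> 'v::ab_group_add \<Rightarrow> 'v) \<Rightarrow> (complex mat \<Rightarrow> 'v \<Rightarrow> 'v) \<Rightarrow>
   (complex mat \<Rightarrow> complex) \<Rightarrow> 'v set" where
  "weight_space h scale \<rho> \<mu> = {v. \<forall>H\<in>h. \<rho> H v = scale (\<mu> H) v}"

definition highest_weight_vector ::
  "(bit \<Rightarrow> complex mat set) \<Rightarrow> complex mat set \<Rightarrow> (complex mat \<Rightarrow> complex) set \<Rightarrow>
   (complex \<Rightarrow> 'v::ab_group_add \<Rightarrow> 'v) \<Rightarrow> (bit \<Rightarrow> 'v set) \<Rightarrow> (complex mat \<Rightarrow> 'v \<Rightarrow> 'v) \<Rightarrow>
   (complex mat \<Rightarrow> complex) \<Rightarrow> 'v \<Rightarrow> bool" where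
  "highest_weight_vector g h B scale P \<rho> \<Lambda> v \<longleftrightarrow>
     v \<noteq> 0 \<and> v \<in> P 0 \<union> P 1 \<and> v \<in> weight_space h scale \<rho> \<Lambda> \<and>
     (\<forall>X\<in>positive_root_vectors g h B. \<rho> X v = 0)"

text \<open>
  The simple highest weight module of highest weight \<open>\<Lambda>\<close>, which is unique up to isomorphism
  (and parity shift).
\<close>

definition simple_highest_weight_module ::
  "(bit \<Rightarrow> complex mat set) \<Rightarrow> complex mat set \<Rightarrow> (complex mat \<Rightarrow> complex) set \<Rightarrow>
   (complex mat \<Rightarrow> complex) \<Rightarrow>
   (complex \<Rightarrow> 'v::ab_group_add \<Rightarrow> 'v) \<Rightarrow> (bit \<Rightarrow> 'v set) \<Rightarrow> (complex mat \<Rightarrow> 'v \<Rightarrow> 'v) \<Rightarrow> bool" where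
  "simple_highest_weight_module g h B \<Lambda> scale P \<rho> \<longleftrightarrow>
     simple_supermodule g scale P \<rho> \<and>
     (\<exists>v. highest_weight_vector g h B scale P \<rho> \<Lambda> v \<and>
          (\<forall>U. submodule g scale P \<rho> U \<and> v \<in> U \<longrightarrow> U = UNIV))"


section \<open>Bounded weight modules\<close>

text \<open>
  Weight spaces for distinct restrictions to \<open>h\<close> are linearly independent, so that being the
  direct sum of the weight spaces amounts to being spanned by them.
\<close>

definition weight_module ::
  "complex mat set \<Rightarrow> (complex \<Rightarrow> 'v::ab_group_add \<Rightarrow> 'v) \<Rightarrow> (complex mat \<Rightarrow> 'v \<Rightarrow> 'v) \<Rightarrow> bool" where
  "weight_module h scale \<rho> \<longleftrightarrow>
     module.span scale (\<Union>\<mu>\<in>dual_space h. weight_space h scale \<rho> \<mu>) = UNIV"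

text \<open>
  Finite dimensionality has to be required separately, because \<open>vector_space.dim\<close>
  is 0 on infinite-dimensional subspaces.
\<close>

definition finite_dim :: "(complex \<Rightarrow> 'v::ab_group_add \<Rightarrow> 'v) \<Rightarrow> 'v set \<Rightarrow> bool" where
  "finite_dim scale S \<longleftrightarrow> (\<exists>B. finite B \<and> S \<subseteq> module.span scale B)"

definition multiplicity ::
  "complex mat set \<Rightarrow> (complex \<Rightarrow> 'v::ab_group_add \<Rightarrow> 'v) \<Rightarrow> (complex mat \<Rightarrow> 'v \<Rightarrow> 'v) \<Rightarrow>
   (complex mat \<Rightarrow> complex) \<Rightarrow> nat" where
  "multiplicity h scale \<rho> \<mu> = vector_space.dim scale (weight_space h scale \<rho> \<mu>)"

definition bounded_module ::
  "complex mat set \<Rightarrow> (complex \<Rightarrow> 'v::ab_group_add \<Rightarrow> 'v) \<Rightarrow> (complex mat \<Rightarrow> 'v \<Rightarrow> 'v) \<Rightarrow> bool" where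
  "bounded_module h scale \<rho> \<longleftrightarrow>
     weight_module h scale \<rho> \<and>
     (\<exists>d. \<forall>\<mu>\<in>dual_space h.
        finite_dim scale (weight_space h scale \<rho> \<mu>) \<and> multiplicity h scale \<rho> \<mu> \<le> d)"

text \<open>The degree is meaningful for bounded modules only.\<close>

definition module_degree ::
  "complex mat set \<Rightarrow> (complex \<Rightarrow> 'v::ab_group_add \<Rightarrow> 'v) \<Rightarrow> (complex mat \<Rightarrow> 'v \<Rightarrow> 'v) \<Rightarrow> nat" where
  "module_degree h scale \<rho> = Max (multiplicity h scale \<rho> ` dual_space h)"


section \<open>The Lie superalgebra osp(m|2) and its subalgebra of type o(m)\<close>

text \<open>
  The split realization on the superspace with basis vectors \<open>0, \<dots>, m - 1\<close> (even) and
  \<open>m, m + 1\<close> (odd), so that the diagonal matrices form a Cartan subalgebra. The invariant form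
  pairs \<open>i\<close> with \<open>m - 1 - i\<close> symmetrically and \<open>m\<close> with \<open>m + 1\<close> antisymmetrically.
\<close>

definition index_parity :: "nat \<Rightarrow> nat \<Rightarrow> bit" where
  "index_parity m i = (if i < m then 0 else 1)"

definition gram :: "nat \<Rightarrow> complex mat" where
  "gram m = mat (m + 2) (m + 2) (\<lambda>(i, j).
     if i < m \<and> j < m \<and> i + j = m - 1 then 1
     else if i = m \<and> j = m + 1 then 1
     else if i = m + 1 \<and> j = m then -1
     else 0)"

text \<open>
  The last condition says \<open>(X e\<^sub>i, e\<^sub>j) + (-1)\<^bsup>p |i|\<^esup> (e\<^sub>i, X e\<^sub>j) = 0\<close> for the
  invariant form.
\<close>

definition osp :: "nat \<Rightarrow> bit \<Rightarrow> complex mat set" where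
  "osp m p = {X \<in> carrier_mat (m + 2) (m + 2).
     (\<forall>i<m + 2. \<forall>j<m + 2. X $$ (i, j) \<noteq> 0 \<longrightarrow> index_parity m i + index_parity m j = p) \<and>
     (\<forall>i<m + 2. \<forall>j<m + 2.
        (transpose_mat X * gram m) $$ (i, j)
        + koszul p (index_parity m i) * (gram m * X) $$ (i, j) = 0)}"

definition osp_cartan :: "nat \<Rightarrow> complex mat set" where
  "osp_cartan m = {X \<in> osp m 0. diagonal_mat X}"

text \<open>The Lie algebra of type o(m), embedded in osp(m|2) as the upper left block.\<close>

definition orth :: "nat \<Rightarrow> complex mat set" where
  "orth m = {X \<in> osp m 0. \<forall>i<m + 2. \<forall>j<m + 2. X $$ (i, j) \<noteq> 0 \<longrightarrow> i < m \<and> j < m}"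

definition orth_cartan :: "nat \<Rightarrow> complex mat set" where
  "orth_cartan m = osp_cartan m \<inter> orth m"

text \<open>
  With these coordinates \<open>H \<in> osp_cartan m\<close> has the diagonal entries
  \<open>\<epsilon>\<^sub>1, \<dots>, \<epsilon>\<^sub>s, (0,) -\<epsilon>\<^sub>s, \<dots>, -\<epsilon>\<^sub>1, \<delta>\<^sub>1, -\<delta>\<^sub>1\<close> where \<open>s = m div 2\<close>.
\<close>

definition eps :: "nat \<Rightarrow> complex mat \<Rightarrow> complex" where
  "eps i = (\<lambda>H. H $$ (i - 1, i - 1))"

definition delta1 :: "nat \<Rightarrow> complex mat \<Rightarrow> complex" where
  "delta1 m = (\<lambda>H. H $$ (m, m))"

definition orth_base :: "nat \<Rightarrow> (complex mat \<Rightarrow> complex) set" where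
  "orth_base m =
     (if m \<le> 2 then {}
      else {(\<lambda>H. eps i H - eps (i + 1) H) | i. 1 \<le> i \<and> i < m div 2} \<union>
           (if odd m then {eps (m div 2)}
            else {(\<lambda>H. eps (m div 2 - 1) H + eps (m div 2) H)}))"

definition osp_base :: "nat \<Rightarrow> (complex mat \<Rightarrow> complex) set" where
  "osp_base m =
     (if m = 1 then {delta1 m}
      else if m = 2 then {(\<lambda>H. delta1 m H - eps 1 H), (\<lambda>H. delta1 m H + eps 1 H)}
      else {(\<lambda>H. delta1 m H - eps 1 H)} \<union> orth_base m)"

definition osp_simple_module ::
  "nat \<Rightarrow> (complex mat \<Rightarrow> complex) \<Rightarrow>
   (complex \<Rightarrow> 'v::ab_group_add \<Rightarrow> 'v) \<Rightarrow> (bit \<Rightarrow> 'v set) \<Rightarrow> (complex mat \<Rightarrow> 'v \<Rightarrow> 'v) \<Rightarrow> bool" where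
  "osp_simple_module m \<Lambda> scale P \<rho> \<longleftrightarrow>
     simple_highest_weight_module (osp m) (osp_cartan m) (osp_base m) \<Lambda> scale P \<rho>"

text \<open>
  An ordinary Lie algebra is a Lie superalgebra with odd part 0, and its ordinary modules are
  the supermodules with odd part 0; for these, all subspaces are graded.
\<close>

definition purely_even :: "'a \<Rightarrow> 'a set \<Rightarrow> bit \<Rightarrow> 'a set" where
  "purely_even z S p = (if p = 0 then S else {z})"

definition orth_simple_module ::
  "nat \<Rightarrow> (complex mat \<Rightarrow> complex) \<Rightarrow>
   (complex \<Rightarrow> 'w::ab_group_add \<Rightarrow> 'w) \<Rightarrow> (complex mat \<Rightarrow> 'w \<Rightarrow> 'w) \<Rightarrow> bool" where
  "orth_simple_module m \<mu> scale \<rho> \<longleftrightarrow>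
     simple_highest_weight_module (purely_even (0\<^sub>m (m + 2) (m + 2)) (orth m)) (orth_cartan m)
       (orth_base m) \<mu> scale (purely_even 0 UNIV) \<rho>"

end

theory Submission
  imports Defs "HOL-Library.Product_Plus"
begin

text \<open>
  Let \<open>D\<close> be the Cartan element on which \<open>\<delta>\<^sub>1\<close> is 1 and all \<open>\<epsilon>\<^sub>i\<close> vanish. The adjoint
  eigenvalues of \<open>D\<close> grade osp(m|2): degree 0 is \<open>o(m) + \<complex> D\<close>, degrees 1 and -1 are the odd root
  vectors (\<open>m\<close> each), degrees 2 and -2 the root vectors of sp(2). All roots of positive degree are
  positive for the given base. Let \<open>v\<close> be a highest weight vector of \<open>L(\<Lambda>)\<close>, and call the
  o(m)-submodule generated by \<open>v\<close> the top layer.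

  The top layer is \<open>L\<^sub>o(\<Lambda>)\<close>. Elements of positive degree kill it, and \<open>D\<close> acts on it by a scalar.
  Hence, for an o(m)-submodule \<open>U\<close> of it, the span of all words in lowering operators applied to
  \<open>U\<close> is a submodule of \<open>L(\<Lambda>)\<close> whose part of highest degree is \<open>U\<close>
  (\<open>lowering_of_top_stable\<close>, \<open>lowering_top_part\<close>). As \<open>L(\<Lambda>)\<close> is simple, \<open>U\<close> is 0 or
  the whole top layer; so the top layer is a simple highest weight module of the
  prescribed weight, and such modules are unique up to isomorphism (\<open>highest_weight_iso\<close>).

  A weight space of the top layer lies in one weight space of \<open>L(\<Lambda>)\<close>, so boundedness
  passes from \<open>L(\<Lambda>)\<close> to \<open>L\<^sub>o(\<Lambda>)\<close>. Conversely, \<open>L(\<Lambda>)\<close> is obtained from the top layer by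
  lowering operators alone. The odd ones \<open>y\<^sub>0, \<dots>, y\<^bsub>m-1\<^esub>\<close> anticommute up to multiples of the even one
  \<open>f\<close>, and \<open>f\<close> commutes with them, so the vectors \<open>y\<^sub>I f\<^sup>j s\<close>, with \<open>I\<close> a set of indices and \<open>s\<close>
  a weight vector of the top layer, span \<open>L(\<Lambda>)\<close> (\<open>span_lowered\<close>). For a fixed total weight,
  \<open>I\<close> determines \<open>j\<close> (by its value on \<open>D\<close>) and the weight of \<open>s\<close>. Every
  multiplicity of \<open>L(\<Lambda>)\<close> is therefore at most \<open>2\<^sup>m\<close> times the degree of \<open>L\<^sub>o(\<Lambda>)\<close>
  (\<open>weight_bounded_lowered\<close>), and \<open>2\<^sup>m \<le> 2\<^bsup>2m\<^esup>\<close>.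
\<close>


section \<open>Weight vectors and generated subspaces\<close>

lemma one_smult_mat: "(1::complex) \<cdot>\<^sub>m X = X"
  by (rule eq_matI) auto

text \<open>
  If \<open>v\<close> has weight \<open>\<mu>\<close> and is a combination of weight vectors, among them one \<open>s\<^sub>0\<close> of weight
  \<open>\<nu> \<noteq> \<mu>\<close>, choose \<open>H\<close> with \<open>\<nu> H \<noteq> \<mu> H\<close>. The operator \<open>\<rho> H - \<nu> H\<close> kills \<open>s\<^sub>0\<close>, scales the
  other vectors and multiplies \<open>v\<close> by the nonzero number \<open>\<mu> H - \<nu> H\<close>, so \<open>s\<^sub>0\<close> can be dropped.
  With a one-element \<open>h\<close> this is the independence of eigenspaces of one operator.
\<close>

lemma weight_vector_in_span_weight_part:
  fixes scale :: "complex \<Rightarrow> 'v::ab_group_add \<Rightarrow> 'v"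
  assumes vs: "vector_space scale"
    and lin: "\<And>H. H \<in> h \<Longrightarrow> Vector_Spaces.linear scale scale (\<rho> H)"
    and S: "S \<subseteq> (\<Union>\<mu>. weight_space h scale \<rho> \<mu>)"
    and v: "v \<in> module.span scale S" "v \<in> weight_space h scale \<rho> \<mu>"
  shows "v \<in> module.span scale (S \<inter> weight_space h scale \<rho> \<mu>)"
proof -
  interpret vector_space scale by fact
  let ?V = "weight_space h scale \<rho> \<mu>"
  obtain F r where F: "finite F" "F \<subseteq> S" and "v = (\<Sum>a\<in>F. scale (r a) a)"
    using v(1) unfolding span_explicit by blast
  then have vF: "v \<in> span F"
    by (simp add: span_sum span_scale span_base)
  \<comment> \<open>the vectors of weight different from \<open>\<mu>\<close> are dropped one at a time\<close>
  have "v \<in> span (F - K)" if "finite K" "K \<subseteq> F - ?V" for K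
    using that
  proof (induction K)
    case (insert s0 K)
    then have vK: "v \<in> span (F - K)" and s0: "s0 \<in> F - K" "s0 \<notin> ?V" by auto
    from s0 F(2) S obtain \<nu> where \<nu>: "s0 \<in> weight_space h scale \<rho> \<nu>" by blast
    with s0(2) obtain H where H: "H \<in> h" "\<mu> H \<noteq> \<nu> H"
      unfolding weight_space_def by auto
    interpret L: Vector_Spaces.linear scale scale "\<rho> H" by (rule lin[OF H(1)])
    have "\<rho> H x - scale (\<nu> H) x \<in> span (F - insert s0 K)" if "x \<in> span (F - K)" for x
      using that
    proof (induction rule: span_induct_alt)
      case base
      then show ?case by (simp add: span_zero L.zero)
    next
      case (step c s y)
      then have "s \<in> S" using F(2) by blast
      then obtain \<nu>' where \<nu>': "s \<in> weight_space h scale \<rho> \<nu>'" using S by blast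
      have "\<rho> H s - scale (\<nu> H) s \<in> span (F - insert s0 K)"
      proof (cases "s = s0")
        case True
        then show ?thesis using \<nu> H by (simp add: weight_space_def span_zero)
      next
        case False
        then have "s \<in> span (F - insert s0 K)" using step by (auto intro: span_base)
        moreover have "\<rho> H s - scale (\<nu> H) s = scale (\<nu>' H - \<nu> H) s"
          using \<nu>' H by (simp add: weight_space_def scale_left_diff_distrib)
        ultimately show ?thesis by (simp add: span_scale)
      qed
      then have "scale c (\<rho> H s - scale (\<nu> H) s) + (\<rho> H y - scale (\<nu> H) y) \<in> span (F - insert s0 K)"
        using step by (blast intro: span_add span_scale)
      moreover have "\<rho> H (scale c s + y) - scale (\<nu> H) (scale c s + y)
          = scale c (\<rho> H s - scale (\<nu> H) s) + (\<rho> H y - scale (\<nu> H) y)"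
        by (simp add: L.add L.scale scale_right_diff_distrib scale_right_distrib scale_left_commute)
      ultimately show ?case by simp
    qed
    from this[OF vK] have "scale (\<mu> H - \<nu> H) v \<in> span (F - insert s0 K)"
      using v(2) H by (simp add: weight_space_def scale_left_diff_distrib)
    then have "scale (inverse (\<mu> H - \<nu> H)) (scale (\<mu> H - \<nu> H) v) \<in> span (F - insert s0 K)"
      by (rule span_scale)
    then show ?case using H by simp
  qed (use vF in simp)
  from this[of "F - ?V"] have "v \<in> span (F - (F - ?V))" using F(1) by simp
  moreover have "F - (F - ?V) \<subseteq> S \<inter> ?V" using F(2) by blast
  ultimately show ?thesis using span_mono by blast
qed

text \<open>
  The subspace spanned by all words in the operators from \<open>N\<close> applied to \<open>U\<close>. An inductive
  definition, because most facts about it are proved by induction on the words.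
\<close>

inductive_set generated ::
  "(complex \<Rightarrow> 'v::ab_group_add \<Rightarrow> 'v) \<Rightarrow> (complex mat \<Rightarrow> 'v \<Rightarrow> 'v) \<Rightarrow> complex mat set \<Rightarrow> 'v set \<Rightarrow> 'v set"
  for scale \<rho> N U where
  gen_base: "u \<in> U \<Longrightarrow> u \<in> generated scale \<rho> N U"
| gen_zero: "0 \<in> generated scale \<rho> N U"
| gen_add: "u \<in> generated scale \<rho> N U \<Longrightarrow> w \<in> generated scale \<rho> N U \<Longrightarrow> u + w \<in> generated scale \<rho> N U"
| gen_scale: "u \<in> generated scale \<rho> N U \<Longrightarrow> scale c u \<in> generated scale \<rho> N U"
| gen_act: "u \<in> generated scale \<rho> N U \<Longrightarrow> X \<in> N \<Longrightarrow> \<rho> X u \<in> generated scale \<rho> N U"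

definition matrix_superalgebra :: "(bit \<Rightarrow> complex mat set) \<Rightarrow> bool" where
  "matrix_superalgebra g \<longleftrightarrow>
     (\<forall>p. \<forall>X\<in>g p. \<forall>Y\<in>g p. X + Y \<in> g p) \<and>
     (\<forall>p c. \<forall>X\<in>g p. c \<cdot>\<^sub>m X \<in> g p) \<and>
     (\<forall>p q. \<forall>X\<in>g p. \<forall>Y\<in>g q. super_bracket p q X Y \<in> g (p + q))"

text \<open>
  A supermodule without its parity decomposition. In this form, products of representations
  and restrictions to subalgebras are representations for purely formal reasons.
\<close>

locale super_rep = vector_space scale
  for scale :: "complex \<Rightarrow> 'v::ab_group_add \<Rightarrow> 'v" +
  fixes g :: "bit \<Rightarrow> complex mat set" and \<rho> :: "complex mat \<Rightarrow> 'v \<Rightarrow> 'v"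
  assumes algebra: "matrix_superalgebra g"
    and linear_act: "X \<in> g p \<Longrightarrow> Vector_Spaces.linear scale scale (\<rho> X)"
    and add_act: "X \<in> g p \<Longrightarrow> Y \<in> g p \<Longrightarrow> \<rho> (X + Y) v = \<rho> X v + \<rho> Y v"
    and smult_act: "X \<in> g p \<Longrightarrow> \<rho> (c \<cdot>\<^sub>m X) v = scale c (\<rho> X v)"
    and bracket_act: "X \<in> g p \<Longrightarrow> Y \<in> g q \<Longrightarrow>
      \<rho> (super_bracket p q X Y) v = \<rho> X (\<rho> Y v) - scale (koszul p q) (\<rho> Y (\<rho> X v))"
begin

lemma subspace_generated: "subspace (generated scale \<rho> N U)"
  by (auto simp: subspace_def intro: generated.intros)

lemma gen_least:
  assumes "subspace A" "U \<subseteq> A" "\<And>X u. X \<in> N \<Longrightarrow> u \<in> A \<Longrightarrow> \<rho> X u \<in> A"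
  shows "generated scale \<rho> N U \<subseteq> A"
proof
  fix x assume "x \<in> generated scale \<rho> N U"
  then show "x \<in> A"
    by induction (use assms in \<open>auto simp: subspace_def\<close>)
qed

lemma swap_act:
  assumes "X \<in> g p" "Y \<in> g q"
  shows "\<rho> X (\<rho> Y v) = \<rho> (super_bracket p q X Y) v + scale (koszul p q) (\<rho> Y (\<rho> X v))"
  by (simp add: bracket_act[OF assms])

lemma act_zero: "X \<in> g p \<Longrightarrow> \<rho> X 0 = 0"
  using linear_act Vector_Spaces.linear.axioms(3) module_hom.zero by blast

lemma act_add: "X \<in> g p \<Longrightarrow> \<rho> X (u + w) = \<rho> X u + \<rho> X w"
  using linear_act Vector_Spaces.linear.axioms(3) module_hom.add by blast

lemma act_scale: "X \<in> g p \<Longrightarrow> \<rho> X (scale c u) = scale c (\<rho> X u)"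
  using linear_act Vector_Spaces.linear.axioms(3) module_hom.scale by blast

lemma zero_matrix_act: "0\<^sub>m k k \<in> g p \<Longrightarrow> \<rho> (0\<^sub>m k k) u = 0"
  using smult_act[of "0\<^sub>m k k" p 0 u] by simp

text \<open>
  Stability is only needed on \<open>U\<close>: commuting \<open>X\<close> past the first letter of a word yields the
  bracket, again an element of the algebra, applied to a shorter word, and the letter applied
  to \<open>X\<close> times a shorter word. This replaces a Poincare-Birkhoff-Witt argument.
\<close>

lemma gen_stable:
  assumes N: "N \<subseteq> (\<Union>p. g p)"
    and U: "\<And>p X u. X \<in> g p \<Longrightarrow> u \<in> U \<Longrightarrow> \<rho> X u \<in> generated scale \<rho> N U"
    and x: "x \<in> generated scale \<rho> N U" and X: "X \<in> g p"
  shows "\<rho> X x \<in> generated scale \<rho> N U"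
  using x X
proof (induction arbitrary: X p)
  case (gen_act u Y)
  then obtain q where Y: "Y \<in> g q" using N by blast
  have "super_bracket p q X Y \<in> g (p + q)"
    using algebra gen_act.prems Y by (auto simp: matrix_superalgebra_def)
  then have "\<rho> (super_bracket p q X Y) u \<in> generated scale \<rho> N U"
    by (rule gen_act.IH)
  moreover have "scale (koszul p q) (\<rho> Y (\<rho> X u)) \<in> generated scale \<rho> N U"
    using gen_act by (blast intro: generated.intros)
  ultimately show ?case
    by (simp add: swap_act[OF gen_act.prems Y] generated.gen_add)
qed (auto simp: act_zero act_add act_scale intro: generated.intros U)

lemma root_act:
  assumes "H \<in> g 0" "Y \<in> g p" "H * Y - Y * H = c \<cdot>\<^sub>m Y"
  shows "\<rho> H (\<rho> Y v) = \<rho> Y (\<rho> H v) + scale c (\<rho> Y v)"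
proof -
  have "super_bracket 0 p H Y = c \<cdot>\<^sub>m Y"
    using assms(3) by (simp add: super_bracket_def koszul_def one_smult_mat)
  then show ?thesis
    by (simp add: swap_act[OF assms(1,2)] smult_act[OF assms(2)] koszul_def add.commute)
qed

text \<open>
  If every letter lowers the eigenvalue of \<open>D\<close> by a positive integer, nonempty words applied
  to \<open>U\<close> lie below the eigenvalue of \<open>U\<close>, so nothing is added in that eigenspace.
\<close>

lemma gen_top:
  assumes D: "D \<in> g 0"
    and N: "\<And>Y. Y \<in> N \<Longrightarrow> \<exists>q n. Y \<in> g q \<and> D * Y - Y * D = (- of_nat (Suc n)) \<cdot>\<^sub>m Y"
    and U: "subspace U" "\<And>u. u \<in> U \<Longrightarrow> \<rho> D u = scale c u"
    and x: "x \<in> generated scale \<rho> N U" "\<rho> D x = scale c x"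
  shows "x \<in> U"
proof -
  define E where "E k = {u. \<rho> D u = scale k u}" for k
  have E_eq: "E k = weight_space {D} scale \<rho> (\<lambda>_. k)" for k
    by (simp add: E_def weight_space_def)
  define L where "L = span (\<Union>n. E (c - of_nat (Suc n)))"
  have lower: "\<rho> Y u \<in> L" if Y: "Y \<in> N" and u: "u \<in> E (c - of_nat k)" for Y u k
  proof -
    obtain q n where n: "Y \<in> g q" "D * Y - Y * D = (- of_nat (Suc n)) \<cdot>\<^sub>m Y" using N[OF Y] by blast
    have "\<rho> D (\<rho> Y u) = scale (c - of_nat k) (\<rho> Y u) + scale (- of_nat (Suc n)) (\<rho> Y u)"
      using u by (subst root_act[OF D n]) (simp add: E_def act_scale[OF n(1)])
    also have "\<dots> = scale (c - of_nat (Suc (k + n))) (\<rho> Y u)"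
      by (subst scale_left_distrib[symmetric]) simp
    finally have "\<rho> Y u \<in> E (c - of_nat (Suc (k + n)))" by (simp add: E_def)
    then show ?thesis unfolding L_def by (intro span_base) blast
  qed
  have lowerL: "\<rho> Y l \<in> L" if Y: "Y \<in> N" and l: "l \<in> L" for Y l
  proof -
    obtain q where q: "Y \<in> g q" using N[OF Y] by blast
    show ?thesis using l unfolding L_def
    proof (induction rule: span_induct_alt)
      case base
      then show ?case by (simp add: act_zero[OF q] span_zero)
    next
      case (step d s y)
      then obtain k where "s \<in> E (c - of_nat (Suc k))" by blast
      from lower[OF Y this] step show ?case
        by (simp add: act_add[OF q] act_scale[OF q] L_def span_add span_scale)
    qed
  qed
  have "\<exists>u\<in>U. \<exists>l\<in>L. x = u + l" using x(1)
  proof induction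
    case (gen_base u)
    then show ?case using span_zero unfolding L_def by force
  next
    case gen_zero
    then show ?case using subspace_0[OF U(1)] span_zero unfolding L_def by force
  next
    case (gen_add a b)
    then obtain u l u' l' where "u \<in> U" "l \<in> L" "a = u + l" "u' \<in> U" "l' \<in> L" "b = u' + l'" by blast
    then show ?case using subspace_add[OF U(1), of u u'] span_add[of l _ l'] unfolding L_def
      by (intro bexI[of _ "u + u'"] bexI[of _ "l + l'"]) auto
  next
    case (gen_scale a d)
    then obtain u l where "u \<in> U" "l \<in> L" "a = u + l" by blast
    then show ?case using subspace_scale[OF U(1), of u d] span_scale[of l _ d] unfolding L_def
      by (intro bexI[of _ "scale d u"] bexI[of _ "scale d l"]) (auto simp: scale_right_distrib)
  next
    case (gen_act a Y)
    then obtain u l where ul: "u \<in> U" "l \<in> L" "a = u + l" by blast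
    obtain q where q: "Y \<in> g q" using N[OF \<open>Y \<in> N\<close>] by blast
    have "\<rho> Y u \<in> L" using lower[of Y u 0] gen_act ul U(2) by (simp add: E_def)
    moreover have "\<rho> Y l \<in> L" using lowerL gen_act ul by blast
    ultimately have "\<rho> Y a \<in> L" using ul by (simp add: act_add[OF q] L_def span_add)
    then show ?case using subspace_0[OF U(1)] by force
  qed
  then obtain u l where ul: "u \<in> U" "l \<in> L" "x = u + l" by blast
  have "l \<in> E c"
  proof -
    have "scale c u + \<rho> D l = scale c u + scale c l"
      using x(2) U(2)[OF ul(1)] by (simp add: ul(3) act_add[OF D] scale_right_distrib)
    then show ?thesis by (simp add: E_def)
  qed
  have "l \<in> span ((\<Union>n. E (c - of_nat (Suc n))) \<inter> weight_space {D} scale \<rho> (\<lambda>_. c))"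
    by (rule weight_vector_in_span_weight_part)
      (use ul(2) \<open>l \<in> E c\<close> linear_act[OF D] vector_space_axioms in \<open>auto simp: L_def E_eq\<close>)
  moreover have "(\<Union>n. E (c - of_nat (Suc n))) \<inter> weight_space {D} scale \<rho> (\<lambda>_. c) \<subseteq> {0}"
  proof
    fix y assume "y \<in> (\<Union>n. E (c - of_nat (Suc n))) \<inter> weight_space {D} scale \<rho> (\<lambda>_. c)"
    then obtain n where "scale (c - of_nat (Suc n)) y = scale c y"
      by (auto simp: E_def weight_space_def simp del: of_nat_Suc)
    then have "scale (of_nat (Suc n)) y = 0"
      by (simp add: scale_left_diff_distrib del: of_nat_Suc)
    then show "y \<in> {0}" by (simp del: of_nat_Suc)
  qed
  then have "span ((\<Union>n. E (c - of_nat (Suc n))) \<inter> weight_space {D} scale \<rho> (\<lambda>_. c)) \<subseteq> span {0}"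
    by (rule span_mono)
  ultimately have "l \<in> span {0}" by blast
  then have "l = 0" by simp
  then show ?thesis using ul by simp
qed

end


section \<open>The matrices of osp(m|2)\<close>

\<comment> \<open>the matrix size stays in the form \<open>m + 2\<close> of the definitions\<close>
declare add_2_eq_Suc' [simp del]

text \<open>
  The invariant form pairs the basis vectors \<open>i\<close> and \<open>dual_index m i\<close>, with the value
  \<open>index_sign m i\<close>.
\<close>

definition dual_index :: "nat \<Rightarrow> nat \<Rightarrow> nat" where
  "dual_index m i = (if i < m then m - 1 - i else if i = m then m + 1 else m)"

definition index_sign :: "nat \<Rightarrow> nat \<Rightarrow> complex" where
  "index_sign m i = (if i = m + 1 then -1 else 1)"

definition supp :: "complex mat \<Rightarrow> (nat \<times> nat) set" where
  "supp X = {(i, j). i < dim_row X \<and> j < dim_col X \<and> X $$ (i, j) \<noteq> 0}"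

definition cut :: "(nat \<times> nat) set \<Rightarrow> complex mat \<Rightarrow> complex mat" where
  "cut A X = mat (dim_row X) (dim_col X) (\<lambda>ij. if ij \<in> A then X $$ ij else 0)"

lemma dual_index_less [simp]: "i < m + 2 \<Longrightarrow> dual_index m i < m + 2"
  by (auto simp: dual_index_def)

lemma dual_index_dual_index [simp]: "i < m + 2 \<Longrightarrow> dual_index m (dual_index m i) = i"
  by (auto simp: dual_index_def)

lemma dual_index_less_iff [simp]: "i < m + 2 \<Longrightarrow> dual_index m i < m \<longleftrightarrow> i < m"
  by (auto simp: dual_index_def)

lemma index_parity_dual [simp]: "i < m + 2 \<Longrightarrow> index_parity m (dual_index m i) = index_parity m i"
  by (simp add: index_parity_def)

lemma index_sign_square [simp]: "index_sign m i * index_sign m i = 1"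
  by (simp add: index_sign_def)

lemma bij_dual_index: "bij_betw (dual_index m) {0..<m + 2} {0..<m + 2}"
  by (rule bij_betw_byWitness[where f' = "dual_index m"]) (auto simp del: add_2_eq_Suc')

lemma gram_entry:
  "i < m + 2 \<Longrightarrow> j < m + 2 \<Longrightarrow> gram m $$ (i, j) = (if j = dual_index m i then index_sign m i else 0)"
  by (auto simp: gram_def dual_index_def index_sign_def)

lemma mult_entry:
  assumes "X \<in> carrier_mat n n" "Y \<in> carrier_mat n n" "a < n" "b < n"
  shows "(X * Y) $$ (a, b) = (\<Sum>k = 0..<n. X $$ (a, k) * Y $$ (k, b))"
  using assms by (auto simp: scalar_prod_def)

text \<open>
  The form being supported on the pairs \<open>(i, dual_index m i)\<close>, invariance relates just two
  entries at a time: the entry at \<open>(a, b)\<close> and the one at the dual position.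
\<close>

lemma osp_iff:
  "X \<in> osp m p \<longleftrightarrow> X \<in> carrier_mat (m + 2) (m + 2) \<and>
     (\<forall>a<m + 2. \<forall>b<m + 2. X $$ (a, b) \<noteq> 0 \<longrightarrow> index_parity m a + index_parity m b = p) \<and>
     (\<forall>a<m + 2. \<forall>b<m + 2. X $$ (a, b) =
        - (koszul p (index_parity m b) * index_sign m a * index_sign m b
           * X $$ (dual_index m b, dual_index m a)))"
  (is "_ \<longleftrightarrow> ?C \<and> ?H \<and> (\<forall>a<m + 2. \<forall>b<m + 2. ?E a b)")
proof -
  have "(\<forall>i<m + 2. \<forall>j<m + 2. (transpose_mat X * gram m) $$ (i, j)
        + koszul p (index_parity m i) * (gram m * X) $$ (i, j) = 0)
      \<longleftrightarrow> (\<forall>a<m + 2. \<forall>b<m + 2. ?E a b)" if C: ?C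
  proof -
    have G: "gram m \<in> carrier_mat (m + 2) (m + 2)" by (simp add: gram_def)
    have 1: "(transpose_mat X * gram m) $$ (i, j) = X $$ (dual_index m j, i) * index_sign m (dual_index m j)"
      if "i < m + 2" "j < m + 2" for i j
    proof -
      have "(transpose_mat X * gram m) $$ (i, j)
          = (\<Sum>k = 0..<m + 2. transpose_mat X $$ (i, k) * gram m $$ (k, j))"
        by (rule mult_entry) (use C G that in auto)
      also have "\<dots> = (\<Sum>k = 0..<m + 2. if k = dual_index m j then X $$ (k, i) * index_sign m k else 0)"
        by (rule sum.cong) (use C that in \<open>auto simp: gram_entry simp del: add_2_eq_Suc'\<close>)
      also have "\<dots> = X $$ (dual_index m j, i) * index_sign m (dual_index m j)"
        using dual_index_less[OF that(2)] by (simp add: sum.delta)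
      finally show ?thesis .
    qed
    have 2: "(gram m * X) $$ (i, j) = index_sign m i * X $$ (dual_index m i, j)"
      if "i < m + 2" "j < m + 2" for i j
    proof -
      have "(gram m * X) $$ (i, j) = (\<Sum>k = 0..<m + 2. gram m $$ (i, k) * X $$ (k, j))"
        by (rule mult_entry) (use C G that in auto)
      also have "\<dots> = (\<Sum>k = 0..<m + 2. if k = dual_index m i then index_sign m i * X $$ (k, j) else 0)"
        by (rule sum.cong) (use C that in \<open>auto simp: gram_entry simp del: add_2_eq_Suc'\<close>)
      also have "\<dots> = index_sign m i * X $$ (dual_index m i, j)"
        using dual_index_less[OF that(1)] by (simp add: sum.delta)
      finally show ?thesis .
    qed
    have 3: "(transpose_mat X * gram m) $$ (b, dual_index m a)
        + koszul p (index_parity m b) * (gram m * X) $$ (b, dual_index m a) = 0 \<longleftrightarrow> ?E a b"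
      if "a < m + 2" "b < m + 2" for a b
    proof -
      have "x * s + k * (t * y) = 0 \<longleftrightarrow> x = - (k * s * t * y)" if "s * s = 1" for x y s t k :: complex
      proof -
        have "x * s + k * (t * y) = 0 \<longleftrightarrow> (x * s + k * (t * y)) * s = 0"
          using that by auto
        also have "(x * s + k * (t * y)) * s = x * (s * s) + k * s * t * y"
          by (simp add: algebra_simps)
        finally show ?thesis using that by (simp add: eq_neg_iff_add_eq_0)
      qed
      then show ?thesis
        using that by (simp add: 1 2 del: add_2_eq_Suc')
    qed
    show ?thesis
    proof safe
      fix a b
      assume *: "\<forall>i<m + 2. \<forall>j<m + 2. (transpose_mat X * gram m) $$ (i, j)
        + koszul p (index_parity m i) * (gram m * X) $$ (i, j) = 0" and ab: "a < m + 2" "b < m + 2"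
      from *[rule_format, OF ab(2) dual_index_less[OF ab(1)]] show "?E a b"
        by (simp only: 3[OF ab])
    next
      fix i j
      assume *: "\<forall>a<m + 2. \<forall>b<m + 2. ?E a b" and ij: "i < m + 2" "j < m + 2"
      from *[rule_format, OF dual_index_less[OF ij(2)] ij(1)]
        3[OF dual_index_less[OF ij(2)] ij(1)]
      show "(transpose_mat X * gram m) $$ (i, j)
        + koszul p (index_parity m i) * (gram m * X) $$ (i, j) = 0"
        unfolding dual_index_dual_index[OF ij(2)] by blast
    qed
  qed
  then show ?thesis unfolding osp_def by blast
qed

lemma ospI:
  assumes "X \<in> carrier_mat (m + 2) (m + 2)"
    and "\<And>a b. a < m + 2 \<Longrightarrow> b < m + 2 \<Longrightarrow> X $$ (a, b) \<noteq> 0 \<Longrightarrow> index_parity m a + index_parity m b = p"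
    and "\<And>a b. a < m + 2 \<Longrightarrow> b < m + 2 \<Longrightarrow> X $$ (a, b) =
        - (koszul p (index_parity m b) * index_sign m a * index_sign m b
           * X $$ (dual_index m b, dual_index m a))"
  shows "X \<in> osp m p"
  using assms unfolding osp_iff by blast

lemma osp_carrier: "X \<in> osp m p \<Longrightarrow> X \<in> carrier_mat (m + 2) (m + 2)"
  by (simp add: osp_iff)

lemma osp_dim: "X \<in> osp m p \<Longrightarrow> dim_row X = m + 2" "X \<in> osp m p \<Longrightarrow> dim_col X = m + 2"
  using osp_carrier by blast+

lemma osp_parity:
  assumes X: "X \<in> osp m p" and ab: "(a, b) \<in> supp X"
  shows "index_parity m a + index_parity m b = p"
proof -
  have "a < m + 2" "b < m + 2" "X $$ (a, b) \<noteq> 0"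
    using osp_dim[OF X] ab by (auto simp: supp_def)
  then show ?thesis using X unfolding osp_iff by blast
qed

lemma osp_entry:
  "X \<in> osp m p \<Longrightarrow> a < m + 2 \<Longrightarrow> b < m + 2 \<Longrightarrow> X $$ (a, b) =
        - (koszul p (index_parity m b) * index_sign m a * index_sign m b
           * X $$ (dual_index m b, dual_index m a))"
  unfolding osp_iff by blast

text \<open>
  The sign comparison behind the closure of osp(m|2) under the bracket; \<open>b\<close> and \<open>c\<close> are index
  parities, and \<open>c + b\<close> is the parity of a matrix with a nonzero entry there.
\<close>

lemma koszul_bits:
  "koszul p c * koszul (c + b) b = koszul p (c + b) * koszul (p + (c + b)) b"
  by (cases p; cases b; cases c) (simp_all add: koszul_def)

text \<open>
  Taking the adjoint with respect to the form reverses products up to a sign, so the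
  adjoint of \<open>X * Y\<close> is \<open>Y * X\<close> up to a sign; the bracket combines the two.
\<close>

lemma osp_mult_entry:
  assumes X: "X \<in> osp m p" and Y: "Y \<in> osp m q" and ab: "a < m + 2" "b < m + 2"
  shows "(X * Y) $$ (a, b) = koszul p q * koszul (p + q) (index_parity m b)
     * index_sign m a * index_sign m b * (Y * X) $$ (dual_index m b, dual_index m a)"
proof -
  let ?d = "dual_index m" and ?s = "index_sign m" and ?p = "index_parity m"
  have "(Y * X) $$ (?d b, ?d a) = (\<Sum>k = 0..<m + 2. Y $$ (?d b, k) * X $$ (k, ?d a))"
    using X Y ab by (intro mult_entry osp_carrier dual_index_less)
  also have "\<dots> = (\<Sum>k = 0..<m + 2. Y $$ (?d b, ?d k) * X $$ (?d k, ?d a))"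
    by (rule sum.reindex_bij_betw[OF bij_dual_index, symmetric])
  finally have YX: "(Y * X) $$ (?d b, ?d a) = \<dots>" .
  have "(X * Y) $$ (a, b) = (\<Sum>k = 0..<m + 2. X $$ (a, k) * Y $$ (k, b))"
    using X Y ab by (intro mult_entry osp_carrier)
  also have "\<dots> = (\<Sum>k = 0..<m + 2. koszul p q * koszul (p + q) (?p b) * ?s a * ?s b *
      (Y $$ (?d b, ?d k) * X $$ (?d k, ?d a)))"
  proof (rule sum.cong)
    fix k assume "k \<in> {0..<m + 2}"
    then have k: "k < m + 2" by simp
    show "X $$ (a, k) * Y $$ (k, b) = koszul p q * koszul (p + q) (?p b) * ?s a * ?s b *
      (Y $$ (?d b, ?d k) * X $$ (?d k, ?d a))"
    proof (cases "Y $$ (?d b, ?d k) = 0")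
      case True
      then show ?thesis using osp_entry[OF Y k ab(2)] by simp
    next
      case False
      then have "(?d b, ?d k) \<in> supp Y"
        using ab k osp_dim[OF Y] by (simp add: supp_def del: add_2_eq_Suc')
      from osp_parity[OF Y this] have q: "q = ?p k + ?p b"
        unfolding index_parity_dual[OF ab(2)] index_parity_dual[OF k] by (simp only: add.commute)
      have "X $$ (a, k) * Y $$ (k, b) = (koszul p (?p k) * koszul q (?p b)) * (?s k * ?s k) * ?s a * ?s b *
          (Y $$ (?d b, ?d k) * X $$ (?d k, ?d a))"
        unfolding osp_entry[OF X ab(1) k] osp_entry[OF Y k ab(2)] by (simp only: mult_ac minus_mult_minus)
      also have "koszul p (?p k) * koszul q (?p b) = koszul p q * koszul (p + q) (?p b)"
        unfolding q by (rule koszul_bits)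
      finally show ?thesis by (simp only: index_sign_square mult_1_right)
    qed
  qed simp
  also have "\<dots> = koszul p q * koszul (p + q) (?p b) * ?s a * ?s b * (Y * X) $$ (?d b, ?d a)"
    unfolding YX by (simp only: sum_distrib_left)
  finally show ?thesis .
qed

lemma mult_supp:
  assumes "X \<in> carrier_mat n n" "Y \<in> carrier_mat n n" "(a, b) \<in> supp (X * Y)"
  obtains k where "(a, k) \<in> supp X" "(k, b) \<in> supp Y"
proof -
  have ab: "a < n" "b < n" using assms by (auto simp: supp_def)
  have "(\<Sum>k = 0..<n. X $$ (a, k) * Y $$ (k, b)) \<noteq> 0"
    using assms(3) mult_entry[OF assms(1,2) ab] by (simp add: supp_def)
  then obtain k where "k < n" "X $$ (a, k) * Y $$ (k, b) \<noteq> 0"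
    by (metis (no_types, lifting) atLeastLessThan_iff sum.neutral)
  then show ?thesis using that[of k] assms(1,2) ab by (auto simp: supp_def)
qed

lemma bracket_supp:
  assumes "X \<in> carrier_mat n n" "Y \<in> carrier_mat n n" "(a, b) \<in> supp (super_bracket p q X Y)"
  shows "(\<exists>k. (a, k) \<in> supp X \<and> (k, b) \<in> supp Y) \<or> (\<exists>k. (a, k) \<in> supp Y \<and> (k, b) \<in> supp X)"
proof -
  have "(a, b) \<in> supp (X * Y) \<or> (a, b) \<in> supp (Y * X)"
    using assms by (auto simp: supp_def super_bracket_def)
  then show ?thesis using mult_supp[OF assms(1,2)] mult_supp[OF assms(2,1)] by metis
qed

lemma super_bracket_carrier:
  "X \<in> carrier_mat n n \<Longrightarrow> Y \<in> carrier_mat n n \<Longrightarrow> super_bracket p q X Y \<in> carrier_mat n n"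
  unfolding super_bracket_def by (intro minus_carrier_mat smult_carrier_mat mult_carrier_mat)

lemma koszul_commute: "koszul p q = koszul q p"
  by (simp add: koszul_def)

lemma koszul_square: "koszul p q * koszul p q = 1"
  by (simp add: koszul_def)

lemma osp_bracket:
  assumes X: "X \<in> osp m p" and Y: "Y \<in> osp m q"
  shows "super_bracket p q X Y \<in> osp m (p + q)"
proof (rule ospI)
  note C = osp_carrier[OF X] osp_carrier[OF Y]
  show "super_bracket p q X Y \<in> carrier_mat (m + 2) (m + 2)"
    using C by (rule super_bracket_carrier)
  fix a b assume ab: "a < m + 2" "b < m + 2"
  {
    assume "super_bracket p q X Y $$ (a, b) \<noteq> 0"
    then have "(a, b) \<in> supp (super_bracket p q X Y)"
      using ab super_bracket_carrier[OF C, of p q] by (auto simp: supp_def)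
    from bracket_supp[OF C this] show "index_parity m a + index_parity m b = p + q"
    proof (elim disjE exE conjE)
      fix k assume "(a, k) \<in> supp X" "(k, b) \<in> supp Y"
      from osp_parity[OF X this(1)] osp_parity[OF Y this(2)] show ?thesis
        by (cases "index_parity m a"; cases "index_parity m b"; cases "index_parity m k") auto
    next
      fix k assume "(a, k) \<in> supp Y" "(k, b) \<in> supp X"
      from osp_parity[OF Y this(1)] osp_parity[OF X this(2)] show ?thesis
        by (cases "index_parity m a"; cases "index_parity m b"; cases "index_parity m k") auto
    qed
  }
  have entry: "super_bracket p q X Y $$ (c, d) = (X * Y) $$ (c, d) - koszul p q * (Y * X) $$ (c, d)"
    if "c < m + 2" "d < m + 2" for c d
    using C that by (auto simp: super_bracket_def)
  let ?d = "dual_index m" and ?s = "index_sign m" and ?p = "index_parity m"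
  let ?k = "koszul (p + q) (?p b) * ?s a * ?s b"
  have "super_bracket p q X Y $$ (a, b)
      = koszul p q * ?k * (Y * X) $$ (?d b, ?d a) - koszul p q * (koszul p q * ?k * (X * Y) $$ (?d b, ?d a))"
    unfolding entry[OF ab] osp_mult_entry[OF X Y ab] osp_mult_entry[OF Y X ab] koszul_commute[of q p]
      add.commute[of q p]
    by (simp add: mult.assoc)
  also have "\<dots> = - (?k * ((X * Y) $$ (?d b, ?d a) - koszul p q * (Y * X) $$ (?d b, ?d a)))"
  proof -
    have "c * k * x - c * (c * k * y) = - (k * (y - c * x))" if "c * c = 1" for c k x y :: complex
    proof -
      have "c * k * x - c * (c * k * y) = c * k * x - (c * c) * (k * y)" by (simp only: mult_ac)
      then show ?thesis using that by (simp add: algebra_simps)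
    qed
    then show ?thesis using koszul_square by blast
  qed
  also have "\<dots> = - (?k * super_bracket p q X Y $$ (?d b, ?d a))"
    unfolding entry[OF dual_index_less[OF ab(2)] dual_index_less[OF ab(1)]] ..
  finally show "super_bracket p q X Y $$ (a, b) = - (?k * super_bracket p q X Y $$ (?d b, ?d a))" .
qed

lemma osp_add: "X \<in> osp m p \<Longrightarrow> Y \<in> osp m p \<Longrightarrow> X + Y \<in> osp m p"
proof (rule ospI)
  assume X: "X \<in> osp m p" and Y: "Y \<in> osp m p"
  note C = osp_carrier[OF X] osp_carrier[OF Y]
  show "X + Y \<in> carrier_mat (m + 2) (m + 2)" using C by simp
  fix a b assume ab: "a < m + 2" "b < m + 2"
  show "(X + Y) $$ (a, b) = - (koszul p (index_parity m b) * index_sign m a * index_sign m b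
           * (X + Y) $$ (dual_index m b, dual_index m a))"
    using C ab osp_entry[OF X ab] osp_entry[OF Y ab] dual_index_less[OF ab(1)] dual_index_less[OF ab(2)]
    by (auto simp: algebra_simps)
  assume "(X + Y) $$ (a, b) \<noteq> 0"
  then have "(a, b) \<in> supp X \<or> (a, b) \<in> supp Y" using C ab by (auto simp: supp_def)
  then show "index_parity m a + index_parity m b = p" using osp_parity X Y by blast
qed

lemma osp_smult: "X \<in> osp m p \<Longrightarrow> c \<cdot>\<^sub>m X \<in> osp m p"
proof (rule ospI)
  assume X: "X \<in> osp m p"
  note C = osp_carrier[OF X]
  show "c \<cdot>\<^sub>m X \<in> carrier_mat (m + 2) (m + 2)" using C by simp
  fix a b assume ab: "a < m + 2" "b < m + 2"
  show "(c \<cdot>\<^sub>m X) $$ (a, b) = - (koszul p (index_parity m b) * index_sign m a * index_sign m b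
           * (c \<cdot>\<^sub>m X) $$ (dual_index m b, dual_index m a))"
    using C ab osp_entry[OF X ab] dual_index_less[OF ab(1)] dual_index_less[OF ab(2)]
    by auto
  assume "(c \<cdot>\<^sub>m X) $$ (a, b) \<noteq> 0"
  then have "(a, b) \<in> supp X" using C ab by (auto simp: supp_def)
  then show "index_parity m a + index_parity m b = p" using osp_parity X by blast
qed

lemma osp_zero: "0\<^sub>m (m + 2) (m + 2) \<in> osp m p"
  by (rule ospI) (auto simp: dual_index_def)

lemma superalgebra_osp: "matrix_superalgebra (osp m)"
  unfolding matrix_superalgebra_def by (blast intro: osp_add osp_smult osp_bracket)

lemma orth_iff: "X \<in> orth m \<longleftrightarrow> X \<in> osp m 0 \<and> supp X \<subseteq> {..<m} \<times> {..<m}"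
proof (cases "X \<in> osp m 0")
  case True
  then show ?thesis using osp_dim[OF True] by (auto simp: orth_def supp_def)
qed (simp add: orth_def)

lemma supp_add: "dim_row X = dim_row Y \<Longrightarrow> dim_col X = dim_col Y \<Longrightarrow> supp (X + Y) \<subseteq> supp X \<union> supp Y"
  by (auto simp: supp_def)

lemma supp_smult: "supp (c \<cdot>\<^sub>m X) \<subseteq> supp X"
  by (auto simp: supp_def)

lemma orth_add: "X \<in> orth m \<Longrightarrow> Y \<in> orth m \<Longrightarrow> X + Y \<in> orth m"
  using supp_add[of X Y] osp_dim[of X m 0] osp_dim[of Y m 0] by (auto simp: orth_iff osp_add)

lemma orth_smult: "X \<in> orth m \<Longrightarrow> c \<cdot>\<^sub>m X \<in> orth m"
  using supp_smult[of c X] by (auto simp: orth_iff osp_smult)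

lemma orth_bracket:
  assumes "X \<in> orth m" "Y \<in> orth m"
  shows "super_bracket 0 0 X Y \<in> orth m"
proof -
  have "super_bracket 0 0 X Y \<in> osp m (0 + 0)"
    using assms by (intro osp_bracket) (auto simp: orth_iff)
  moreover have "supp (super_bracket 0 0 X Y) \<subseteq> {..<m} \<times> {..<m}"
  proof clarify
    fix a b assume ab: "(a, b) \<in> supp (super_bracket 0 0 X Y)"
    have "X \<in> carrier_mat (m + 2) (m + 2)" "Y \<in> carrier_mat (m + 2) (m + 2)"
      using assms osp_carrier by (auto simp: orth_iff)
    from bracket_supp[OF this ab] assms show "a \<in> {..<m} \<and> b \<in> {..<m}"
      by (auto simp: orth_iff)
  qed
  ultimately show ?thesis by (simp add: orth_iff)
qed

lemma orth_zero: "0\<^sub>m (m + 2) (m + 2) \<in> orth m"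
  by (auto simp: orth_iff osp_zero supp_def)

text \<open>
  o(m) as a superalgebra, so that all facts about representations of superalgebras apply to it.
\<close>

abbreviation orth_even :: "nat \<Rightarrow> bit \<Rightarrow> complex mat set" where
  "orth_even m \<equiv> purely_even (0\<^sub>m (m + 2) (m + 2)) (orth m)"

lemma orth_even_subset: "X \<in> orth_even m p \<Longrightarrow> X \<in> osp m p"
  by (auto simp: purely_even_def osp_zero orth_iff split: if_splits)

lemma superalgebra_orth: "matrix_superalgebra (orth_even m)"
proof -
  let ?Z = "0\<^sub>m (m + 2) (m + 2) :: complex mat"
  have "super_bracket p q ?Z X = ?Z" "super_bracket p q X ?Z = ?Z"
    if "X \<in> carrier_mat (m + 2) (m + 2)" for p q X
    using that by (auto simp: super_bracket_def intro!: eq_matI)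
  moreover have "X \<in> carrier_mat (m + 2) (m + 2)" if "X \<in> orth m" for X
    using that osp_carrier by (auto simp: orth_iff)
  ultimately have "super_bracket p q X Y \<in> orth_even m (p + q)"
    if "X \<in> orth_even m p" "Y \<in> orth_even m q" for p q X Y
    using that orth_bracket[of X m Y]
    by (cases p; cases q) (auto simp: purely_even_def orth_zero)
  moreover have "X + Y \<in> orth_even m p" if "X \<in> orth_even m p" "Y \<in> orth_even m p" for p X Y
    using that by (auto simp: purely_even_def orth_add split: if_splits)
  moreover have "c \<cdot>\<^sub>m X \<in> orth_even m p" if "X \<in> orth_even m p" for p c X
    using that by (auto simp: purely_even_def orth_smult split: if_splits)
  ultimately show ?thesis unfolding matrix_superalgebra_def by blast
qed


section \<open>Elementary matrices and root vectors\<close>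

text \<open>
  Invariance couples only the entries at \<open>(a, b)\<close> and at its dual position. The matrices of
  osp(m|2) supported on such a pair are root vectors or Cartan elements, and they span
  osp(m|2); this replaces the choice of a basis.
\<close>

definition pair_orbit :: "nat \<Rightarrow> nat \<Rightarrow> nat \<Rightarrow> (nat \<times> nat) set" where
  "pair_orbit m a b = {(a, b), (dual_index m b, dual_index m a)}"

lemma supp_cut: "supp (cut A X) = supp X \<inter> A"
  by (auto simp: supp_def cut_def split: if_splits)

lemma cut_split: "X = cut A X + cut (- A) X"
  by (rule eq_matI) (auto simp: cut_def)

lemma osp_cut:
  assumes X: "X \<in> osp m p"
    and A: "\<And>a b. a < m + 2 \<Longrightarrow> b < m + 2 \<Longrightarrow> (a, b) \<in> A \<longleftrightarrow> (dual_index m b, dual_index m a) \<in> A"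
  shows "cut A X \<in> osp m p"
proof (rule ospI)
  show "cut A X \<in> carrier_mat (m + 2) (m + 2)"
    using osp_dim[OF X] by (simp add: cut_def)
  fix a b assume ab: "a < m + 2" "b < m + 2"
  show "cut A X $$ (a, b) \<noteq> 0 \<Longrightarrow> index_parity m a + index_parity m b = p"
    using osp_parity[OF X, of a b] ab osp_dim[OF X] by (auto simp: cut_def supp_def split: if_splits)
  show "cut A X $$ (a, b) = - (koszul p (index_parity m b) * index_sign m a * index_sign m b
           * cut A X $$ (dual_index m b, dual_index m a))"
    using osp_entry[OF X ab] A[OF ab] ab osp_dim[OF X] by (auto simp: cut_def)
qed

lemma pair_orbit_dual:
  assumes "a < m + 2" "b < m + 2" "i < m + 2" "j < m + 2"
  shows "(i, j) \<in> pair_orbit m a b \<longleftrightarrow> (dual_index m j, dual_index m i) \<in> pair_orbit m a b"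
proof -
  have "dual_index m j = a \<longleftrightarrow> j = dual_index m a" "dual_index m i = b \<longleftrightarrow> i = dual_index m b"
    "dual_index m j = dual_index m b \<longleftrightarrow> j = b" "dual_index m i = dual_index m a \<longleftrightarrow> i = a"
    using assms by (metis dual_index_dual_index)+
  then show ?thesis by (auto simp: pair_orbit_def)
qed

lemma supp_empty: "X \<in> carrier_mat n k \<Longrightarrow> supp X = {} \<Longrightarrow> X = 0\<^sub>m n k"
  by (rule eq_matI) (auto simp: supp_def)

lemma finite_supp: "finite (supp X)"
proof (rule finite_subset)
  show "supp X \<subseteq> {..<dim_row X} \<times> {..<dim_col X}" by (auto simp: supp_def)
qed simp

text \<open>
  Cutting out the entries at one position and its dual position stays in osp(m|2), so a
  matrix splits into elementary ones by induction on the size of its support.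
\<close>

lemma osp_induct [consumes 1, case_names zero add elementary]:
  assumes X: "X \<in> osp m p"
    and zero: "Q (0\<^sub>m (m + 2) (m + 2))"
    and add: "\<And>Y Z. Y \<in> osp m p \<Longrightarrow> Z \<in> osp m p \<Longrightarrow> Q Y \<Longrightarrow> Q Z \<Longrightarrow> Q (Y + Z)"
    and elementary: "\<And>Y a b. Y \<in> osp m p \<Longrightarrow> (a, b) \<in> supp X \<Longrightarrow>
      supp Y \<subseteq> pair_orbit m a b \<Longrightarrow> supp Y \<subseteq> supp X \<Longrightarrow> Q Y"
  shows "Q X"
proof -
  have "Q Y" if "Y \<in> osp m p" "supp Y \<subseteq> supp X" for Y
    using that
  proof (induction "card (supp Y)" arbitrary: Y rule: less_induct)
    case less
    show ?case
    proof (cases "supp Y = {}")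
      case True
      then show ?thesis using supp_empty[OF osp_carrier[OF less.prems(1)]] zero by simp
    next
      case False
      then obtain a b where ab: "(a, b) \<in> supp Y" by auto
      let ?A = "pair_orbit m a b"
      have lt: "a < m + 2" "b < m + 2" using ab osp_dim[OF less.prems(1)] by (auto simp: supp_def)
      have "cut ?A Y \<in> osp m p" "cut (- ?A) Y \<in> osp m p"
        using pair_orbit_dual[OF lt] less.prems(1) by (auto intro!: osp_cut)
      moreover have "card (supp (cut (- ?A) Y)) < card (supp Y)"
        using ab by (intro psubset_card_mono finite_supp) (auto simp: supp_cut pair_orbit_def)
      ultimately have "Q (cut ?A Y)" "Q (cut (- ?A) Y)"
        using elementary[of "cut ?A Y" a b] less.hyps[of "cut (- ?A) Y"] less.prems(2) ab
        by (auto simp: supp_cut)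
      with \<open>cut ?A Y \<in> osp m p\<close> \<open>cut (- ?A) Y \<in> osp m p\<close> have "Q (cut ?A Y + cut (- ?A) Y)"
        by (intro add)
      then show ?thesis using cut_split[of Y ?A] by simp
    qed
  qed
  then show ?thesis using X by blast
qed

text \<open>
  Closure under cutting is what allows the decomposition into elementary matrices inside the
  subalgebra; it holds for osp(m|2) itself and for o(m).
\<close>

locale osp_rep = super_rep +
  fixes m :: nat
  assumes sub_osp: "X \<in> g p \<Longrightarrow> X \<in> osp m p"
    and cut_closed: "X \<in> g p \<Longrightarrow> Y \<in> osp m p \<Longrightarrow> supp Y \<subseteq> supp X \<Longrightarrow> Y \<in> g p"
begin

lemma act_decompose:
  assumes X: "X \<in> g p" and U: "subspace U"
    and elementary: "\<And>Y a b. Y \<in> g p \<Longrightarrow> a < m + 2 \<Longrightarrow> b < m + 2 \<Longrightarrow> (a, b) \<in> supp X \<Longrightarrow>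
      supp Y \<subseteq> pair_orbit m a b \<Longrightarrow> supp Y \<subseteq> supp X \<Longrightarrow> \<rho> Y u \<in> U"
  shows "\<rho> X u \<in> U"
proof -
  have "X \<in> osp m p" using X by (rule sub_osp)
  then have "X \<in> g p \<and> \<rho> X u \<in> U"
  proof (induction rule: osp_induct)
    case zero
    have "0\<^sub>m (m + 2) (m + 2) = 0 \<cdot>\<^sub>m X"
      using osp_carrier[OF \<open>X \<in> osp m p\<close>] by (intro eq_matI) auto
    then show ?case
      using smult_act[OF X, of 0 u] subspace_0[OF U] algebra X
      by (auto simp: matrix_superalgebra_def)
  next
    case (add Y Z)
    then show ?case
      using algebra subspace_add[OF U] by (auto simp: matrix_superalgebra_def add_act)
  next
    case (elementary Y a b)
    moreover have "a < m + 2" "b < m + 2"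
      using elementary(2) osp_dim[OF \<open>X \<in> osp m p\<close>] by (auto simp: supp_def)
    ultimately show ?case using assms(3) cut_closed[OF X] by blast
  qed
  then show ?thesis by blast
qed

end

lemma diagonal_commutator:
  assumes H: "H \<in> carrier_mat n n" "diagonal_mat H" and Y: "Y \<in> carrier_mat n n"
    and c: "\<And>i j. (i, j) \<in> supp Y \<Longrightarrow> H $$ (i, i) - H $$ (j, j) = c"
  shows "H * Y - Y * H = c \<cdot>\<^sub>m Y"
proof (rule eq_matI)
  fix i j assume "i < dim_row (c \<cdot>\<^sub>m Y)" "j < dim_col (c \<cdot>\<^sub>m Y)"
  then have ij: "i < n" "j < n" using Y by auto
  have "(H * Y) $$ (i, j) = (\<Sum>k = 0..<n. if k = i then H $$ (i, i) * Y $$ (i, j) else 0)"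
    unfolding mult_entry[OF H(1) Y ij] using H ij
    by (intro sum.cong) (auto simp: diagonal_mat_def)
  moreover have "(Y * H) $$ (i, j) = (\<Sum>k = 0..<n. if k = j then Y $$ (i, j) * H $$ (j, j) else 0)"
    unfolding mult_entry[OF Y H(1) ij] using H ij
    by (intro sum.cong) (auto simp: diagonal_mat_def)
  ultimately have "(H * Y - Y * H) $$ (i, j) = (H $$ (i, i) - H $$ (j, j)) * Y $$ (i, j)"
    using ij H Y by (simp add: algebra_simps)
  also have "\<dots> = c * Y $$ (i, j)"
    using c[of i j] ij Y by (cases "Y $$ (i, j) = 0") (auto simp: supp_def)
  finally show "(H * Y - Y * H) $$ (i, j) = (c \<cdot>\<^sub>m Y) $$ (i, j)" using ij Y by simp
qed (use H Y in auto)

lemma cartan_osp: "H \<in> osp_cartan m \<Longrightarrow> H \<in> osp m 0"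
  by (simp add: osp_cartan_def)

lemma cartan_dual:
  assumes "H \<in> osp_cartan m" "a < m + 2"
  shows "H $$ (dual_index m a, dual_index m a) = - H $$ (a, a)"
  using osp_entry[OF cartan_osp[OF assms(1)] assms(2) assms(2)] by (simp add: koszul_def)

lemma elementary_root:
  assumes H: "H \<in> osp_cartan m" and Y: "Y \<in> osp m p" "supp Y \<subseteq> pair_orbit m a b"
    and ab: "a < m + 2" "b < m + 2"
  shows "H * Y - Y * H = (H $$ (a, a) - H $$ (b, b)) \<cdot>\<^sub>m Y"
proof (rule diagonal_commutator)
  show "H \<in> carrier_mat (m + 2) (m + 2)" "diagonal_mat H"
    using H osp_carrier by (auto simp: osp_cartan_def)
  show "Y \<in> carrier_mat (m + 2) (m + 2)" using Y osp_carrier by blast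
  fix i j assume "(i, j) \<in> supp Y"
  then have "(i, j) \<in> pair_orbit m a b" using Y by blast
  then show "H $$ (i, i) - H $$ (j, j) = H $$ (a, a) - H $$ (b, b)"
    using cartan_dual[OF H ab(1)] cartan_dual[OF H ab(2)] by (auto simp: pair_orbit_def)
qed

lemma zero_weight_elementary:
  assumes Y: "Y \<in> osp m 0" "supp Y \<subseteq> pair_orbit m a a" and a: "a < m + 2"
  shows "Y \<in> osp_cartan m"
  using assms by (auto simp: osp_cartan_def diagonal_mat_def pair_orbit_def supp_def)

text \<open>
  Differences of diagonal entries and combinations of the base are functions on all matrices;
  as roots they only have to agree on the Cartan subalgebra \<open>h\<close>.
\<close>

definition positive_on ::
  "complex mat set \<Rightarrow> (complex mat \<Rightarrow> complex) set \<Rightarrow> (complex mat \<Rightarrow> complex) \<Rightarrow> bool" where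
  "positive_on h B \<alpha> \<longleftrightarrow> (\<exists>\<beta>\<in>nonneg_combinations B. \<forall>H\<in>h. \<alpha> H = \<beta> H)"

lemma positive_on_base:
  assumes "finite B" "\<beta> \<in> B" "\<And>H. H \<in> h \<Longrightarrow> \<alpha> H = \<beta> H"
  shows "positive_on h B \<alpha>"
proof -
  let ?n = "\<lambda>\<gamma>. if \<gamma> = \<beta> then 1 else 0 :: nat"
  have "(\<lambda>X. \<Sum>\<gamma>\<in>B. of_nat (?n \<gamma>) * \<gamma> X) = (\<lambda>X. \<Sum>\<gamma>\<in>B. if \<gamma> = \<beta> then \<gamma> X else 0)"
    by (intro ext sum.cong) auto
  also have "\<dots> = \<beta>" using assms by (simp add: sum.delta)
  finally have "\<beta> = (\<lambda>X. \<Sum>\<gamma>\<in>B. of_nat (?n \<gamma>) * \<gamma> X)" ..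
  moreover have "\<exists>\<gamma>\<in>B. ?n \<gamma> \<noteq> 0" using assms(2) by auto
  ultimately have "\<beta> \<in> nonneg_combinations B"
    unfolding nonneg_combinations_def by (intro CollectI exI[of _ ?n] conjI)
  then show ?thesis using assms(3) by (auto simp: positive_on_def)
qed

lemma positive_on_add:
  assumes "positive_on h B \<alpha>" "positive_on h B \<beta>" "\<And>H. H \<in> h \<Longrightarrow> \<gamma> H = \<alpha> H + \<beta> H"
  shows "positive_on h B \<gamma>"
proof -
  obtain n where n: "\<exists>\<beta>\<in>B. n \<beta> \<noteq> 0" "\<forall>H\<in>h. \<alpha> H = (\<Sum>\<beta>\<in>B. of_nat (n \<beta>) * \<beta> H)"
    using assms(1) unfolding positive_on_def nonneg_combinations_def by blast
  obtain k where k: "\<exists>\<beta>\<in>B. k \<beta> \<noteq> 0" "\<forall>H\<in>h. \<beta> H = (\<Sum>\<beta>\<in>B. of_nat (k \<beta>) * \<beta> H)"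
    using assms(2) unfolding positive_on_def nonneg_combinations_def by blast
  have "(\<lambda>X. \<Sum>\<beta>\<in>B. of_nat (n \<beta> + k \<beta>) * \<beta> X) \<in> nonneg_combinations B"
    unfolding nonneg_combinations_def using n(1)
    by (intro CollectI exI[of _ "\<lambda>\<beta>. n \<beta> + k \<beta>"]) auto
  moreover have "\<forall>H\<in>h. \<gamma> H = (\<Sum>\<beta>\<in>B. of_nat (n \<beta> + k \<beta>) * \<beta> H)"
    using n k assms(3) by (simp add: sum.distrib distrib_right)
  ultimately show ?thesis unfolding positive_on_def
    by (intro bexI[of _ "\<lambda>X. \<Sum>\<beta>\<in>B. of_nat (n \<beta> + k \<beta>) * \<beta> X"])
qed

lemma positive_root_vectorI:
  assumes "Y \<in> total_space g" "h \<subseteq> osp_cartan m" "Y \<in> osp m p" "supp Y \<subseteq> pair_orbit m a b"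
    and "a < m + 2" "b < m + 2" "positive_on h B (\<lambda>H. H $$ (a, a) - H $$ (b, b))"
  shows "Y \<in> positive_root_vectors g h B"
proof -
  obtain \<beta> where "\<beta> \<in> nonneg_combinations B" "\<forall>H\<in>h. H $$ (a, a) - H $$ (b, b) = \<beta> H"
    using assms(7) unfolding positive_on_def by blast
  then show ?thesis
    using assms(1,2) elementary_root[OF _ assms(3-6)]
    unfolding positive_root_vectors_def root_space_def by force
qed

lemma finite_orth_base: "finite (orth_base m)"
proof -
  have "{(\<lambda>H. eps i H - eps (i + 1) H) | i. 1 \<le> i \<and> i < m div 2}
      = (\<lambda>i H. eps i H - eps (i + 1) H) ` {1..<m div 2}" by auto
  then show ?thesis by (simp add: orth_base_def)
qed

lemma finite_osp_base: "finite (osp_base m)"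
  by (simp add: osp_base_def finite_orth_base)

text \<open>
  Write \<open>s = m div 2\<close>. On the Cartan subalgebra the diagonal is antisymmetric, so these differences
  are \<open>\<epsilon>\<^sub>j - \<epsilon>\<^bsub>j+1\<^esub>\<close> in both halves and \<open>\<epsilon>\<^sub>s\<close> next to the middle entry 0 if \<open>m\<close> is odd. For even \<open>m\<close>
  the middle difference is \<open>2 \<epsilon>\<^sub>s\<close>, which is excluded: it is not a positive combination.
\<close>

lemma consecutive_positive:
  assumes B: "finite B" "orth_base m \<subseteq> B" and i: "i + 1 < m" "3 \<le> m" "odd m \<or> i + 1 \<noteq> m div 2"
  shows "positive_on (osp_cartan m) B (\<lambda>H. H $$ (i, i) - H $$ (i + 1, i + 1))"
proof -
  define s where "s = m div 2"
  have ms: "m = 2 * s \<or> m = 2 * s + 1" unfolding s_def by presburger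
  have base: "positive_on (osp_cartan m) B \<alpha>"
    if "j + 1 < s" "\<And>H. H \<in> osp_cartan m \<Longrightarrow> \<alpha> H = H $$ (j, j) - H $$ (j + 1, j + 1)" for \<alpha> j
  proof (rule positive_on_base[OF B(1)])
    have "(\<lambda>H. eps (j + 1) H - eps (j + 1 + 1) H) \<in> orth_base m"
      using that(1) i(2) by (auto simp: orth_base_def s_def)
    then show "(\<lambda>H. eps (j + 1) H - eps (j + 1 + 1) H) \<in> B" using B(2) by blast
  qed (use that(2) in \<open>simp add: eps_def\<close>)
  have odd_base: "positive_on (osp_cartan m) B \<alpha>"
    if "odd m" "\<And>H. H \<in> osp_cartan m \<Longrightarrow> \<alpha> H = H $$ (s - 1, s - 1)" for \<alpha>
  proof (rule positive_on_base[OF B(1)])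
    have "eps s \<in> orth_base m" using that(1) i(2) by (simp add: orth_base_def s_def)
    then show "eps s \<in> B" using B(2) by blast
  qed (use that(2) in \<open>simp add: eps_def\<close>)
  have "i + 1 < s \<or> odd m \<and> i + 1 = s \<or> odd m \<and> i = s \<or> m - s \<le> i"
  proof (cases "odd m")
    case True
    then have "m = 2 * s + 1" using ms by auto
    then show ?thesis using True by linarith
  next
    case False
    then have "m = 2 * s" "i + 1 \<noteq> s" using ms i(3) by (auto simp: s_def)
    then show ?thesis by linarith
  qed
  then consider "i + 1 < s" | "odd m" "i + 1 = s" | "odd m" "i = s" | "m - s \<le> i"
    by blast
  then show ?thesis
  proof cases
    case 1
    then show ?thesis by (rule base) simp
  next
    case 2
    then have "dual_index m (i + 1) = i + 1" using ms by (auto simp: dual_index_def)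
    then have "H $$ (i + 1, i + 1) = 0" if "H \<in> osp_cartan m" for H
      using cartan_dual[OF that, of "i + 1"] i by simp
    then show ?thesis using 2 by (intro odd_base) auto
  next
    case 3
    then have d: "dual_index m i = i" "dual_index m (i + 1) = s - 1" using ms i by (auto simp: dual_index_def)
    have "H $$ (i, i) - H $$ (i + 1, i + 1) = H $$ (s - 1, s - 1)" if "H \<in> osp_cartan m" for H
      using cartan_dual[OF that, of i] cartan_dual[OF that, of "i + 1"] i d by simp
    then show ?thesis using 3 by (intro odd_base)
  next
    case 4
    let ?j = "m - 2 - i"
    have d: "dual_index m i = ?j + 1" "dual_index m (i + 1) = ?j" using i by (auto simp: dual_index_def)
    have "?j + 1 < s" using 4 i ms by linarith
    moreover have "H $$ (i, i) - H $$ (i + 1, i + 1) = H $$ (?j, ?j) - H $$ (?j + 1, ?j + 1)"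
      if "H \<in> osp_cartan m" for H
      using cartan_dual[OF that, of i] cartan_dual[OF that, of "i + 1"] i d by simp
    ultimately show ?thesis by (rule base)
  qed
qed

text \<open>
  Sums of consecutive differences. For even \<open>m = 2 s\<close> a sum crossing the middle has to use
  the base element \<open>\<epsilon>\<^bsub>s-1\<^esub> + \<epsilon>\<^sub>s\<close>, which is the difference of the diagonal entries \<open>s - 1\<close> and
  \<open>s + 1\<close> (counted from 0), and also that of \<open>s - 2\<close> and \<open>s\<close>. Leaving \<open>B\<close> arbitrary above
  the base of o(m) covers the base of osp(m|2) as well.
\<close>

lemma orth_root_positive:
  assumes B: "finite B" "orth_base m \<subseteq> B" and ab: "a < b" "b < m" "a + b \<noteq> m - 1"
  shows "positive_on (osp_cartan m) B (\<lambda>H. H $$ (a, a) - H $$ (b, b))"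
proof -
  let ?P = "\<lambda>a b. positive_on (osp_cartan m) B (\<lambda>H. H $$ (a, a) - H $$ (b, b))"
  define s where "s = m div 2"
  have m3: "3 \<le> m" using ab by linarith
  have trans: "?P a c" if "?P a b" "?P b c" for a b c
    using positive_on_add[OF that, of "\<lambda>H. H $$ (a, a) - H $$ (c, c)"] by simp
  have chain: "?P a b" if "a < b" "b < m" "\<And>i. a \<le> i \<Longrightarrow> i < b \<Longrightarrow> odd m \<or> i + 1 \<noteq> s" for a b
    using that
  proof (induction b)
    case (Suc b)
    have last: "?P b (Suc b)"
      using consecutive_positive[OF B, of b] Suc.prems m3 by (simp add: s_def)
    show ?case
    proof (cases "a = b")
      case False
      then have "?P a b" using Suc by (intro Suc.IH) auto
      then show ?thesis using last by (rule trans)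
    qed (use last in simp)
  qed simp
  show ?thesis
  proof (cases "odd m \<or> b < s \<or> s \<le> a")
    case True
    then show ?thesis using ab by (intro chain) auto
  next
    case False
    then have "m = 2 * s" by (simp add: s_def)
    with False m3 have ms: "m = 2 * s" "a < s" "s \<le> b" "2 \<le> s" by auto
    have last: "(\<lambda>H. eps (s - 1) H + eps s H) \<in> B"
      using B(2) ms by (auto simp: orth_base_def)
    have P1: "?P (s - 1) (s + 1)" and P2: "?P (s - 2) s"
    proof -
      have d: "dual_index m (s + 1) = s - 2" "dual_index m s = s - 1"
        using ms by (auto simp: dual_index_def)
      have "H $$ (s - 1, s - 1) - H $$ (s + 1, s + 1) = eps (s - 1) H + eps s H"
        "H $$ (s - 2, s - 2) - H $$ (s, s) = eps (s - 1) H + eps s H" if "H \<in> osp_cartan m" for H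
        using cartan_dual[OF that, of s] cartan_dual[OF that, of "s + 1"] d ms
        by (simp_all add: eps_def diff_diff_eq numeral_2_eq_2)
      then show "?P (s - 1) (s + 1)" "?P (s - 2) s"
        by (auto intro: positive_on_base[OF B(1) last])
    qed
    show ?thesis
    proof (cases "b = s")
      case True
      then have "a \<le> s - 2" using ab ms by auto
      then show ?thesis
        using P2 True chain[of a "s - 2"] trans[of a "s - 2" s] ms by (cases "a = s - 2") auto
    next
      case False
      have "?P a (s + 1)"
        using P1 chain[of a "s - 1"] trans[of a "s - 1" "s + 1"] ms by (cases "a = s - 1") auto
      then show ?thesis
        using False chain[of "s + 1" b] trans[of a "s + 1" b] ms ab by (cases "b = s + 1") auto
    qed
  qed
qed

text \<open>
  The entry at \<open>(a, b)\<close> has weight \<open>delta_degree m a - delta_degree m b\<close> in the direction of \<open>\<delta>\<^sub>1\<close>.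
\<close>

definition delta_degree :: "nat \<Rightarrow> nat \<Rightarrow> int" where
  "delta_degree m a = (if a < m then 0 else if a = m then 1 else -1)"

text \<open>
  Starting from \<open>\<delta>\<^sub>1 - \<epsilon>\<^sub>1\<close>, all \<open>\<delta>\<^sub>1 \<plusminus> \<epsilon>\<^sub>i\<close> are reached by adding roots of o(m). As
  \<open>2 \<epsilon>\<^sub>1\<close> is not a root, \<open>\<delta>\<^sub>1 + \<epsilon>\<^sub>1\<close> is reached from the preceding diagonal entry, that is, from
  \<open>\<delta>\<^sub>1 + \<epsilon>\<^sub>2\<close> (from \<open>\<delta>\<^sub>1\<close> if \<open>m = 3\<close>); for \<open>m = 2\<close> it is in the base.
\<close>

lemma osp_root_positive:
  assumes m: "1 \<le> m" and ab: "a < m + 2" "b < m + 2" "delta_degree m b < delta_degree m a"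
  shows "positive_on (osp_cartan m) (osp_base m) (\<lambda>H. H $$ (a, a) - H $$ (b, b))"
proof -
  let ?P = "\<lambda>a b. positive_on (osp_cartan m) (osp_base m) (\<lambda>H. H $$ (a, a) - H $$ (b, b))"
  note fin = finite_osp_base[of m]
  have trans: "?P a c" if "?P a b" "?P b c" for a b c
    using positive_on_add[OF that, of "\<lambda>H. H $$ (a, a) - H $$ (c, c)"] by simp
  have sub: "orth_base m \<subseteq> osp_base m" by (auto simp: osp_base_def orth_base_def)
  note even = orth_root_positive[OF fin sub]
  have first: "?P m 0"
  proof (cases "m = 1")
    case True
    have "H $$ (0, 0) = 0" if "H \<in> osp_cartan m" for H
      using cartan_dual[OF that, of 0] True by (simp add: dual_index_def)
    then show ?thesis using True
      by (intro positive_on_base[OF fin, of "delta1 m"]) (auto simp: osp_base_def delta1_def)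
  next
    case False
    then show ?thesis using m
      by (intro positive_on_base[OF fin, of "\<lambda>H. delta1 m H - eps 1 H"])
        (auto simp: osp_base_def delta1_def eps_def)
  qed
  have lt: "?P m b" if b: "b < m" for b
  proof -
    consider "b = 0" | "b \<noteq> 0" "b \<noteq> m - 1" | "b = m - 1" "m = 2" | "b = m - 1" "3 \<le> m"
      using b m by linarith
    then show ?thesis
    proof cases
      case 2
      then have "?P 0 b" using b by (intro even) auto
      with first show ?thesis by (rule trans)
    next
      case 3
      have "H $$ (1, 1) = - H $$ (0, 0)" if "H \<in> osp_cartan m" for H
        using cartan_dual[OF that, of 0] 3 by (simp add: dual_index_def)
      then show ?thesis using 3
        by (intro positive_on_base[OF fin, of "\<lambda>H. delta1 m H + eps 1 H"])
          (auto simp: osp_base_def delta1_def eps_def)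
    next
      case 4
      have "?P 0 (m - 2)" "?P (m - 2) (m - 1)" using 4 by (auto intro!: even)
      then show ?thesis using first trans 4(1) by blast
    qed (use first in simp)
  qed
  have gt: "?P a (m + 1)" if a: "a < m" for a
  proof -
    have "dual_index m a < m" using a by simp
    from lt[OF this] have "positive_on (osp_cartan m) (osp_base m)
      (\<lambda>H. H $$ (m, m) - H $$ (dual_index m a, dual_index m a))" .
    moreover have "H $$ (m, m) - H $$ (dual_index m a, dual_index m a) = H $$ (a, a) - H $$ (m + 1, m + 1)"
      if "H \<in> osp_cartan m" for H
      using cartan_dual[OF that, of a] cartan_dual[OF that, of m] a by (simp add: dual_index_def)
    ultimately show ?thesis unfolding positive_on_def by simp
  qed
  have "a = m \<and> b < m \<or> a < m \<and> b = m + 1 \<or> a = m \<and> b = m + 1"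
    using ab by (auto simp: delta_degree_def split: if_splits)
  then show ?thesis using lt gt trans[of m 0 "m + 1"] m by auto
qed

text \<open>
  The Cartan element \<open>D\<close> with \<open>\<delta>\<^sub>1 = 1\<close> and \<open>\<epsilon>\<^sub>i = 0\<close>.
\<close>

definition grading_element :: "nat \<Rightarrow> complex mat" where
  "grading_element m = mat (m + 2) (m + 2) (\<lambda>(i, j). if i = j then of_int (delta_degree m i) else 0)"

text \<open>
  A Cartan element of o(m) on which every positive root \<open>\<epsilon>\<^sub>i \<plusminus> \<epsilon>\<^sub>j\<close> or \<open>\<epsilon>\<^sub>i\<close> takes a positive
  even value, so that it separates the highest weight from all lower ones.
\<close>

definition height_element :: "nat \<Rightarrow> complex mat" where
  "height_element m = mat (m + 2) (m + 2)
     (\<lambda>(i, j). if i = j \<and> i < m then of_nat (m - 1) - 2 * of_nat i else 0)"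

definition odd_lowering :: "nat \<Rightarrow> nat \<Rightarrow> complex mat" where
  "odd_lowering m i = mat (m + 2) (m + 2) (\<lambda>ab. if ab \<in> pair_orbit m i m then 1 else 0)"

definition even_lowering :: "nat \<Rightarrow> complex mat" where
  "even_lowering m = mat (m + 2) (m + 2) (\<lambda>ab. if ab = (m + 1, m) then 1 else 0)"

lemma delta_degree_dual: "a < m + 2 \<Longrightarrow> delta_degree m (dual_index m a) = - delta_degree m a"
  by (auto simp: delta_degree_def dual_index_def)

lemma grading_cartan: "grading_element m \<in> osp_cartan m"
proof -
  have "grading_element m \<in> osp m 0"
    by (rule ospI) (auto simp: grading_element_def delta_degree_dual koszul_def index_parity_def
        dest: arg_cong[of "dual_index m _" _ "dual_index m"] split: if_splits)
  then show ?thesis by (simp add: osp_cartan_def diagonal_mat_def grading_element_def)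
qed

lemma height_cartan: "height_element m \<in> orth_cartan m"
proof -
  have "height_element m \<in> osp m 0"
  proof (rule ospI)
    fix a b assume ab: "a < m + 2" "b < m + 2"
    have "complex_of_nat (m - 1) - 2 * of_nat (m - 1 - b) = - (of_nat (m - 1) - 2 * of_nat b)" if "b < m"
      using that by (simp add: of_nat_diff algebra_simps)
    moreover have "dual_index m b = dual_index m a \<longleftrightarrow> a = b" using ab by (metis dual_index_dual_index)
    moreover have "dual_index m b = m - 1 - b" if "b < m" using that by (simp add: dual_index_def)
    ultimately show "height_element m $$ (a, b) = - (koszul 0 (index_parity m b) * index_sign m a
        * index_sign m b * height_element m $$ (dual_index m b, dual_index m a))"
      using ab by (auto simp: height_element_def koszul_def)
  qed (auto simp: height_element_def split: if_splits)
  then show ?thesis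
    by (auto simp: orth_cartan_def osp_cartan_def orth_iff diagonal_mat_def supp_def
        height_element_def split: if_splits)
qed

lemma odd_lowering_osp:
  assumes i: "i < m"
  shows "odd_lowering m i \<in> osp m 1"
proof (rule ospI)
  have d: "dual_index m m = m + 1" "dual_index m i < m" using i by (auto simp: dual_index_def)
  fix a b assume ab: "a < m + 2" "b < m + 2"
  show "index_parity m a + index_parity m b = 1" if "odd_lowering m i $$ (a, b) \<noteq> 0"
    using that ab i d by (auto simp: odd_lowering_def pair_orbit_def index_parity_def split: if_splits)
  have "koszul 1 (index_parity m b) * index_sign m a * index_sign m b = -1"
    if "(a, b) \<in> pair_orbit m i m"
    using that i d by (auto simp: pair_orbit_def index_parity_def index_sign_def koszul_def)
  then show "odd_lowering m i $$ (a, b) = - (koszul 1 (index_parity m b) * index_sign m a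
        * index_sign m b * odd_lowering m i $$ (dual_index m b, dual_index m a))"
    using ab i pair_orbit_dual[of i m m a b] by (auto simp: odd_lowering_def)
qed (simp add: odd_lowering_def)

lemma even_lowering_osp: "even_lowering m \<in> osp m 0"
proof (rule ospI)
  fix a b assume ab: "a < m + 2" "b < m + 2"
  show "index_parity m a + index_parity m b = 0" if "even_lowering m $$ (a, b) \<noteq> 0"
    using that ab by (auto simp: even_lowering_def index_parity_def split: if_splits)
  have "dual_index m b = m + 1 \<longleftrightarrow> b = m" "dual_index m a = m \<longleftrightarrow> a = m + 1"
    using ab by (auto simp: dual_index_def split: if_splits)
  then show "even_lowering m $$ (a, b) = - (koszul 0 (index_parity m b) * index_sign m a
        * index_sign m b * even_lowering m $$ (dual_index m b, dual_index m a))"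
    using ab by (auto simp: even_lowering_def koszul_def index_sign_def)
qed (simp add: even_lowering_def)

lemma odd_lowering_supp: "i < m \<Longrightarrow> supp (odd_lowering m i) = pair_orbit m i m"
  by (auto simp: odd_lowering_def pair_orbit_def supp_def dual_index_def split: if_splits)

lemma even_lowering_supp: "supp (even_lowering m) = {(m + 1, m)}"
  by (auto simp: even_lowering_def supp_def split: if_splits)

lemma supp_even_lowering:
  assumes "X \<in> carrier_mat (m + 2) (m + 2)" "supp X \<subseteq> {(m + 1, m)}"
  shows "X = X $$ (m + 1, m) \<cdot>\<^sub>m even_lowering m"
  by (rule eq_matI) (use assms in \<open>auto simp: supp_def even_lowering_def\<close>)

lemma supp_odd_lowering:
  assumes X: "X \<in> osp m p" "supp X \<subseteq> pair_orbit m i m" "X \<noteq> 0\<^sub>m (m + 2) (m + 2)" and i: "i < m"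
  shows "p = 1" "X = X $$ (i, m) \<cdot>\<^sub>m odd_lowering m i"
proof -
  obtain a b where ab: "(a, b) \<in> supp X"
    using supp_empty[OF osp_carrier[OF X(1)]] X(3) by fast
  then have "(a, b) \<in> supp (odd_lowering m i)"
    using X(2) by (auto simp: odd_lowering_supp[OF i])
  from osp_parity[OF odd_lowering_osp[OF i] this] osp_parity[OF X(1) ab]
  show p: "p = 1" by simp
  have C: "dim_row X = m + 2" "dim_col X = m + 2" using osp_dim[OF X(1)] by auto
  have d: "dual_index m i < m" "dual_index m m = m + 1" using i by (auto simp: dual_index_def)
  have e: "X $$ (m + 1, dual_index m i) = X $$ (i, m)"
    using osp_entry[OF X(1), of i m] i p d by (simp add: koszul_def index_parity_def index_sign_def)
  show "X = X $$ (i, m) \<cdot>\<^sub>m odd_lowering m i"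
  proof (rule eq_matI)
    fix c b assume "c < dim_row (X $$ (i, m) \<cdot>\<^sub>m odd_lowering m i)" "b < dim_col (X $$ (i, m) \<cdot>\<^sub>m odd_lowering m i)"
    then have cb: "c < m + 2" "b < m + 2" by (auto simp: odd_lowering_def)
    show "X $$ (c, b) = (X $$ (i, m) \<cdot>\<^sub>m odd_lowering m i) $$ (c, b)"
    proof (cases "(c, b) \<in> pair_orbit m i m")
      case True
      then show ?thesis using cb e d by (auto simp: odd_lowering_def pair_orbit_def)
    next
      case False
      then have "X $$ (c, b) = 0" using X(2) cb C by (auto simp: supp_def)
      then show ?thesis using cb False by (simp add: odd_lowering_def)
    qed
  qed (use C in \<open>auto simp: odd_lowering_def\<close>)
qed

lemma bracket_odd_lowering:
  assumes "i < m" "j < m"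
  shows "\<exists>c. super_bracket 1 1 (odd_lowering m i) (odd_lowering m j) = c \<cdot>\<^sub>m even_lowering m"
proof -
  note C = osp_carrier[OF odd_lowering_osp[OF assms(1)]] osp_carrier[OF odd_lowering_osp[OF assms(2)]]
  have d: "dual_index m m = m + 1" "dual_index m i \<noteq> m + 1" "dual_index m j \<noteq> m + 1"
    using assms by (auto simp: dual_index_def)
  have "supp (super_bracket 1 1 (odd_lowering m i) (odd_lowering m j)) \<subseteq> {(m + 1, m)}"
  proof clarify
    fix a b assume "(a, b) \<in> supp (super_bracket 1 1 (odd_lowering m i) (odd_lowering m j))"
    from bracket_supp[OF C this] show "a = m + 1 \<and> b = m"
      using assms d by (auto simp: odd_lowering_supp pair_orbit_def)
  qed
  from supp_even_lowering[OF super_bracket_carrier[OF C] this] show ?thesis by blast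
qed

lemma bracket_even_odd_lowering:
  assumes "i < m"
  shows "super_bracket 0 1 (even_lowering m) (odd_lowering m i) = 0\<^sub>m (m + 2) (m + 2)"
proof (rule supp_empty)
  note C = osp_carrier[OF even_lowering_osp] osp_carrier[OF odd_lowering_osp[OF assms(1)]]
  show "super_bracket 0 1 (even_lowering m) (odd_lowering m i) \<in> carrier_mat (m + 2) (m + 2)"
    using C by (rule super_bracket_carrier)
  have d: "dual_index m m = m + 1" "dual_index m i \<noteq> m + 1" "dual_index m i \<noteq> m"
    using assms by (auto simp: dual_index_def)
  show "supp (super_bracket 0 1 (even_lowering m) (odd_lowering m i)) = {}"
  proof (rule ccontr)
    assume "supp (super_bracket 0 1 (even_lowering m) (odd_lowering m i)) \<noteq> {}"
    then obtain a b where "(a, b) \<in> supp (super_bracket 0 1 (even_lowering m) (odd_lowering m i))" by auto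
    from bracket_supp[OF C this] show False
      using assms d by (auto simp: odd_lowering_supp even_lowering_supp pair_orbit_def)
  qed
qed


section \<open>Highest weight vectors over o(m)\<close>

lemma total_space_memI:
  assumes "X \<in> osp m p"
  shows "X \<in> total_space (osp m)"
proof (cases "p = 0")
  case True
  have "X = X + 0\<^sub>m (m + 2) (m + 2)" using osp_carrier[OF assms] by simp
  then show ?thesis using assms osp_zero[of m 1] True unfolding total_space_def by blast
next
  case False
  have "X = 0\<^sub>m (m + 2) (m + 2) + X" using osp_carrier[OF assms] by simp
  moreover have "X \<in> osp m 1" using assms False by simp
  ultimately show ?thesis using osp_zero[of m 0] unfolding total_space_def by blast
qed

lemma total_space_orth_even: "total_space (orth_even m) = orth m"
proof -
  have "X + 0\<^sub>m (m + 2) (m + 2) = X" if "X \<in> orth m" for X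
    using that osp_carrier[of X m 0] by (simp add: orth_iff)
  then show ?thesis by (force simp: total_space_def purely_even_def)
qed

lemma orth_even_orth: "X \<in> orth_even m p \<Longrightarrow> X \<in> orth m"
  by (auto simp: purely_even_def orth_zero split: if_splits)

lemma super_rep_of_supermodule:
  assumes "lie_supermodule g scale P \<rho>" "matrix_superalgebra g" "\<And>p. g p \<subseteq> total_space g"
  shows "super_rep scale g \<rho>"
proof -
  note L = assms(1)[unfolded lie_supermodule_def]
  have T: "X \<in> g p \<Longrightarrow> X \<in> total_space g" for X p using assms(3) by blast
  show ?thesis
  proof (intro super_rep.intro super_rep_axioms.intro)
    show "vector_space scale" using L by blast
    show "matrix_superalgebra g" by fact
  qed (use L T in blast)+
qed

lemma osp_rep_osp: "super_rep scale (osp m) \<rho> \<Longrightarrow> osp_rep scale (osp m) \<rho> m"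
  by (intro osp_rep.intro osp_rep_axioms.intro) auto

lemma osp_rep_orth: "super_rep scale (orth_even m) \<rho> \<Longrightarrow> osp_rep scale (orth_even m) \<rho> m"
proof (intro osp_rep.intro osp_rep_axioms.intro)
  fix X Y p assume XY: "X \<in> orth_even m p" "Y \<in> osp m p" "supp Y \<subseteq> supp X"
  show "Y \<in> orth_even m p"
  proof (cases "p = 0")
    case True
    then show ?thesis using XY by (auto simp: purely_even_def orth_iff)
  next
    case False
    then have "X = 0\<^sub>m (m + 2) (m + 2)" using XY(1) by (simp add: purely_even_def)
    then have "supp X = {}" by (simp add: supp_def)
    then have "Y = 0\<^sub>m (m + 2) (m + 2)" using XY by (intro supp_empty osp_carrier) auto
    then show ?thesis using False by (simp add: purely_even_def)
  qed
qed (auto intro: orth_even_subset)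

lemma (in super_rep) restrict_algebra:
  assumes "matrix_superalgebra g'" "\<And>p. g' p \<subseteq> g p"
  shows "super_rep scale g' \<rho>"
proof -
  have sub: "X \<in> g' p \<Longrightarrow> X \<in> g p" for X p using assms(2) by blast
  show ?thesis
  proof (intro super_rep.intro super_rep_axioms.intro)
    show "vector_space scale" ..
    show "matrix_superalgebra g'" by fact
  qed (rule linear_act[OF sub] add_act[OF sub sub] smult_act[OF sub] bracket_act[OF sub sub]; assumption)+
qed

lemma (in super_rep) product_rep:
  assumes "super_rep scale' g \<sigma>"
  shows "super_rep (\<lambda>c (a, b). (scale c a, scale' c b)) g (\<lambda>X (a, b). (\<rho> X a, \<sigma> X b))"
proof -
  interpret W: super_rep scale' g \<sigma> by fact
  have vs: "vector_space (\<lambda>c (a, b). (scale c a, scale' c b))"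
    by unfold_locales
      (auto simp: scale_right_distrib W.scale_right_distrib scale_left_distrib W.scale_left_distrib)
  show ?thesis
  proof (intro super_rep.intro super_rep_axioms.intro vs)
    show "matrix_superalgebra g" by (rule algebra)
    show "Vector_Spaces.linear (\<lambda>c (a, b). (scale c a, scale' c b)) (\<lambda>c (a, b). (scale c a, scale' c b))
        (\<lambda>(a, b). (\<rho> X a, \<sigma> X b))" if "X \<in> g p" for X p
    proof -
      show ?thesis
        unfolding Vector_Spaces.linear_iff using vs
        by (auto simp: act_add[OF that] W.act_add[OF that] act_scale[OF that] W.act_scale[OF that])
    qed
  qed (auto simp: add_act W.add_act smult_act W.smult_act bracket_act W.bracket_act)
qed

locale orth_rep = osp_rep scale "orth_even m" \<rho> m
  for scale :: "complex \<Rightarrow> 'v::ab_group_add \<Rightarrow> 'v" and \<rho> m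
begin

lemma orth_mem: "X \<in> orth m \<Longrightarrow> X \<in> orth_even m 0"
  by (simp add: purely_even_def)

text \<open>
  Highest weight vectors in terms of the upper triangular elementary matrices; these are
  either positive root vectors or zero.
\<close>

definition highest :: "(complex mat \<Rightarrow> complex) \<Rightarrow> 'v \<Rightarrow> bool" where
  "highest \<Lambda> v \<longleftrightarrow> (\<forall>H\<in>orth_cartan m. \<rho> H v = scale (\<Lambda> H) v) \<and>
     (\<forall>Y\<in>orth m. \<forall>a b. a < b \<longrightarrow> b < m \<longrightarrow> supp Y \<subseteq> pair_orbit m a b \<longrightarrow> \<rho> Y v = 0)"

definition lowering :: "complex mat set" where
  "lowering = {Y \<in> orth m. \<exists>a b. b < a \<and> a < m \<and> supp Y \<subseteq> pair_orbit m a b}"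

text \<open>
  Elementary matrices of o(m) above the diagonal kill \<open>v\<close>, diagonal ones scale it, so words in
  those below the diagonal suffice.
\<close>

lemma lowering_generates:
  assumes v: "highest \<Lambda> v"
  shows "generated scale \<rho> (orth m) {v} = generated scale \<rho> lowering (span {v})"
proof
  let ?G = "generated scale \<rho> lowering (span {v})"
  have base: "\<rho> X u \<in> ?G" if X: "X \<in> orth_even m p" and u: "u \<in> span {v}" for p X u
  proof (rule act_decompose[OF X subspace_generated])
    fix Y a b
    assume Y: "Y \<in> orth_even m p" "a < m + 2" "b < m + 2" "(a, b) \<in> supp X"
      "supp Y \<subseteq> pair_orbit m a b"
    have Yo: "Y \<in> orth m" using Y(1) by (rule orth_even_orth)
    note Y0 = orth_mem[OF Yo]
    have ab: "a < m" "b < m" using orth_even_orth[OF X] Y(4) by (auto simp: orth_iff)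
    obtain k where k: "u = scale k v" using u by (auto simp: span_singleton)
    consider "a < b" | "a = b" | "b < a" by linarith
    then show "\<rho> Y u \<in> ?G"
    proof cases
      case 1
      then have "\<rho> Y v = 0" using v Yo ab Y(5) unfolding highest_def by blast
      then show ?thesis by (simp add: k act_scale[OF Y0] gen_zero)
    next
      case 2
      have "Y \<in> osp m 0" using Yo by (simp add: orth_iff)
      then have "Y \<in> osp_cartan m" using Y 2 by (auto intro: zero_weight_elementary)
      then have "\<rho> Y v = scale (\<Lambda> Y) v" using v Yo by (simp add: highest_def orth_cartan_def)
      then have "\<rho> Y u = scale (\<Lambda> Y) u"
        by (simp add: k act_scale[OF Y0] mult.commute)
      then show ?thesis using u by (simp add: gen_scale gen_base)
    next
      case 3
      then have "Y \<in> lowering" using Yo ab Y(5) by (auto simp: lowering_def)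
      then show ?thesis using u by (intro gen_act gen_base)
    qed
  qed
  show "generated scale \<rho> (orth m) {v} \<subseteq> ?G"
  proof (rule gen_least)
    show "{v} \<subseteq> ?G" by (auto intro: gen_base span_base)
    show "\<rho> X u \<in> ?G" if "X \<in> orth m" "u \<in> ?G" for X u
      by (rule gen_stable[OF _ base that(2) orth_mem[OF that(1)]])
        (use orth_mem in \<open>auto simp: lowering_def\<close>)
  qed (rule subspace_generated)
  show "?G \<subseteq> generated scale \<rho> (orth m) {v}"
  proof (rule gen_least)
    show "span {v} \<subseteq> generated scale \<rho> (orth m) {v}"
      by (rule span_minimal) (auto intro: gen_base subspace_generated)
  qed (auto simp: subspace_generated lowering_def intro: gen_act)
qed

text \<open>
  Every letter strictly lowers the eigenvalue of the height element, so in the module generated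
  by \<open>v\<close> only the multiples of \<open>v\<close> have the eigenvalue of \<open>v\<close>.
\<close>

lemma highest_weight_line:
  assumes v: "highest \<Lambda> v" and u: "u \<in> generated scale \<rho> (orth m) {v}"
    and H: "\<rho> (height_element m) u = scale (\<Lambda> (height_element m)) u"
  shows "u \<in> span {v}"
proof (rule gen_top)
  note hc = height_cartan[of m]
  then have ho: "height_element m \<in> orth m" by (simp add: orth_cartan_def)
  show D: "height_element m \<in> orth_even m 0" using ho by (rule orth_mem)
  show "\<exists>q n. Y \<in> orth_even m q \<and>
      height_element m * Y - Y * height_element m = - of_nat (Suc n) \<cdot>\<^sub>m Y" if Yl: "Y \<in> lowering" for Y
  proof -
    obtain a b where Y: "Y \<in> orth m" "b < a" "a < m" "supp Y \<subseteq> pair_orbit m a b"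
      using Yl unfolding lowering_def by blast
    have "height_element m * Y - Y * height_element m
        = (height_element m $$ (a, a) - height_element m $$ (b, b)) \<cdot>\<^sub>m Y"
      by (rule elementary_root) (use Y hc in \<open>auto simp: orth_cartan_def orth_iff\<close>)
    also have "height_element m $$ (a, a) - height_element m $$ (b, b) = - of_nat (2 * (a - b))"
      using Y(2,3) by (simp add: height_element_def of_nat_diff)
    also have "2 * (a - b) = Suc (2 * (a - b) - 1)"
      using Y(2) by simp
    finally show ?thesis using orth_mem[OF Y(1)] by blast
  qed
  show "subspace (span {v})" by (rule subspace_span)
  show "\<rho> (height_element m) w = scale (\<Lambda> (height_element m)) w" if "w \<in> span {v}" for w
    using that v hc unfolding span_singleton highest_def
    by (auto simp: act_scale[OF D] scale_left_commute)
  show "u \<in> generated scale \<rho> lowering (span {v})"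
    using u unfolding lowering_generates[OF v] .
qed (rule H)

end

lemma orth_cartan_subset: "orth_cartan m \<subseteq> osp_cartan m"
  by (auto simp: orth_cartan_def)

lemma cartan_carrier: "H \<in> osp_cartan m \<Longrightarrow> H \<in> carrier_mat (m + 2) (m + 2)"
  using cartan_osp osp_carrier by blast

lemma dual_space_add_root:
  assumes "\<mu> \<in> dual_space h" "h \<subseteq> osp_cartan m" "a < m + 2" "b < m + 2"
  shows "(\<lambda>H. \<mu> H + (H $$ (a, a) - H $$ (b, b))) \<in> dual_space h"
proof -
  have *: "dim_row X = m + 2" "dim_col X = m + 2" if "X \<in> h" for X
    using cartan_carrier[of X m] assms(2) that by auto
  show ?thesis
    using assms(1,3,4) by (auto simp: dual_space_def * algebra_simps)
qed

lemma (in osp_rep) elementary_shifts_weight: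
  assumes h: "h \<subseteq> osp_cartan m" "h \<subseteq> g 0" and Y: "Y \<in> g p" "supp Y \<subseteq> pair_orbit m a b"
    and ab: "a < m + 2" "b < m + 2" and u: "u \<in> weight_space h scale \<rho> \<mu>"
  shows "\<rho> Y u \<in> weight_space h scale \<rho> (\<lambda>H. \<mu> H + (H $$ (a, a) - H $$ (b, b)))"
  unfolding weight_space_def
proof safe
  fix H assume H: "H \<in> h"
  then have "H * Y - Y * H = (H $$ (a, a) - H $$ (b, b)) \<cdot>\<^sub>m Y"
    using elementary_root[OF _ sub_osp[OF Y(1)] Y(2) ab] h by blast
  moreover have "\<rho> H u = scale (\<mu> H) u" using u H by (simp add: weight_space_def)
  ultimately show "\<rho> H (\<rho> Y u) = scale (\<mu> H + (H $$ (a, a) - H $$ (b, b))) (\<rho> Y u)"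
    using root_act[of H Y p "H $$ (a, a) - H $$ (b, b)" u] H h(2) Y(1)
    by (auto simp: act_scale[OF Y(1)] scale_left_distrib)
qed

lemma (in orth_rep) generated_weight_span:
  assumes v: "highest \<Lambda> v" and \<Lambda>: "\<Lambda> \<in> dual_space (orth_cartan m)"
  shows "generated scale \<rho> (orth m) {v}
    \<subseteq> span (\<Union>\<mu>\<in>dual_space (orth_cartan m). weight_space (orth_cartan m) scale \<rho> \<mu>)"
    (is "_ \<subseteq> span ?S")
  unfolding lowering_generates[OF v]
proof (rule gen_least)
  have "v \<in> ?S" using v \<Lambda> by (auto simp: highest_def weight_space_def)
  then show "span {v} \<subseteq> span ?S" by (intro span_mono) auto
  show "subspace (span ?S)" by (rule subspace_span)
  fix Y u assume Y: "Y \<in> lowering" and u: "u \<in> span ?S"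
  then obtain a b where ab: "b < a" "a < m" "supp Y \<subseteq> pair_orbit m a b" and Yo: "Y \<in> orth m"
    by (auto simp: lowering_def)
  have h: "orth_cartan m \<subseteq> orth_even m 0" using orth_mem by (auto simp: orth_cartan_def)
  note Y0 = orth_mem[OF Yo]
  show "\<rho> Y u \<in> span ?S" using u
  proof (induction rule: span_induct_alt)
    case base
    then show ?case by (simp add: act_zero[OF Y0] span_zero)
  next
    case (step c x y)
    then obtain \<mu> where \<mu>: "\<mu> \<in> dual_space (orth_cartan m)" "x \<in> weight_space (orth_cartan m) scale \<rho> \<mu>"
      by blast
    have "\<rho> Y x \<in> ?S"
      using elementary_shifts_weight[OF orth_cartan_subset h Y0 ab(3) _ _ \<mu>(2)]
        dual_space_add_root[OF \<mu>(1) orth_cartan_subset, of a b] ab by fastforce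
    then have "scale c (\<rho> Y x) + \<rho> Y y \<in> span ?S"
      using step by (intro span_add span_scale) (auto intro: span_base)
    then show ?case by (simp add: act_add[OF Y0] act_scale[OF Y0])
  qed
qed


section \<open>The top layer of a highest weight osp(m|2)-module\<close>

text \<open>
  A highest weight vector in terms of elementary matrices: the positive root vectors are the
  upper triangular ones in o(m) together with those of positive \<open>\<delta>\<^sub>1\<close>-degree.
\<close>

locale osp_highest_rep = osp_rep scale "osp m" \<rho> m
  for scale :: "complex \<Rightarrow> 'v::ab_group_add \<Rightarrow> 'v" and \<rho> m +
  fixes \<Lambda> :: "complex mat \<Rightarrow> complex" and v :: 'v
  assumes cartan_weight: "H \<in> osp_cartan m \<Longrightarrow> \<rho> H v = scale (\<Lambda> H) v"
    and orth_raising: "Y \<in> orth m \<Longrightarrow> a < b \<Longrightarrow> b < m \<Longrightarrow> supp Y \<subseteq> pair_orbit m a b \<Longrightarrow> \<rho> Y v = 0"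
    and delta_raising: "Y \<in> osp m p \<Longrightarrow> a < m + 2 \<Longrightarrow> b < m + 2 \<Longrightarrow>
      delta_degree m b < delta_degree m a \<Longrightarrow> supp Y \<subseteq> pair_orbit m a b \<Longrightarrow> \<rho> Y v = 0"
begin

sublocale orth: orth_rep scale \<rho> m
proof (intro orth_rep.intro osp_rep_orth restrict_algebra superalgebra_orth)
  show "orth_even m p \<subseteq> osp m p" for p by (auto intro: orth_even_subset)
qed

lemma orth_osp: "X \<in> orth m \<Longrightarrow> X \<in> osp m 0"
  by (simp add: orth_iff)

lemma orth_highest: "orth.highest \<Lambda> v"
  using cartan_weight orth_raising orth_cartan_subset unfolding orth.highest_def by blast

definition top_layer :: "'v set" where
  "top_layer = generated scale \<rho> (orth m) {v}"

lemma top_layer_induct: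
  assumes "subspace K" "v \<in> K" "\<And>X u. X \<in> orth m \<Longrightarrow> u \<in> K \<Longrightarrow> \<rho> X u \<in> K"
  shows "top_layer \<subseteq> K"
  unfolding top_layer_def by (rule gen_least) (use assms in auto)

lemma top_layer_props:
  "subspace top_layer" "v \<in> top_layer" "X \<in> orth m \<Longrightarrow> u \<in> top_layer \<Longrightarrow> \<rho> X u \<in> top_layer"
  unfolding top_layer_def by (auto intro: subspace_generated gen_base gen_act)

text \<open>
  The vectors killed by everything of positive degree form an o(m)-submodule, since
  brackets with o(m) preserve the degree; it contains \<open>v\<close>.
\<close>

lemma raising_kills_top:
  assumes X: "X \<in> osp m p" "\<And>a b. (a, b) \<in> supp X \<Longrightarrow> delta_degree m b < delta_degree m a"
    and w: "w \<in> top_layer"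
  shows "\<rho> X w = 0"
proof -
  define K where "K = {w. \<forall>p. \<forall>X\<in>osp m p.
    (\<forall>(a, b)\<in>supp X. delta_degree m b < delta_degree m a) \<longrightarrow> \<rho> X w = 0}"
  have "top_layer \<subseteq> K"
  proof (rule top_layer_induct)
    show "subspace K"
      by (auto simp: subspace_def K_def act_zero act_add act_scale)
    show "v \<in> K"
      unfolding K_def
    proof (intro CollectI allI ballI impI)
      fix p X assume X: "X \<in> osp m p" "\<forall>(a, b)\<in>supp X. delta_degree m b < delta_degree m a"
      have "\<rho> X v \<in> {0}"
        by (rule act_decompose[OF X(1)]) (use X(2) delta_raising in \<open>auto simp: subspace_def\<close>)
      then show "\<rho> X v = 0" by simp
    qed
    fix Z u assume Z: "Z \<in> orth m" and u: "u \<in> K"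
    show "\<rho> Z u \<in> K"
      unfolding K_def
    proof (intro CollectI allI ballI impI)
      fix p X assume X: "X \<in> osp m p" "\<forall>(a, b)\<in>supp X. delta_degree m b < delta_degree m a"
      let ?B = "super_bracket p 0 X Z"
      have "?B \<in> osp m p" using osp_bracket[OF X(1) orth_osp[OF Z]] by (simp only: add_0_right)
      moreover have "\<forall>(a, b)\<in>supp ?B. delta_degree m b < delta_degree m a"
      proof clarify
        fix a b assume "(a, b) \<in> supp ?B"
        from bracket_supp[OF osp_carrier[OF X(1)] osp_carrier[OF orth_osp[OF Z]] this]
        moreover have "delta_degree m c = delta_degree m d" if "(c, d) \<in> supp Z" for c d
          using that Z by (auto simp: orth_iff delta_degree_def)
        ultimately show "delta_degree m b < delta_degree m a" using X(2) by fastforce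
      qed
      ultimately have "\<rho> ?B u = 0" using u by (auto simp: K_def)
      moreover have "\<rho> X u = 0" using u X by (auto simp: K_def)
      ultimately show "\<rho> X (\<rho> Z u) = 0"
        by (simp add: swap_act[OF X(1) orth_osp[OF Z]] act_zero[OF orth_osp[OF Z]])
    qed
  qed
  then show ?thesis using w X unfolding K_def by blast
qed

lemma grading_commutator:
  assumes "X \<in> osp m p" "\<And>a b. (a, b) \<in> supp X \<Longrightarrow> delta_degree m a - delta_degree m b = k"
  shows "grading_element m * X - X * grading_element m = of_int k \<cdot>\<^sub>m X"
proof (rule diagonal_commutator)
  show "grading_element m \<in> carrier_mat (m + 2) (m + 2)" "diagonal_mat (grading_element m)"
    using grading_cartan[of m] by (auto simp: osp_cartan_def cartan_carrier[OF grading_cartan])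
  show C: "X \<in> carrier_mat (m + 2) (m + 2)" using assms(1) by (rule osp_carrier)
  fix i j assume "(i, j) \<in> supp X"
  moreover from this have "i < m + 2" "j < m + 2" using C by (auto simp: supp_def)
  ultimately show "grading_element m $$ (i, i) - grading_element m $$ (j, j) = of_int k"
    using assms(2) by (force simp: grading_element_def simp flip: of_int_diff)
qed

abbreviation "\<Lambda>\<^sub>D \<equiv> \<Lambda> (grading_element m)"

lemma grading_top:
  assumes "w \<in> top_layer"
  shows "\<rho> (grading_element m) w = scale \<Lambda>\<^sub>D w"
proof -
  note D = cartan_osp[OF grading_cartan[of m]]
  have "top_layer \<subseteq> {w. \<rho> (grading_element m) w = scale \<Lambda>\<^sub>D w}"
  proof (rule top_layer_induct)
    show "subspace {w. \<rho> (grading_element m) w = scale \<Lambda>\<^sub>D w}"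
      by (auto simp: subspace_def act_zero[OF D] act_add[OF D] act_scale[OF D]
          scale_right_distrib mult.commute)
    show "v \<in> {w. \<rho> (grading_element m) w = scale \<Lambda>\<^sub>D w}"
      using cartan_weight[OF grading_cartan] by simp
    fix X u assume X: "X \<in> orth m" and u: "u \<in> {w. \<rho> (grading_element m) w = scale \<Lambda>\<^sub>D w}"
    have "grading_element m * X - X * grading_element m = of_int 0 \<cdot>\<^sub>m X"
      by (rule grading_commutator[OF orth_osp[OF X]])
        (use X in \<open>auto simp: orth_iff delta_degree_def\<close>)
    from root_act[OF D orth_osp[OF X] this, of u] u
    show "\<rho> X u \<in> {w. \<rho> (grading_element m) w = scale \<Lambda>\<^sub>D w}"
      by (simp add: act_scale[OF orth_osp[OF X]])
  qed
  then show ?thesis using assms by blast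
qed

text \<open>
  All homogeneous matrices of negative degree; odd ones have degree -1 and even ones -2.
\<close>

definition delta_lowering :: "complex mat set" where
  "delta_lowering = {X. \<exists>p. X \<in> osp m p \<and> (\<forall>(a, b)\<in>supp X. delta_degree m a < delta_degree m b)}"

lemma delta_lowering_commutator:
  assumes "X \<in> delta_lowering"
  shows "\<exists>q n. X \<in> osp m q \<and>
    grading_element m * X - X * grading_element m = (- of_nat (Suc n)) \<cdot>\<^sub>m X"
proof -
  obtain p where X: "X \<in> osp m p" "\<And>a b. (a, b) \<in> supp X \<Longrightarrow> delta_degree m a < delta_degree m b"
    using assms by (auto simp: delta_lowering_def)
  let ?n = "if p = 1 then 0 else 1 :: nat"
  have "grading_element m * X - X * grading_element m = of_int (- int (Suc ?n)) \<cdot>\<^sub>m X"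
  proof (rule grading_commutator[OF X(1)])
    fix a b assume "(a, b) \<in> supp X"
    from osp_parity[OF X(1) this] X(2)[OF this]
    show "delta_degree m a - delta_degree m b = - int (Suc ?n)"
      by (auto simp: delta_degree_def index_parity_def split: if_splits)
  qed
  also have "of_int (- int (Suc ?n)) = (- of_nat (Suc ?n) :: complex)" by simp
  finally show ?thesis using X(1) by blast
qed

lemma delta_degree_orbit:
  assumes "(i, j) \<in> pair_orbit m a b" "a < m + 2" "b < m + 2"
  shows "delta_degree m i - delta_degree m j = delta_degree m a - delta_degree m b"
  using assms by (auto simp: pair_orbit_def delta_degree_dual)

text \<open>
  By \<open>gen_stable\<close> it suffices to act on \<open>U\<close>: positive degree kills it, degree 0 is o(m) and
  \<open>D\<close>, and negative degree is among the generators.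
\<close>

lemma lowering_of_top_stable:
  assumes U: "subspace U" "U \<subseteq> top_layer" "\<And>Z u. Z \<in> orth m \<Longrightarrow> u \<in> U \<Longrightarrow> \<rho> Z u \<in> U"
    and X: "X \<in> osp m p" and x: "x \<in> generated scale \<rho> delta_lowering U"
  shows "\<rho> X x \<in> generated scale \<rho> delta_lowering U"
proof (rule gen_stable[OF _ _ x X])
  show "delta_lowering \<subseteq> (\<Union>p. osp m p)" by (auto simp: delta_lowering_def)
  fix p X u assume X: "X \<in> osp m p" and u: "u \<in> U"
  show "\<rho> X u \<in> generated scale \<rho> delta_lowering U"
  proof (rule act_decompose[OF X subspace_generated])
    fix Y a b
    assume Y: "Y \<in> osp m p" "supp Y \<subseteq> pair_orbit m a b" and ab: "a < m + 2" "b < m + 2" "(a, b) \<in> supp X"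
    have deg: "delta_degree m i - delta_degree m j = delta_degree m a - delta_degree m b"
      if "(i, j) \<in> supp Y" for i j
      using that Y(2) ab(1,2) by (intro delta_degree_orbit) auto
    consider "delta_degree m b < delta_degree m a" | "delta_degree m a < delta_degree m b"
      | "a < m" "b < m" | "a = b" "m \<le> a"
      using ab(1,2) by (fastforce simp: delta_degree_def split: if_splits)
    then show "\<rho> Y u \<in> generated scale \<rho> delta_lowering U"
    proof cases
      case 1
      have "\<rho> Y u = 0" by (rule raising_kills_top[OF Y(1)]) (use 1 deg u U(2) in force)+
      then show ?thesis by (simp add: gen_zero)
    next
      case 2
      then have "Y \<in> delta_lowering" using deg Y(1) unfolding delta_lowering_def by force
      then show ?thesis using u by (intro gen_act gen_base)
    next
      case 3
      then have "p = 0" using osp_parity[OF X ab(3)] by (simp add: index_parity_def)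
      moreover have "pair_orbit m a b \<subseteq> {..<m} \<times> {..<m}" using 3 by (auto simp: pair_orbit_def)
      ultimately have "Y \<in> orth m" using Y by (auto simp: orth_iff)
      then show ?thesis using u U(3) by (intro gen_base)
    next
      case 4
      then have p: "p = 0" using osp_parity[OF X ab(3)] by (auto simp: index_parity_def)
      let ?c = "Y $$ (m, m)"
      have dim: "dim_row Y = m + 2" "dim_col Y = m + 2" using osp_dim[OF Y(1)] by auto
      have e: "Y $$ (m + 1, m + 1) = - ?c"
        using osp_entry[OF Y(1), of m m] p by (simp add: koszul_def dual_index_def index_sign_def)
      have supp: "(i, j) \<in> {(m, m), (m + 1, m + 1)}" if "(i, j) \<in> supp Y" for i j
        using that Y(2) 4 ab(1) by (auto simp: pair_orbit_def dual_index_def split: if_splits)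
      have "Y = ?c \<cdot>\<^sub>m grading_element m"
      proof (rule eq_matI)
        fix i j assume "i < dim_row (?c \<cdot>\<^sub>m grading_element m)" "j < dim_col (?c \<cdot>\<^sub>m grading_element m)"
        then have ij: "i < m + 2" "j < m + 2" by (auto simp: grading_element_def)
        show "Y $$ (i, j) = (?c \<cdot>\<^sub>m grading_element m) $$ (i, j)"
        proof (cases "(i, j) \<in> {(m, m), (m + 1, m + 1)}")
          case True
          then show ?thesis using e ij by (auto simp: grading_element_def delta_degree_def)
        next
          case False
          then have "Y $$ (i, j) = 0" using supp[of i j] ij dim by (auto simp: supp_def)
          moreover have "i = j \<Longrightarrow> i < m" using False ij by auto
          ultimately show ?thesis using ij by (auto simp: grading_element_def delta_degree_def)
        qed
      qed (use dim in \<open>auto simp: grading_element_def\<close>)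
      then have "\<rho> Y u = scale ?c (\<rho> (grading_element m) u)"
        using smult_act[OF cartan_osp[OF grading_cartan[of m]]] by metis
      also have "\<dots> = scale ?c (scale \<Lambda>\<^sub>D u)"
        using grading_top u U(2) by (metis subsetD)
      finally show ?thesis using u by (simp add: gen_scale gen_base)
    qed
  qed
qed

lemma lowering_top_part:
  assumes U: "subspace U" "U \<subseteq> top_layer"
    and x: "x \<in> generated scale \<rho> delta_lowering U" "\<rho> (grading_element m) x = scale \<Lambda>\<^sub>D x"
  shows "x \<in> U"
  by (rule gen_top[OF cartan_osp[OF grading_cartan] delta_lowering_commutator U(1) _ x])
    (use grading_top U(2) in auto)

end

text \<open>
  Homogeneous letters turn homogeneous vectors into homogeneous vectors, so the span of the
  words contains the parity components of its elements, as a submodule must.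
\<close>

lemma generated_graded:
  assumes L: "lie_supermodule g scale P \<rho>" and T: "\<And>p. g p \<subseteq> total_space g"
    and N: "N \<subseteq> (\<Union>p. g p)" and U: "U \<subseteq> P q"
    and x: "x \<in> generated scale \<rho> N U"
  shows "\<exists>a\<in>generated scale \<rho> N U \<inter> P 0. \<exists>b\<in>generated scale \<rho> N U \<inter> P 1. x = a + b"
proof -
  let ?G = "generated scale \<rho> N U"
  interpret vector_space scale using L by (simp add: lie_supermodule_def)
  have sub: "subspace (P p)" for p using L by (simp add: lie_supermodule_def parity_decomposition_def)
  have P0: "0 \<in> P p" for p using subspace_0[OF sub] .
  have act: "\<rho> X u \<in> P (p + r)" if "X \<in> g p" "u \<in> P r" for X u p r
    using L that unfolding lie_supermodule_def by blast
  have add: "\<rho> X (u + w) = \<rho> X u + \<rho> X w" if "X \<in> g p" for X p u w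
  proof -
    have "Vector_Spaces.linear scale scale (\<rho> X)"
      using L T that unfolding lie_supermodule_def by blast
    then show ?thesis by (simp add: Vector_Spaces.linear_iff)
  qed
  show ?thesis using x
  proof induction
    case (gen_base u)
    have "q = 0 \<or> q = 1" by (cases q) auto
    then show ?case
    proof
      assume "q = 0"
      then show ?case using gen_base U P0 by (intro bexI[of _ u] bexI[of _ 0]) (auto intro: generated.intros)
    next
      assume "q = 1"
      then show ?case using gen_base U P0 by (intro bexI[of _ 0] bexI[of _ u]) (auto intro: generated.intros)
    qed
  next
    case gen_zero
    then show ?case using P0 by (intro bexI[of _ 0]) (auto intro: generated.intros)
  next
    case (gen_add u w)
    then obtain a b a' b' where "a \<in> ?G \<inter> P 0" "b \<in> ?G \<inter> P 1" "u = a + b"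
      "a' \<in> ?G \<inter> P 0" "b' \<in> ?G \<inter> P 1" "w = a' + b'" by metis
    then show ?case
      by (intro bexI[of _ "a + a'"] bexI[of _ "b + b'"])
        (auto intro: generated.gen_add subspace_add[OF sub])
  next
    case (gen_scale u c)
    then obtain a b where "a \<in> ?G \<inter> P 0" "b \<in> ?G \<inter> P 1" "u = a + b" by metis
    then show ?case
      by (intro bexI[of _ "scale c a"] bexI[of _ "scale c b"])
        (auto intro: generated.gen_scale subspace_scale[OF sub] simp: scale_right_distrib)
  next
    case (gen_act u X)
    then obtain a b where ab: "a \<in> ?G \<inter> P 0" "b \<in> ?G \<inter> P 1" "u = a + b" by metis
    obtain p where p: "X \<in> g p" using N gen_act by blast
    have "p = 0 \<or> p = 1" by (cases p) auto
    then show ?case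
    proof
      assume "p = 0"
      then show ?case using ab gen_act act[OF p, of a 0] act[OF p, of b 1] add[OF p]
        by (intro bexI[of _ "\<rho> X a"] bexI[of _ "\<rho> X b"]) (auto intro: generated.gen_act)
    next
      assume "p = 1"
      then show ?case using ab gen_act act[OF p, of a 0] act[OF p, of b 1] add[OF p]
        by (intro bexI[of _ "\<rho> X b"] bexI[of _ "\<rho> X a"]) (auto intro: generated.gen_act)
    qed
  qed
qed


section \<open>Uniqueness of the simple highest weight o(m)-module\<close>

lemma generated_pair_fst:
  "x \<in> generated (\<lambda>c (a, b). (scale c a, scale' c b)) (\<lambda>X (a, b). (\<rho> X a, \<sigma> X b)) N {(v, v')} \<Longrightarrow>
    fst x \<in> generated scale \<rho> N {v}"
  by (induction rule: generated.induct) (auto intro: generated.intros)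

lemma generated_pair_snd:
  "x \<in> generated (\<lambda>c (a, b). (scale c a, scale' c b)) (\<lambda>X (a, b). (\<rho> X a, \<sigma> X b)) N {(v, v')} \<Longrightarrow>
    snd x \<in> generated scale' \<sigma> N {v'}"
  by (induction rule: generated.induct) (auto intro: generated.intros)

lemma generated_pair_fst_onto:
  assumes "a \<in> generated scale \<rho> N {v}"
  shows "\<exists>b. (a, b) \<in> generated (\<lambda>c (a, b). (scale c a, scale' c b)) (\<lambda>X (a, b). (\<rho> X a, \<sigma> X b)) N {(v, v')}"
    (is "\<exists>b. _ \<in> ?R")
  using assms
proof induction
  case (gen_base u)
  then have "(u, v') \<in> ?R" by (intro generated.gen_base) auto
  then show ?case ..
next
  case gen_zero
  have "(0, 0) \<in> ?R" unfolding zero_prod_def[symmetric] by (rule generated.gen_zero)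
  then show ?case ..
next
  case (gen_add u w)
  then obtain b b' where "(u, b) \<in> ?R" "(w, b') \<in> ?R" by blast
  from generated.gen_add[OF this] show ?case by auto
next
  case (gen_scale u c)
  then obtain b where "(u, b) \<in> ?R" by blast
  from generated.gen_scale[OF this, of c] show ?case by auto
next
  case (gen_act u X)
  then obtain b where "(u, b) \<in> ?R" by blast
  from generated.gen_act[OF this \<open>X \<in> N\<close>] show ?case by auto
qed

lemma generated_pair_snd_onto:
  assumes "b \<in> generated scale' \<sigma> N {v'}"
  shows "\<exists>a. (a, b) \<in> generated (\<lambda>c (a, b). (scale c a, scale' c b)) (\<lambda>X (a, b). (\<rho> X a, \<sigma> X b)) N {(v, v')}"
    (is "\<exists>a. _ \<in> ?R")
  using assms
proof induction
  case (gen_base u)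
  then have "(v, u) \<in> ?R" by (intro generated.gen_base) auto
  then show ?case ..
next
  case gen_zero
  have "(0, 0) \<in> ?R" unfolding zero_prod_def[symmetric] by (rule generated.gen_zero)
  then show ?case ..
next
  case (gen_add u w)
  then obtain b b' where "(b, u) \<in> ?R" "(b', w) \<in> ?R" by blast
  from generated.gen_add[OF this] show ?case by auto
next
  case (gen_scale u c)
  then obtain b where "(b, u) \<in> ?R" by blast
  from generated.gen_scale[OF this, of c] show ?case by auto
next
  case (gen_act u X)
  then obtain b where "(b, u) \<in> ?R" by blast
  from generated.gen_act[OF this \<open>X \<in> N\<close>] show ?case by auto
qed

text \<open>
  The graph of the isomorphism is the submodule \<open>R\<close> of the product generated by the pair of
  highest weight vectors. Its highest weight space is the line through that pair, so
  neither \<open>(v, 0)\<close> nor \<open>(0, v')\<close> belongs to it. The vectors \<open>a\<close> with \<open>(a, 0)\<close> in \<open>R\<close> form a submodule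
  without \<open>v\<close>, hence 0 by simplicity, and likewise on the other side: \<open>R\<close> is a bijection.
\<close>

lemma highest_weight_iso:
  fixes scale :: "complex \<Rightarrow> 'v::ab_group_add \<Rightarrow> 'v" and scale' :: "complex \<Rightarrow> 'w::ab_group_add \<Rightarrow> 'w"
  assumes V: "orth_rep scale \<rho> m" and W: "orth_rep scale' \<sigma> m"
    and v: "orth_rep.highest scale \<rho> m \<Lambda> v" "v \<noteq> 0"
    and v': "orth_rep.highest scale' \<sigma> m \<Lambda> v'" "v' \<noteq> 0"
    and simple: "\<And>U. module.subspace scale U \<Longrightarrow> U \<subseteq> generated scale \<rho> (orth m) {v} \<Longrightarrow>
      (\<And>X u. X \<in> orth m \<Longrightarrow> u \<in> U \<Longrightarrow> \<rho> X u \<in> U) \<Longrightarrow> U \<noteq> {0} \<Longrightarrow> v \<in> U"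
    and simple': "\<And>U. module.subspace scale' U \<Longrightarrow> U \<subseteq> generated scale' \<sigma> (orth m) {v'} \<Longrightarrow>
      (\<And>X u. X \<in> orth m \<Longrightarrow> u \<in> U \<Longrightarrow> \<sigma> X u \<in> U) \<Longrightarrow> U \<noteq> {0} \<Longrightarrow> v' \<in> U"
    and total: "generated scale' \<sigma> (orth m) {v'} = UNIV"
  obtains \<phi> where "Vector_Spaces.linear scale' scale \<phi>" "inj \<phi>"
    "range \<phi> = generated scale \<rho> (orth m) {v}" "\<forall>X\<in>orth m. \<forall>w. \<phi> (\<sigma> X w) = \<rho> X (\<phi> w)"
proof -
  let ?s = "\<lambda>c (a, b). (scale c a, scale' c b)" and ?\<pi> = "\<lambda>X (a, b). (\<rho> X a, \<sigma> X b)"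
  interpret V: orth_rep scale \<rho> m by fact
  interpret W: orth_rep scale' \<sigma> m by fact
  interpret R: orth_rep ?s ?\<pi> m
    by (intro orth_rep.intro osp_rep_orth V.product_rep W.super_rep_axioms)
  have hw: "R.highest \<Lambda> (v, v')"
    using v(1) v'(1) unfolding R.highest_def V.highest_def W.highest_def
    by (auto simp: zero_prod_def)
  define R where "R = generated ?s ?\<pi> (orth m) {(v, v')}"
  note intros = generated.intros[where scale = ?s and \<rho> = ?\<pi> and N = "orth m" and U = "{(v, v')}", folded R_def]
  have zero: "(0, 0) \<in> R" using intros(2) by (simp add: zero_prod_def)
  have add: "(a + a', b + b') \<in> R" if "(a, b) \<in> R" "(a', b') \<in> R" for a b a' b'
    using intros(3)[OF that] by simp
  have sc: "(scale c a, scale' c b) \<in> R" if "(a, b) \<in> R" for a b c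
    using intros(4)[OF that] by simp
  have act: "(\<rho> X a, \<sigma> X b) \<in> R" if "(a, b) \<in> R" "X \<in> orth m" for a b X
    using intros(5)[OF that] by simp
  have h: "height_element m \<in> orth_cartan m" by (rule height_cartan)
  have line: "\<exists>k. (a, b) = (scale k v, scale' k v')"
    if "(a, b) \<in> R" "\<rho> (height_element m) a = scale (\<Lambda> (height_element m)) a"
      "\<sigma> (height_element m) b = scale' (\<Lambda> (height_element m)) b" for a b
  proof -
    have "(a, b) \<in> R.span {(v, v')}"
      by (rule R.highest_weight_line[OF hw]) (use that in \<open>auto simp: R_def\<close>)
    then show ?thesis by (auto simp: R.span_singleton)
  qed
  have D: "height_element m \<in> orth_even m 0" using h V.orth_mem by (simp add: orth_cartan_def)
  have left: "a = 0" if "(a, 0) \<in> R" for a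
  proof (rule ccontr)
    assume "a \<noteq> 0"
    let ?U = "{a. (a, 0) \<in> R}"
    have "v \<in> ?U"
    proof (rule simple)
      show "V.subspace ?U"
        using zero add[of _ 0 _ 0] sc[of _ 0] by (auto simp: V.subspace_def)
      show "?U \<subseteq> generated scale \<rho> (orth m) {v}"
        using generated_pair_fst[of _ scale scale' \<rho> \<sigma> "orth m" v v'] by (force simp: R_def)
      show "\<rho> X u \<in> ?U" if "X \<in> orth m" "u \<in> ?U" for X u
        using act[of u 0 X] that W.act_zero[OF W.orth_mem[OF that(1)]] by simp
      show "?U \<noteq> {0}" using \<open>a \<noteq> 0\<close> that by blast
    qed
    then have "\<exists>k. (v, 0) = (scale k v, scale' k v')"
      using v(1) h by (intro line) (auto simp: V.highest_def W.act_zero[OF D])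
    then show False using v(2) v'(2) by auto
  qed
  have right: "b = 0" if "(0, b) \<in> R" for b
  proof (rule ccontr)
    assume "b \<noteq> 0"
    let ?U = "{b. (0, b) \<in> R}"
    have "v' \<in> ?U"
    proof (rule simple')
      show "W.subspace ?U"
        using zero add[of 0 _ 0] sc[of 0] by (auto simp: W.subspace_def)
      show "?U \<subseteq> generated scale' \<sigma> (orth m) {v'}"
        using generated_pair_snd[of _ scale scale' \<rho> \<sigma> "orth m" v v'] by (force simp: R_def)
      show "\<sigma> X u \<in> ?U" if "X \<in> orth m" "u \<in> ?U" for X u
        using act[of 0 u X] that V.act_zero[OF V.orth_mem[OF that(1)]] by simp
      show "?U \<noteq> {0}" using \<open>b \<noteq> 0\<close> that by blast
    qed
    then have "\<exists>k. (0, v') = (scale k v, scale' k v')"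
      using v'(1) h by (intro line) (auto simp: W.highest_def V.act_zero[OF D])
    then show False using v(2) v'(2) by auto
  qed
  have diff: "(a - a', b - b') \<in> R" if "(a, b) \<in> R" "(a', b') \<in> R" for a b a' b'
    using add[OF that(1) sc[OF that(2), of "-1"]] by simp
  have "\<exists>a. (a, b) \<in> R" for b
    using generated_pair_snd_onto[of b scale' \<sigma> "orth m" v' scale \<rho> v] total by (simp add: R_def)
  then obtain \<phi> where \<phi>: "\<And>b. (\<phi> b, b) \<in> R" by metis
  have graph: "a = \<phi> b" if "(a, b) \<in> R" for a b
    using left[of "a - \<phi> b"] diff[OF that \<phi>[of b]] by simp
  show ?thesis
  proof
    show "Vector_Spaces.linear scale' scale \<phi>"
      using V.vector_space_axioms W.vector_space_axioms add[OF \<phi> \<phi>, THEN graph] sc[OF \<phi>, THEN graph]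
      by (simp add: Vector_Spaces.linear_iff)
    show "inj \<phi>"
    proof (rule injI)
      fix b b' assume "\<phi> b = \<phi> b'"
      then show "b = b'" using right[of "b - b'"] diff[OF \<phi>[of b] \<phi>[of b']] by simp
    qed
    show "range \<phi> = generated scale \<rho> (orth m) {v}"
    proof
      show "range \<phi> \<subseteq> generated scale \<rho> (orth m) {v}"
        using generated_pair_fst[of _ scale scale' \<rho> \<sigma> "orth m" v v'] \<phi> by (force simp: R_def)
      show "generated scale \<rho> (orth m) {v} \<subseteq> range \<phi>"
        using generated_pair_fst_onto[of _ scale \<rho> "orth m" v scale' \<sigma> v'] graph by (fastforce simp: R_def)
    qed
    show "\<forall>X\<in>orth m. \<forall>w. \<phi> (\<sigma> X w) = \<rho> X (\<phi> w)"
      using act[OF \<phi>, THEN graph] by simp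
  qed
qed


section \<open>Counting weight vectors below the top layer\<close>

lemma weight_space_unique:
  assumes "vector_space scale" "x \<in> weight_space h scale \<rho> \<mu>" "x \<in> weight_space h scale \<rho> \<nu>" "x \<noteq> 0" "H \<in> h"
  shows "\<mu> H = \<nu> H"
proof -
  interpret vector_space scale by fact
  have "scale (\<mu> H) x = scale (\<nu> H) x" using assms by (simp add: weight_space_def)
  then show ?thesis using assms(4) by simp
qed

lemma weight_space_cong:
  "x \<in> weight_space h scale \<rho> \<mu> \<Longrightarrow> (\<And>H. H \<in> h \<Longrightarrow> \<mu> H = \<nu> H) \<Longrightarrow> x \<in> weight_space h scale \<rho> \<nu>"
  by (auto simp: weight_space_def)

text \<open>
  Bounding spanning sets of weight vectors instead of weight spaces makes the bounds additive
  under unions, with no sums of subspaces to handle. Zero is left out of the count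
  because it lies in every weight space.
\<close>

definition weight_bounded ::
  "complex mat set \<Rightarrow> (complex \<Rightarrow> 'v::ab_group_add \<Rightarrow> 'v) \<Rightarrow> (complex mat \<Rightarrow> 'v \<Rightarrow> 'v) \<Rightarrow> nat \<Rightarrow> 'v set \<Rightarrow> bool" where
  "weight_bounded h scale \<rho> d S \<longleftrightarrow> S \<subseteq> (\<Union>\<mu>\<in>dual_space h. weight_space h scale \<rho> \<mu>) \<and>
     (\<forall>\<mu>\<in>dual_space h. finite (S \<inter> weight_space h scale \<rho> \<mu> - {0}) \<and>
        card (S \<inter> weight_space h scale \<rho> \<mu> - {0}) \<le> d)"

lemma weight_bounded_Un:
  assumes "weight_bounded h scale \<rho> d S" "weight_bounded h scale \<rho> e T"
  shows "weight_bounded h scale \<rho> (d + e) (S \<union> T)"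
  unfolding weight_bounded_def
proof (intro conjI ballI)
  show "S \<union> T \<subseteq> (\<Union>\<mu>\<in>dual_space h. weight_space h scale \<rho> \<mu>)"
    using assms unfolding weight_bounded_def by blast
  fix \<mu> assume \<mu>: "\<mu> \<in> dual_space h"
  have eq: "(S \<union> T) \<inter> weight_space h scale \<rho> \<mu> - {0}
      = (S \<inter> weight_space h scale \<rho> \<mu> - {0}) \<union> (T \<inter> weight_space h scale \<rho> \<mu> - {0})" by blast
  note S = assms(1)[unfolded weight_bounded_def, THEN conjunct2, rule_format, OF \<mu>]
  note T = assms(2)[unfolded weight_bounded_def, THEN conjunct2, rule_format, OF \<mu>]
  show "finite ((S \<union> T) \<inter> weight_space h scale \<rho> \<mu> - {0})" unfolding eq using S T by blast
  show "card ((S \<union> T) \<inter> weight_space h scale \<rho> \<mu> - {0}) \<le> d + e"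
    unfolding eq using S T by (intro order_trans[OF card_Un_le] add_mono) blast+
qed

text \<open>
  By the independence of weight spaces, the members of \<open>S\<close> of weight \<open>\<mu>\<close> span the weight space of \<open>\<mu>\<close>.
\<close>

lemma weight_bounded_spanning:
  assumes vs: "vector_space scale" and lin: "\<And>H. H \<in> h \<Longrightarrow> Vector_Spaces.linear scale scale (\<rho> H)"
    and S: "weight_bounded h scale \<rho> d S" and span: "module.span scale S = UNIV" and \<mu>: "\<mu> \<in> dual_space h"
  shows "finite_dim scale (weight_space h scale \<rho> \<mu>)" "multiplicity h scale \<rho> \<mu> \<le> d"
proof -
  interpret vector_space scale by fact
  let ?B = "S \<inter> weight_space h scale \<rho> \<mu> - {0}"
  have "weight_space h scale \<rho> \<mu> \<subseteq> span (S \<inter> weight_space h scale \<rho> \<mu>)"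
  proof
    fix x assume x: "x \<in> weight_space h scale \<rho> \<mu>"
    show "x \<in> span (S \<inter> weight_space h scale \<rho> \<mu>)"
    proof (rule weight_vector_in_span_weight_part[OF vs lin])
      show "S \<subseteq> (\<Union>\<mu>. weight_space h scale \<rho> \<mu>)" using S unfolding weight_bounded_def by blast
    qed (use span x in auto)
  qed
  then have sub: "weight_space h scale \<rho> \<mu> \<subseteq> span ?B" by (simp add: span_delete_0)
  have fin: "finite ?B" "card ?B \<le> d" using S \<mu> unfolding weight_bounded_def by blast+
  show "finite_dim scale (weight_space h scale \<rho> \<mu>)"
    unfolding finite_dim_def using fin sub by blast
  show "multiplicity h scale \<rho> \<mu> \<le> d"
    unfolding multiplicity_def using dim_le_card[OF sub fin(1)] fin(2) by simp
qed

lemma independent_card_bound: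
  assumes "vector_space scale" "\<not> module.dependent scale T" "T \<subseteq> U" "finite_dim scale U"
    "vector_space.dim scale U \<le> d"
  shows "finite T \<and> card T \<le> d"
proof -
  interpret vector_space scale by fact
  obtain B where B: "B \<subseteq> U" "independent B" "U \<subseteq> span B" "card B = dim U" by (rule basis_exists)
  obtain F where F: "finite F" "U \<subseteq> span F" using assms(4) by (auto simp: finite_dim_def)
  have "finite B" using independent_span_bound[OF F(1) B(2)] B(1) F(2) by blast
  from independent_span_bound[OF this assms(2)] assms(3) B(3) have "finite T \<and> card T \<le> card B"
    by blast
  then show ?thesis using assms(5) B(4) by linarith
qed

text \<open>
  A root vector shifts all weights by its root, so distinct weights stay distinct and the
  count per weight cannot grow.
\<close>

lemma (in osp_rep) weight_bounded_image:
  assumes h: "h \<subseteq> osp_cartan m" "h \<subseteq> g 0" and Y: "Y \<in> g p" "supp Y \<subseteq> pair_orbit m a b"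
    and ab: "a < m + 2" "b < m + 2" and S: "weight_bounded h scale \<rho> d S"
  shows "weight_bounded h scale \<rho> d (\<rho> Y ` S)"
  unfolding weight_bounded_def
proof (intro conjI ballI)
  have shift: "\<exists>\<nu>\<in>dual_space h. s \<in> weight_space h scale \<rho> \<nu> \<and>
      (\<lambda>H. \<nu> H + (H $$ (a, a) - H $$ (b, b))) \<in> dual_space h \<and>
      \<rho> Y s \<in> weight_space h scale \<rho> (\<lambda>H. \<nu> H + (H $$ (a, a) - H $$ (b, b)))" if s: "s \<in> S" for s
  proof -
    obtain \<nu> where \<nu>: "\<nu> \<in> dual_space h" "s \<in> weight_space h scale \<rho> \<nu>"
      using S s unfolding weight_bounded_def by blast
    then show ?thesis
      using dual_space_add_root[OF \<nu>(1) h(1) ab] elementary_shifts_weight[OF h Y ab \<nu>(2)] by blast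
  qed
  then show "\<rho> Y ` S \<subseteq> (\<Union>\<mu>\<in>dual_space h. weight_space h scale \<rho> \<mu>)" by blast
  fix \<mu> assume \<mu>: "\<mu> \<in> dual_space h"
  let ?\<mu>' = "\<lambda>H. \<mu> H + (H $$ (b, b) - H $$ (a, a))"
  let ?B = "S \<inter> weight_space h scale \<rho> ?\<mu>' - {0}"
  have "?\<mu>' \<in> dual_space h" by (rule dual_space_add_root[OF \<mu> h(1) ab(2,1)])
  then have B: "finite ?B" "card ?B \<le> d" using S unfolding weight_bounded_def by blast+
  have sub: "\<rho> Y ` S \<inter> weight_space h scale \<rho> \<mu> - {0} \<subseteq> \<rho> Y ` ?B"
  proof
    fix y assume y: "y \<in> \<rho> Y ` S \<inter> weight_space h scale \<rho> \<mu> - {0}"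
    then obtain s where s: "s \<in> S" "y = \<rho> Y s" by blast
    from shift[OF s(1)] obtain \<nu> where \<nu>: "s \<in> weight_space h scale \<rho> \<nu>"
      "\<rho> Y s \<in> weight_space h scale \<rho> (\<lambda>H. \<nu> H + (H $$ (a, a) - H $$ (b, b)))" by blast
    have "\<nu> H + (H $$ (a, a) - H $$ (b, b)) = \<mu> H" if "H \<in> h" for H
      by (rule weight_space_unique[OF vector_space_axioms \<nu>(2) _ _ that]) (use y s in auto)
    then have "s \<in> weight_space h scale \<rho> ?\<mu>'"
      by (intro weight_space_cong[OF \<nu>(1)]) (auto simp: algebra_simps)
    moreover have "s \<noteq> 0" using y s act_zero[OF Y(1)] by auto
    ultimately show "y \<in> \<rho> Y ` ?B" using s by blast
  qed
  show "finite (\<rho> Y ` S \<inter> weight_space h scale \<rho> \<mu> - {0})"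
    using sub B(1) by (rule finite_subset[OF _ finite_imageI])
  show "card (\<rho> Y ` S \<inter> weight_space h scale \<rho> \<mu> - {0}) \<le> d"
    using card_mono[OF finite_imageI[OF B(1)] sub] card_image_le[OF B(1), of "\<rho> Y"] B(2) by linarith
qed

context osp_highest_rep
begin

abbreviation "f_act \<equiv> \<rho> (even_lowering m)"

text \<open>
  The vectors \<open>y\<^sub>I f\<^sup>j s\<close> with \<open>s\<close> in \<open>S\<close> and \<open>I\<close> a set of indices below \<open>n\<close>; the largest index
  acts last. Adding one index at a time keeps the reordering of words to a single exchange.
\<close>

primrec lowered :: "'v set \<Rightarrow> nat \<Rightarrow> 'v set" where
  "lowered S 0 = (\<Union>j. (f_act ^^ j) ` S)"
| "lowered S (Suc n) = lowered S n \<union> \<rho> (odd_lowering m n) ` lowered S n"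

lemma act_span:
  assumes "X \<in> osp m p" "\<And>s. s \<in> S \<Longrightarrow> \<rho> X s \<in> span T" "x \<in> span S"
  shows "\<rho> X x \<in> span T"
  using assms(3)
proof (induction rule: span_induct_alt)
  case base
  then show ?case by (simp add: act_zero[OF assms(1)] span_zero)
next
  case (step c s y)
  then show ?case
    using assms(2) by (auto simp: act_add[OF assms(1)] act_scale[OF assms(1)] intro!: span_add span_scale)
qed

lemma f_odd_commute:
  assumes "i < m"
  shows "f_act (\<rho> (odd_lowering m i) u) = \<rho> (odd_lowering m i) (f_act u)"
proof -
  note E = even_lowering_osp[of m] and O = odd_lowering_osp[OF assms]
  have "\<rho> (0\<^sub>m (m + 2) (m + 2)) u = 0" by (rule zero_matrix_act[OF osp_zero])
  then show ?thesis
    using swap_act[OF E O, of u] by (simp add: bracket_even_odd_lowering[OF assms] koszul_def)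
qed

lemma span_lowered_mono: "x \<in> span (lowered S n) \<Longrightarrow> x \<in> span (lowered S (Suc n))"
  using span_mono[of "lowered S n" "lowered S (Suc n)"] by auto

lemma f_preserves_span_lowered:
  assumes "n \<le> m" "x \<in> span (lowered S n)"
  shows "f_act x \<in> span (lowered S n)"
  using assms
proof (induction n arbitrary: x)
  case 0
  show ?case
  proof (rule act_span[OF even_lowering_osp _ 0(2)])
    fix s assume "s \<in> lowered S 0"
    then obtain j t where "t \<in> S" "s = (f_act ^^ j) t" by auto
    then have "f_act s \<in> (f_act ^^ Suc j) ` S" by simp
    then show "f_act s \<in> span (lowered S 0)" unfolding lowered.simps by (intro span_base) blast
  qed
next
  case (Suc n)
  then have n: "n < m" by simp
  show ?case
  proof (rule act_span[OF even_lowering_osp _ Suc.prems(2)])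
    fix s assume "s \<in> lowered S (Suc n)"
    then consider "s \<in> lowered S n" | t where "t \<in> lowered S n" "s = \<rho> (odd_lowering m n) t" by auto
    then show "f_act s \<in> span (lowered S (Suc n))"
    proof cases
      case 1
      then show ?thesis using Suc.IH[of s] n by (intro span_lowered_mono) (auto intro: span_base)
    next
      case 2
      have "f_act t \<in> span (lowered S n)" using Suc.IH[of t] n 2 by (auto intro: span_base)
      then have "\<rho> (odd_lowering m n) (f_act t) \<in> span (lowered S (Suc n))"
        by (rule act_span[OF odd_lowering_osp[OF n], rotated]) (auto intro: span_base)
      then show ?thesis using 2 f_odd_commute[OF n] by simp
    qed
  qed
qed

text \<open>
  Only \<open>y\<^sub>i y\<^sub>n t\<close> needs reordering. It equals a multiple of \<open>f t\<close> minus \<open>y\<^sub>n y\<^sub>i t\<close>; for \<open>i = n\<close> this says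
  that \<open>y\<^sub>n\<^sup>2\<close> is a multiple of \<open>f\<close>.
\<close>

lemma odd_preserves_span_lowered:
  assumes "n \<le> m" "i < n" "x \<in> span (lowered S n)"
  shows "\<rho> (odd_lowering m i) x \<in> span (lowered S n)"
  using assms
proof (induction n arbitrary: x i)
  case (Suc n)
  then have n: "n < m" and i: "i < m" by simp_all
  let ?y = "\<lambda>i. \<rho> (odd_lowering m i)"
  have new: "?y n t \<in> span (lowered S (Suc n))" if "t \<in> span (lowered S n)" for t
    using that by (rule act_span[OF odd_lowering_osp[OF n], rotated]) (auto intro: span_base)
  show ?case
  proof (rule act_span[OF odd_lowering_osp[OF i] _ Suc.prems(3)])
    fix s assume "s \<in> lowered S (Suc n)"
    then consider "s \<in> lowered S n" | t where "t \<in> lowered S n" "s = ?y n t" by auto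
    then show "?y i s \<in> span (lowered S (Suc n))"
    proof cases
      case 1
      then show ?thesis
        using Suc.IH[of i s] n new[of s] Suc.prems(2)
        by (cases "i = n") (auto intro: span_base span_lowered_mono simp del: lowered.simps)
    next
      case 2
      obtain c where c: "super_bracket 1 1 (odd_lowering m i) (odd_lowering m n) = c \<cdot>\<^sub>m even_lowering m"
        using bracket_odd_lowering[OF i n] by blast
      have anti: "?y i (?y n t) = scale c (f_act t) - ?y n (?y i t)"
        using swap_act[OF odd_lowering_osp[OF i] odd_lowering_osp[OF n], of t]
        by (simp add: c smult_act[OF even_lowering_osp] koszul_def)
      have t: "t \<in> span (lowered S n)" using 2 by (intro span_base)
      then have ft: "f_act t \<in> span (lowered S (Suc n))"
        using f_preserves_span_lowered[of n t S] n by (intro span_lowered_mono) auto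
      show ?thesis
      proof (cases "i = n")
        case True
        then have "scale 2 (?y i s) = scale c (f_act t)"
          using anti 2 scale_left_distrib[of 1 1 "?y i s"] by (simp add: algebra_simps)
        then have "?y i s = scale (1 / 2) (scale c (f_act t))"
          by (simp flip: \<open>scale 2 (?y i s) = scale c (f_act t)\<close>)
        then show ?thesis using ft by (simp add: span_scale del: lowered.simps)
      next
        case False
        then have "?y i t \<in> span (lowered S n)" using Suc.IH[of i t] Suc.prems(2) n t by simp
        then show ?thesis using 2 anti new ft by (simp add: span_diff span_scale del: lowered.simps)
      qed
    qed
  qed
qed simp

lemma delta_lowering_preserves_span_lowered:
  assumes X: "X \<in> delta_lowering" and u: "u \<in> span (lowered S m)"
  shows "\<rho> X u \<in> span (lowered S m)"
proof -
  obtain p where p: "X \<in> osp m p" and deg: "\<And>a b. (a, b) \<in> supp X \<Longrightarrow> delta_degree m a < delta_degree m b"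
    using X by (auto simp: delta_lowering_def)
  show ?thesis
  proof (rule act_decompose[OF p subspace_span])
    fix Y a b
    assume Y: "Y \<in> osp m p" "supp Y \<subseteq> pair_orbit m a b" and ab: "a < m + 2" "b < m + 2" "(a, b) \<in> supp X"
    have odd: "\<rho> Y u \<in> span (lowered S m)" if i: "i < m" "supp Y \<subseteq> pair_orbit m i m" for i
    proof (cases "Y = 0\<^sub>m (m + 2) (m + 2)")
      case True
      then show ?thesis by (simp add: zero_matrix_act[OF osp_zero] span_zero)
    next
      case False
      have "\<rho> Y u = scale (Y $$ (i, m)) (\<rho> (odd_lowering m i) u)"
        using supp_odd_lowering(2)[OF Y(1) i(2) False i(1)] smult_act[OF odd_lowering_osp[OF i(1)]] by metis
      then show ?thesis using odd_preserves_span_lowered[OF _ i(1) u] by (simp add: span_scale)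
    qed
    consider "a < m" "b = m" | "a = m + 1" "b < m" | "a = m + 1" "b = m"
      using deg[OF ab(3)] ab(1,2) by (fastforce simp: delta_degree_def split: if_splits)
    then show "\<rho> Y u \<in> span (lowered S m)"
    proof cases
      case 1
      then show ?thesis using odd[of a] Y(2) by simp
    next
      case 2
      then have "pair_orbit m a b = pair_orbit m (dual_index m b) m" "dual_index m b < m"
        by (auto simp: pair_orbit_def dual_index_def)
      then show ?thesis using odd[of "dual_index m b"] Y(2) by simp
    next
      case 3
      then have "pair_orbit m a b = {(m + 1, m)}" by (auto simp: pair_orbit_def dual_index_def)
      then have "Y = Y $$ (m + 1, m) \<cdot>\<^sub>m even_lowering m"
        using Y by (intro supp_even_lowering osp_carrier) auto
      then have "\<rho> Y u = scale (Y $$ (m + 1, m)) (f_act u)"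
        using smult_act[OF even_lowering_osp] by metis
      then show ?thesis using f_preserves_span_lowered[OF _ u] by (simp add: span_scale)
    qed
  qed
qed

lemma span_lowered:
  assumes "generated scale \<rho> delta_lowering top_layer = UNIV" "top_layer \<subseteq> span S"
  shows "span (lowered S m) = UNIV"
proof -
  have "S \<subseteq> lowered S n" for n
  proof (induction n)
    case 0
    have "(f_act ^^ 0) ` S \<subseteq> lowered S 0" unfolding lowered.simps by blast
    then show ?case by simp
  qed auto
  then have "span S \<subseteq> span (lowered S m)" by (rule span_mono)
  then have "generated scale \<rho> delta_lowering top_layer \<subseteq> span (lowered S m)"
    using assms(2) delta_lowering_preserves_span_lowered by (intro gen_least subspace_span) auto
  then show ?thesis using assms(1) by blast
qed

lemma f_power_shifts_weight:
  assumes "s \<in> weight_space (osp_cartan m) scale \<rho> \<nu>"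
  shows "(f_act ^^ j) s \<in> weight_space (osp_cartan m) scale \<rho> (\<lambda>H. \<nu> H - of_nat (2 * j) * H $$ (m, m))"
proof (induction j)
  case (Suc j)
  have sub: "osp_cartan m \<subseteq> osp m 0" using cartan_osp by blast
  have "supp (even_lowering m) \<subseteq> pair_orbit m (m + 1) m"
    by (auto simp: even_lowering_supp pair_orbit_def)
  from elementary_shifts_weight[OF order.refl sub even_lowering_osp this _ _ Suc]
  have "(f_act ^^ Suc j) s \<in> weight_space (osp_cartan m) scale \<rho>
      (\<lambda>H. \<nu> H - of_nat (2 * j) * H $$ (m, m) + (H $$ (m + 1, m + 1) - H $$ (m, m)))" by simp
  moreover have "\<nu> H - of_nat (2 * j) * H $$ (m, m) + (H $$ (m + 1, m + 1) - H $$ (m, m))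
      = \<nu> H - of_nat (2 * Suc j) * H $$ (m, m)" if "H \<in> osp_cartan m" for H
    using cartan_dual[OF that, of m] by (simp add: dual_index_def algebra_simps)
  ultimately show ?case by (rule weight_space_cong)
qed (use assms in simp)

lemma dual_space_add_delta:
  assumes "\<mu> \<in> dual_space (osp_cartan m)"
  shows "(\<lambda>H. \<mu> H + c * H $$ (m, m)) \<in> dual_space (osp_cartan m)"
proof -
  have *: "dim_row X = m + 2" "dim_col X = m + 2" if "X \<in> osp_cartan m" for X
    using cartan_carrier[OF that] by auto
  show ?thesis
    using assms by (auto simp: dual_space_def * algebra_simps)
qed

text \<open>
  Each of the \<open>n\<close> odd operators at most doubles the count. In the vectors \<open>f\<^sup>j s\<close> the exponent
  is determined by the weight, because \<open>D\<close> is constant on the top layer and \<open>f\<close> lowers it by 2.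
\<close>

lemma weight_bounded_lowered:
  assumes S: "weight_bounded (osp_cartan m) scale \<rho> d S" "S \<subseteq> top_layer" and n: "n \<le> m"
  shows "weight_bounded (osp_cartan m) scale \<rho> (2 ^ n * d) (lowered S n)"
  using n
proof (induction n)
  case 0
  let ?h = "osp_cartan m"
  let ?V = "weight_space ?h scale \<rho>"
  have S_weight: "\<exists>\<nu>\<in>dual_space ?h. s \<in> ?V \<nu>" if "s \<in> S" for s
    using S(1) that unfolding weight_bounded_def by blast
  have exponent: "\<mu> (grading_element m) = \<Lambda>\<^sub>D - of_nat (2 * j)"
      and source: "s \<in> ?V (\<lambda>H. \<mu> H + of_nat (2 * j) * H $$ (m, m))"
    if s: "s \<in> S" "(f_act ^^ j) s \<in> ?V \<mu>" "(f_act ^^ j) s \<noteq> 0" for s j \<mu>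
  proof -
    obtain \<nu> where \<nu>: "s \<in> ?V \<nu>" using S_weight[OF s(1)] by blast
    have eq: "\<mu> H = \<nu> H - of_nat (2 * j) * H $$ (m, m)" if "H \<in> ?h" for H
      by (rule weight_space_unique[OF vector_space_axioms s(2) f_power_shifts_weight[OF \<nu>] s(3) that])
    then show "s \<in> ?V (\<lambda>H. \<mu> H + of_nat (2 * j) * H $$ (m, m))"
      by (intro weight_space_cong[OF \<nu>]) simp
    have "(f_act ^^ j) 0 = 0" by (induction j) (auto simp: act_zero[OF even_lowering_osp])
    then have "s \<noteq> 0" using s(3) by auto
    moreover have "scale \<Lambda>\<^sub>D s = scale (\<nu> (grading_element m)) s"
      using grading_top[of s] S(2) s(1) \<nu> grading_cartan[of m] by (auto simp: weight_space_def)
    ultimately have "\<nu> (grading_element m) = \<Lambda>\<^sub>D" by simp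
    moreover have "grading_element m $$ (m, m) = 1" by (simp add: grading_element_def delta_degree_def)
    ultimately show "\<mu> (grading_element m) = \<Lambda>\<^sub>D - of_nat (2 * j)"
      using eq[OF grading_cartan] by simp
  qed
  show ?case
    unfolding weight_bounded_def
  proof (intro conjI ballI)
    show "lowered S 0 \<subseteq> (\<Union>\<mu>\<in>dual_space ?h. ?V \<mu>)"
    proof
      fix y assume "y \<in> lowered S 0"
      then obtain j s where s: "s \<in> S" "y = (f_act ^^ j) s" by auto
      obtain \<nu> where \<nu>: "\<nu> \<in> dual_space ?h" "s \<in> ?V \<nu>" using S_weight[OF s(1)] by blast
      have "(\<lambda>H. \<nu> H - of_nat (2 * j) * H $$ (m, m)) \<in> dual_space ?h"
        using dual_space_add_delta[OF \<nu>(1), of "- of_nat (2 * j)"] by simp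
      then show "y \<in> (\<Union>\<mu>\<in>dual_space ?h. ?V \<mu>)" using f_power_shifts_weight[OF \<nu>(2), of j] s by blast
    qed
    fix \<mu> assume \<mu>: "\<mu> \<in> dual_space ?h"
    let ?A = "lowered S 0 \<inter> ?V \<mu> - {0}"
    have "finite ?A \<and> card ?A \<le> d"
    proof (cases "?A = {}")
      case False
      then obtain j0 s0 where 0: "s0 \<in> S" "(f_act ^^ j0) s0 \<in> ?V \<mu>" "(f_act ^^ j0) s0 \<noteq> 0" by auto
      let ?\<mu>' = "\<lambda>H. \<mu> H + of_nat (2 * j0) * H $$ (m, m)"
      let ?B = "S \<inter> ?V ?\<mu>' - {0}"
      have B: "finite ?B" "card ?B \<le> d"
        using S(1) dual_space_add_delta[OF \<mu>] unfolding weight_bounded_def by blast+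
      have sub: "?A \<subseteq> (f_act ^^ j0) ` ?B"
      proof
        fix y assume y: "y \<in> ?A"
        then obtain j s where s: "s \<in> S" "y = (f_act ^^ j) s" by auto
        then have "\<mu> (grading_element m) = \<Lambda>\<^sub>D - of_nat (2 * j)" using y by (intro exponent) auto
        with exponent[OF 0] have "j = j0" by simp
        have "(f_act ^^ j) 0 = 0" by (induction j) (auto simp: act_zero[OF even_lowering_osp])
        then have "s \<noteq> 0" using y s by auto
        moreover have "s \<in> ?V ?\<mu>'" using source[of s j \<mu>] y s \<open>j = j0\<close> by auto
        ultimately show "y \<in> (f_act ^^ j0) ` ?B" using s \<open>j = j0\<close> by blast
      qed
      have "card ?A \<le> d"
        using card_mono[OF finite_imageI[OF B(1)] sub] card_image_le[OF B(1), of "f_act ^^ j0"] B(2) by linarith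
      then show ?thesis using finite_subset[OF sub finite_imageI[OF B(1)]] by blast
    next
      case True
      show ?thesis unfolding True by simp
    qed
    then show "finite ?A" "card ?A \<le> 2 ^ 0 * d" by simp_all
  qed
next
  case (Suc n)
  then have n: "n < m" and IH: "weight_bounded (osp_cartan m) scale \<rho> (2 ^ n * d) (lowered S n)" by simp_all
  have sub: "osp_cartan m \<subseteq> osp m 0" using cartan_osp by blast
  have "weight_bounded (osp_cartan m) scale \<rho> (2 ^ n * d) (\<rho> (odd_lowering m n) ` lowered S n)"
    by (rule weight_bounded_image[OF order.refl sub odd_lowering_osp[OF n] _ _ _ IH])
      (use n in \<open>auto simp: odd_lowering_supp\<close>)
  from weight_bounded_Un[OF IH this] show ?case by (simp add: mult_2 distrib_right)
qed

end


section \<open>Boundedness\<close>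

lemma orth_base_subset: "orth_base m \<subseteq> osp_base m"
  by (auto simp: osp_base_def orth_base_def)

text \<open>
  These positions would carry the weights \<open>2 \<epsilon>\<^sub>i\<close>, which are not roots of o(m).
\<close>

lemma antidiagonal_zero:
  assumes Y: "Y \<in> orth m" and ab: "a < b" "b < m" "a + b = m - 1" "supp Y \<subseteq> pair_orbit m a b"
  shows "Y = 0\<^sub>m (m + 2) (m + 2)"
proof -
  have Yo: "Y \<in> osp m 0" using Y by (simp add: orth_iff)
  have d: "dual_index m a = b" "dual_index m b = a" using ab by (auto simp: dual_index_def)
  have "Y $$ (a, b) = 0"
    using osp_entry[OF Yo, of a b] ab(1,2) d by (simp add: koszul_def index_sign_def)
  then have "supp Y = {}" using ab(4) d by (auto simp: pair_orbit_def supp_def)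
  then show ?thesis using osp_carrier[OF Yo] by (intro supp_empty)
qed

lemma orth_highest_of_module:
  assumes W: "orth_rep scale \<sigma> m"
    and v: "highest_weight_vector (orth_even m) (orth_cartan m) (orth_base m) scale P \<sigma> \<mu> v"
    and \<Lambda>: "\<And>H. H \<in> orth_cartan m \<Longrightarrow> \<mu> H = \<Lambda> H"
  shows "orth_rep.highest scale \<sigma> m \<Lambda> v"
proof -
  interpret orth_rep scale \<sigma> m by fact
  show ?thesis
    unfolding highest_def
  proof (intro conjI ballI allI impI)
    show "\<sigma> H v = scale (\<Lambda> H) v" if "H \<in> orth_cartan m" for H
      using v \<Lambda>[OF that] that by (simp add: highest_weight_vector_def weight_space_def)
    fix Y a b assume Y: "Y \<in> orth m" "a < b" "b < m" "supp Y \<subseteq> pair_orbit m a b"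
    show "\<sigma> Y v = 0"
    proof (cases "a + b = m - 1")
      case True
      then show ?thesis
        using antidiagonal_zero[OF Y(1,2,3) True Y(4)] zero_matrix_act[of "m + 2" 0]
        by (simp add: purely_even_def orth_zero)
    next
      case False
      have "positive_on (orth_cartan m) (orth_base m) (\<lambda>H. H $$ (a, a) - H $$ (b, b))"
        using orth_root_positive[OF finite_orth_base order.refl Y(2,3) False] orth_cartan_subset
        unfolding positive_on_def by blast
      then have "Y \<in> positive_root_vectors (orth_even m) (orth_cartan m) (orth_base m)"
        using Y by (intro positive_root_vectorI[OF _ orth_cartan_subset _ Y(4), of _ 0])
          (auto simp: total_space_orth_even orth_iff)
      then show ?thesis using v by (simp add: highest_weight_vector_def)
    qed
  qed
qed

lemma osp_highest_of_module:
  assumes m: "1 \<le> m" and V: "super_rep scale (osp m) \<rho>"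
    and v: "highest_weight_vector (osp m) (osp_cartan m) (osp_base m) scale P \<rho> \<Lambda> v"
  shows "osp_highest_rep scale \<rho> m \<Lambda> v"
proof -
  interpret osp_rep scale "osp m" \<rho> m using V by (rule osp_rep_osp)
  have kill: "\<rho> Y v = 0"
    if "Y \<in> osp m p" "a < m + 2" "b < m + 2" "supp Y \<subseteq> pair_orbit m a b"
      "positive_on (osp_cartan m) (osp_base m) (\<lambda>H. H $$ (a, a) - H $$ (b, b))" for Y p a b
  proof -
    have "Y \<in> positive_root_vectors (osp m) (osp_cartan m) (osp_base m)"
      using that by (intro positive_root_vectorI[OF _ order.refl that(1,4)] total_space_memI)
    then show ?thesis using v by (simp add: highest_weight_vector_def)
  qed
  show ?thesis
  proof
    show "\<rho> H v = scale (\<Lambda> H) v" if "H \<in> osp_cartan m" for H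
      using v that by (simp add: highest_weight_vector_def weight_space_def)
    show "\<rho> Y v = 0" if "Y \<in> orth m" "a < b" "b < m" "supp Y \<subseteq> pair_orbit m a b" for Y a b
    proof (cases "a + b = m - 1")
      case True
      show ?thesis
        unfolding antidiagonal_zero[OF that(1,2,3) True that(4)] by (rule zero_matrix_act[OF osp_zero])
    next
      case False
      then show ?thesis
        using orth_root_positive[OF finite_osp_base orth_base_subset that(2,3) False] that
        by (intro kill[of Y 0 a b]) (auto simp: orth_iff)
    qed
    show "\<rho> Y v = 0" if "Y \<in> osp m p" "a < m + 2" "b < m + 2" "delta_degree m b < delta_degree m a"
      "supp Y \<subseteq> pair_orbit m a b" for Y p a b
      using osp_root_positive[OF m that(2-4)] kill[OF that(1-3,5)] by blast
  qed
qed

lemma orth_simple_module_facts: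
  assumes M: "orth_simple_module m \<mu> scale \<sigma>" and \<Lambda>: "\<And>H. H \<in> orth_cartan m \<Longrightarrow> \<mu> H = \<Lambda> H"
  obtains w where "orth_rep scale \<sigma> m" "orth_rep.highest scale \<sigma> m \<Lambda> w" "w \<noteq> 0"
    "\<forall>U. module.subspace scale U \<longrightarrow> (\<forall>X\<in>orth m. \<forall>u\<in>U. \<sigma> X u \<in> U) \<longrightarrow> U \<noteq> {0} \<longrightarrow> U = UNIV"
    "generated scale \<sigma> (orth m) {w} = UNIV"
proof -
  from M obtain w where S: "simple_supermodule (orth_even m) scale (purely_even 0 UNIV) \<sigma>"
    and w: "highest_weight_vector (orth_even m) (orth_cartan m) (orth_base m) scale (purely_even 0 UNIV) \<sigma> \<mu> w"
    unfolding orth_simple_module_def simple_highest_weight_module_def by blast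
  have "super_rep scale (orth_even m) \<sigma>"
    using S by (intro super_rep_of_supermodule superalgebra_orth)
      (auto simp: simple_supermodule_def total_space_orth_even intro: orth_even_orth)
  then have rep: "orth_rep scale \<sigma> m" by (intro orth_rep.intro osp_rep_orth)
  interpret orth_rep scale \<sigma> m by fact
  have w0: "w \<noteq> 0" using w by (simp add: highest_weight_vector_def)
  have simple: "U = UNIV" if "subspace U" "\<And>X u. X \<in> orth m \<Longrightarrow> u \<in> U \<Longrightarrow> \<sigma> X u \<in> U" "U \<noteq> {0}" for U
  proof -
    have "submodule (orth_even m) scale (purely_even 0 UNIV) \<sigma> U"
      using that by (auto simp: submodule_def total_space_orth_even purely_even_def subspace_0)
    then show ?thesis using S that(3) by (auto simp: simple_supermodule_def)
  qed
  have "generated scale \<sigma> (orth m) {w} = UNIV"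
  proof (rule simple)
    show "generated scale \<sigma> (orth m) {w} \<noteq> {0}" using gen_base[of w "{w}" scale \<sigma> "orth m"] w0 by auto
  qed (auto intro: subspace_generated gen_act)
  moreover have "highest \<Lambda> w" by (rule orth_highest_of_module[OF rep w \<Lambda>])
  moreover have "\<forall>U. subspace U \<longrightarrow> (\<forall>X\<in>orth m. \<forall>u\<in>U. \<sigma> X u \<in> U) \<longrightarrow> U \<noteq> {0} \<longrightarrow> U = UNIV"
    using simple by blast
  ultimately show ?thesis using rep w0 by (intro that)
qed

text \<open>
  What simplicity gives: the top layer has no nonzero proper o(m)-submodules, and the
  lowering operators generate the whole module from it.
\<close>

lemma osp_simple_module_facts:
  assumes m: "1 \<le> m" and M: "osp_simple_module m \<Lambda> scale P \<rho>"
  obtains v where "osp_highest_rep scale \<rho> m \<Lambda> v" "v \<noteq> 0"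
    "\<forall>U. module.subspace scale U \<longrightarrow> U \<subseteq> generated scale \<rho> (orth m) {v} \<longrightarrow>
      (\<forall>X\<in>orth m. \<forall>u\<in>U. \<rho> X u \<in> U) \<longrightarrow> U \<noteq> {0} \<longrightarrow> v \<in> U"
    "generated scale \<rho> (osp_highest_rep.delta_lowering m) (generated scale \<rho> (orth m) {v}) = UNIV"
proof -
  from M obtain v where S: "simple_supermodule (osp m) scale P \<rho>"
    and v: "highest_weight_vector (osp m) (osp_cartan m) (osp_base m) scale P \<rho> \<Lambda> v"
    unfolding osp_simple_module_def simple_highest_weight_module_def by blast
  have L: "lie_supermodule (osp m) scale P \<rho>" using S by (simp add: simple_supermodule_def)
  have T: "osp m p \<subseteq> total_space (osp m)" for p using total_space_memI by blast
  have rep: "osp_highest_rep scale \<rho> m \<Lambda> v"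
    by (rule osp_highest_of_module[OF m super_rep_of_supermodule[OF L superalgebra_osp T] v])
  interpret osp_highest_rep scale \<rho> m \<Lambda> v by fact
  have v0: "v \<noteq> 0" using v by (simp add: highest_weight_vector_def)
  obtain q where q: "v \<in> P q" using v by (auto simp: highest_weight_vector_def)
  have top: "top_layer \<subseteq> P q"
  proof (rule top_layer_induct[OF _ q])
    show "subspace (P q)" using L by (simp add: lie_supermodule_def parity_decomposition_def)
    show "\<rho> X u \<in> P q" if "X \<in> orth m" "u \<in> P q" for X u
    proof -
      have "\<rho> X u \<in> P (0 + q)" using L orth_osp[OF that(1)] that(2) unfolding lie_supermodule_def by blast
      then show ?thesis by (simp only: add_0_left)
    qed
  qed
  have N: "delta_lowering \<subseteq> (\<Union>p. osp m p)" by (auto simp: delta_lowering_def)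
  have all: "generated scale \<rho> delta_lowering U = UNIV"
    if U: "subspace U" "U \<subseteq> top_layer" "\<And>X u. X \<in> orth m \<Longrightarrow> u \<in> U \<Longrightarrow> \<rho> X u \<in> U" "U \<noteq> {0}" for U
  proof -
    let ?G = "generated scale \<rho> delta_lowering U"
    have "submodule (osp m) scale P \<rho> ?G"
      unfolding submodule_def
    proof (intro conjI ballI)
      show "subspace ?G" by (rule subspace_generated)
      show "\<exists>a\<in>?G \<inter> P 0. \<exists>b\<in>?G \<inter> P 1. u = a + b" if "u \<in> ?G" for u
        by (rule generated_graded[OF L T N _ that]) (use U(2) top in blast)
      fix X u assume X: "X \<in> total_space (osp m)" and u: "u \<in> ?G"
      then obtain X0 X1 where X01: "X0 \<in> osp m 0" "X1 \<in> osp m 1" "X = X0 + X1"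
        by (auto simp: total_space_def)
      then have "X0 \<in> total_space (osp m)" "X1 \<in> total_space (osp m)" using T by blast+
      then have "\<rho> X u = \<rho> X0 u + \<rho> X1 u" using L X01(3) unfolding lie_supermodule_def by blast
      moreover have "\<rho> X0 u \<in> ?G" "\<rho> X1 u \<in> ?G"
        using lowering_of_top_stable[OF U(1-3) _ u] X01(1,2) by blast+
      ultimately show "\<rho> X u \<in> ?G" by (simp add: gen_add)
    qed
    moreover have "?G \<noteq> {0}"
    proof -
      obtain u where "u \<in> U" "u \<noteq> 0" using U(4) subspace_0[OF U(1)] by blast
      then show ?thesis using gen_base[of u U scale \<rho> delta_lowering] by auto
    qed
    ultimately show ?thesis using S unfolding simple_supermodule_def by blast
  qed
  show ?thesis
  proof (rule that[OF rep v0])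
    have "v \<in> U" if U: "subspace U" "U \<subseteq> top_layer" "\<forall>X\<in>orth m. \<forall>u\<in>U. \<rho> X u \<in> U" "U \<noteq> {0}" for U
    proof -
      have "v \<in> generated scale \<rho> delta_lowering U" using all[OF U(1,2) _ U(4)] U(3) by auto
      then show "v \<in> U" using lowering_top_part[OF U(1,2)] cartan_weight[OF grading_cartan] by blast
    qed
    then show "\<forall>U. subspace U \<longrightarrow> U \<subseteq> generated scale \<rho> (orth m) {v} \<longrightarrow>
        (\<forall>X\<in>orth m. \<forall>u\<in>U. \<rho> X u \<in> U) \<longrightarrow> U \<noteq> {0} \<longrightarrow> v \<in> U"
      unfolding top_layer_def by blast
  next
    have "top_layer \<noteq> {0}" using top_layer_props(2) v0 by auto
    then show "generated scale \<rho> delta_lowering (generated scale \<rho> (orth m) {v}) = UNIV"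
      using all[of top_layer] top_layer_props by (simp add: top_layer_def)
  qed
qed

text \<open>
  The projection of the Cartan subalgebra to that of o(m) along \<open>D\<close>. A weight of the top
  layer is determined by its o(m)-part, its value \<open>k\<close> on \<open>D\<close> being fixed.
\<close>

definition orth_part :: "nat \<Rightarrow> complex mat \<Rightarrow> complex mat" where
  "orth_part m H = H + (- H $$ (m, m)) \<cdot>\<^sub>m grading_element m"

lemma orth_part_cartan:
  assumes H: "H \<in> osp_cartan m"
  shows "orth_part m H \<in> orth_cartan m"
proof -
  note C = cartan_carrier[OF H]
  have "orth_part m H \<in> osp m 0"
    unfolding orth_part_def using H grading_cartan[of m] by (intro osp_add osp_smult cartan_osp)
  moreover have "supp (orth_part m H) \<subseteq> {..<m} \<times> {..<m}" "diagonal_mat (orth_part m H)"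
  proof -
    have e: "orth_part m H $$ (i, j) = (if i = j \<and> i < m then H $$ (i, i) else 0)"
      if "i < m + 2" "j < m + 2" for i j
    proof -
      have "H $$ (m + 1, m + 1) = - H $$ (m, m)"
        using cartan_dual[OF H, of m] by (simp add: dual_index_def)
      moreover have "i \<noteq> j \<Longrightarrow> H $$ (i, j) = 0"
        using H C that by (auto simp: osp_cartan_def diagonal_mat_def)
      moreover have "i < m \<or> i = m \<or> i = m + 1" using that by linarith
      ultimately show ?thesis
        using C that by (auto simp: orth_part_def grading_element_def delta_degree_def)
    qed
    have "dim_row (orth_part m H) = m + 2" "dim_col (orth_part m H) = m + 2"
      by (simp_all add: orth_part_def grading_element_def)
    then show "supp (orth_part m H) \<subseteq> {..<m} \<times> {..<m}" "diagonal_mat (orth_part m H)"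
      using e by (auto simp: supp_def diagonal_mat_def split: if_splits)
  qed
  ultimately show ?thesis by (simp add: orth_cartan_def osp_cartan_def orth_iff)
qed

definition extend_weight ::
  "nat \<Rightarrow> complex \<Rightarrow> (complex mat \<Rightarrow> complex) \<Rightarrow> complex mat \<Rightarrow> complex" where
  "extend_weight m k \<nu> H = \<nu> (orth_part m H) + H $$ (m, m) * k"

lemma extend_weight_dual:
  assumes "\<nu> \<in> dual_space (orth_cartan m)"
  shows "extend_weight m k \<nu> \<in> dual_space (osp_cartan m)"
  unfolding dual_space_def
proof (intro CollectI conjI ballI allI)
  fix X Y assume X: "X \<in> osp_cartan m" and Y: "Y \<in> osp_cartan m"
  note C = cartan_carrier[OF X] cartan_carrier[OF Y]
  have "orth_part m (X + Y) = orth_part m X + orth_part m Y"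
    using C by (intro eq_matI) (auto simp: orth_part_def grading_element_def algebra_simps)
  then show "extend_weight m k \<nu> (X + Y) = extend_weight m k \<nu> X + extend_weight m k \<nu> Y"
    using assms orth_part_cartan[OF X] orth_part_cartan[OF Y] C
    by (auto simp: extend_weight_def dual_space_def algebra_simps)
next
  fix c X assume X: "X \<in> osp_cartan m"
  note C = cartan_carrier[OF X]
  have "orth_part m (c \<cdot>\<^sub>m X) = c \<cdot>\<^sub>m orth_part m X"
    using C by (intro eq_matI) (auto simp: orth_part_def grading_element_def algebra_simps)
  then show "extend_weight m k \<nu> (c \<cdot>\<^sub>m X) = c * extend_weight m k \<nu> X"
    using assms orth_part_cartan[OF X] C
    by (auto simp: extend_weight_def dual_space_def algebra_simps)
qed

lemma (in osp_highest_rep) top_layer_weight: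
  assumes u: "u \<in> top_layer" "u \<in> weight_space (orth_cartan m) scale \<rho> \<nu>"
  shows "u \<in> weight_space (osp_cartan m) scale \<rho> (extend_weight m \<Lambda>\<^sub>D \<nu>)"
  unfolding weight_space_def
proof safe
  fix H assume H: "H \<in> osp_cartan m"
  note C = cartan_carrier[OF H]
  note g = cartan_osp[OF grading_cartan[of m]]
  have o: "orth_part m H \<in> osp m 0"
    using orth_part_cartan[OF H] orth_cartan_subset cartan_osp by blast
  have "H = orth_part m H + H $$ (m, m) \<cdot>\<^sub>m grading_element m"
    using C by (intro eq_matI) (auto simp: orth_part_def grading_element_def)
  then have "\<rho> H u = \<rho> (orth_part m H) u + scale (H $$ (m, m)) (\<rho> (grading_element m) u)"
    using add_act[OF o osp_smult[OF g]] smult_act[OF g] by metis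
  also have "\<dots> = scale (extend_weight m \<Lambda>\<^sub>D \<nu> H) u"
    using u(2) orth_part_cartan[OF H] grading_top[OF u(1)]
    by (simp add: weight_space_def extend_weight_def scale_left_distrib)
  finally show "\<rho> H u = scale (extend_weight m \<Lambda>\<^sub>D \<nu> H) u" .
qed

lemma dual_space_mono: "h \<subseteq> h' \<Longrightarrow> dual_space h' \<subseteq> dual_space h"
  unfolding dual_space_def by blast

lemma multiplicity_le_degree:
  assumes "bounded_module h scale \<rho>" "\<mu> \<in> dual_space h"
  shows "multiplicity h scale \<rho> \<mu> \<le> module_degree h scale \<rho>"
proof -
  obtain d where "\<forall>\<mu>\<in>dual_space h. multiplicity h scale \<rho> \<mu> \<le> d"
    using assms(1) by (auto simp: bounded_module_def)
  then have "multiplicity h scale \<rho> ` dual_space h \<subseteq> {..d}" by auto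
  then have "finite (multiplicity h scale \<rho> ` dual_space h)"
    by (rule finite_subset) simp
  then show ?thesis unfolding module_degree_def using assms(2) by (intro Max_ge) auto
qed

lemma degree_le:
  assumes "\<And>\<mu>. \<mu> \<in> dual_space h \<Longrightarrow> multiplicity h scale \<rho> \<mu> \<le> d" "\<mu> \<in> dual_space h"
  shows "module_degree h scale \<rho> \<le> d"
proof -
  have "multiplicity h scale \<rho> ` dual_space h \<subseteq> {..d}" using assms(1) by auto
  then have "finite (multiplicity h scale \<rho> ` dual_space h)"
    by (rule finite_subset) simp
  then show ?thesis unfolding module_degree_def using assms by (subst Max_le_iff) auto
qed

theorem theorem6p1:
  fixes m :: nat
    and \<Lambda> :: "complex mat \<Rightarrow> complex"
    and scale :: "complex \<Rightarrow> 'v::ab_group_add \<Rightarrow> 'v"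
    and P :: "bit \<Rightarrow> 'v set"
    and \<rho> :: "complex mat \<Rightarrow> 'v \<Rightarrow> 'v"
    and scale' :: "complex \<Rightarrow> 'w::ab_group_add \<Rightarrow> 'w"
    and \<sigma> :: "complex mat \<Rightarrow> 'w \<Rightarrow> 'w"
  assumes "1 \<le> m"
    and "\<Lambda> \<in> dual_space (osp_cartan m)"
    and "osp_simple_module m \<Lambda> scale P \<rho>"
    and "orth_simple_module m (restrict \<Lambda> (orth_cartan m)) scale' \<sigma>"
  shows "(bounded_module (osp_cartan m) scale \<rho> \<longleftrightarrow>
            bounded_module (orth_cartan m) scale' \<sigma>) \<and>
         (bounded_module (orth_cartan m) scale' \<sigma> \<longrightarrow>
            module_degree (osp_cartan m) scale \<rho> \<le> 2 ^ (2 * m) * module_degree (orth_cartan m) scale' \<sigma>)"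
proof -
  let ?h = "osp_cartan m" and ?o = "orth_cartan m"
  obtain v where V: "osp_highest_rep scale \<rho> m \<Lambda> v" and v0: "v \<noteq> 0"
    and simpleV: "\<forall>U. module.subspace scale U \<longrightarrow> U \<subseteq> generated scale \<rho> (orth m) {v} \<longrightarrow>
      (\<forall>X\<in>orth m. \<forall>u\<in>U. \<rho> X u \<in> U) \<longrightarrow> U \<noteq> {0} \<longrightarrow> v \<in> U"
    and V_total: "generated scale \<rho> (osp_highest_rep.delta_lowering m) (generated scale \<rho> (orth m) {v}) = UNIV"
    by (rule osp_simple_module_facts[OF assms(1,3)])
  have restr: "restrict \<Lambda> ?o H = \<Lambda> H" if "H \<in> ?o" for H using that by simp
  obtain w where W: "orth_rep scale' \<sigma> m" and w: "orth_rep.highest scale' \<sigma> m \<Lambda> w" "w \<noteq> 0"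
    and simpleW: "\<forall>U. module.subspace scale' U \<longrightarrow> (\<forall>X\<in>orth m. \<forall>u\<in>U. \<sigma> X u \<in> U) \<longrightarrow>
      U \<noteq> {0} \<longrightarrow> U = UNIV"
    and W_total: "generated scale' \<sigma> (orth m) {w} = UNIV"
    by (rule orth_simple_module_facts[OF assms(4) restr])
  interpret V: osp_highest_rep scale \<rho> m \<Lambda> v by fact
  interpret W: orth_rep scale' \<sigma> m by fact
  interpret L: vector_space_pair scale' scale
    by (intro vector_space_pair.intro W.vector_space_axioms V.vector_space_axioms)
  obtain \<phi> where \<phi>: "Vector_Spaces.linear scale' scale \<phi>" "inj \<phi>"
      "range \<phi> = V.top_layer" and intertwines: "\<forall>X\<in>orth m. \<forall>w. \<phi> (\<sigma> X w) = \<rho> X (\<phi> w)"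
    unfolding V.top_layer_def
  proof (rule highest_weight_iso[OF V.orth.orth_rep_axioms W V.orth_highest v0 w _ _ W_total])
    show "v \<in> U" if "V.subspace U" "U \<subseteq> generated scale \<rho> (orth m) {v}"
      "\<And>X u. X \<in> orth m \<Longrightarrow> u \<in> U \<Longrightarrow> \<rho> X u \<in> U" "U \<noteq> {0}" for U
      using simpleV that by blast
    show "w \<in> U" if "W.subspace U" "U \<subseteq> generated scale' \<sigma> (orth m) {w}"
      "\<And>X u. X \<in> orth m \<Longrightarrow> u \<in> U \<Longrightarrow> \<sigma> X u \<in> U" "U \<noteq> {0}" for U
      using simpleW that by blast
  qed
  interpret \<phi>: Vector_Spaces.linear scale' scale \<phi> by (rule \<phi>(1))
  have o: "H \<in> ?o \<Longrightarrow> H \<in> orth m" for H by (simp add: orth_cartan_def)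
  have down: "b \<in> weight_space ?o scale' \<sigma> \<mu>" if "\<phi> b \<in> weight_space ?o scale \<rho> \<mu>" for b \<mu>
    unfolding weight_space_def
  proof safe
    fix H assume H: "H \<in> ?o"
    have "\<phi> (\<sigma> H b) = \<phi> (scale' (\<mu> H) b)"
      using that H intertwines o[OF H] by (simp add: weight_space_def \<phi>.scale)
    then show "\<sigma> H b = scale' (\<mu> H) b" using \<phi>(2) by (simp add: inj_eq)
  qed
  have up: "\<phi> b \<in> weight_space ?h scale \<rho> (extend_weight m V.\<Lambda>\<^sub>D \<nu>)"
    if "b \<in> weight_space ?o scale' \<sigma> \<nu>" for b \<nu>
  proof (rule V.top_layer_weight)
    show "\<phi> b \<in> V.top_layer" using \<phi>(3) by blast
    show "\<phi> b \<in> weight_space ?o scale \<rho> \<nu>"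
      unfolding weight_space_def
    proof safe
      fix H assume H: "H \<in> ?o"
      have "\<rho> H (\<phi> b) = \<phi> (\<sigma> H b)" using intertwines o[OF H] by simp
      also have "\<sigma> H b = scale' (\<nu> H) b" using that H by (simp add: weight_space_def)
      finally show "\<rho> H (\<phi> b) = scale (\<nu> H) (\<phi> b)" by (simp add: \<phi>.scale)
    qed
  qed
  have oh: "weight_space ?h scale \<rho> \<mu> \<subseteq> weight_space ?o scale \<rho> \<mu>" for \<mu>
    using orth_cartan_subset by (auto simp: weight_space_def)
  note dual_oh = dual_space_mono[OF orth_cartan_subset[of m]]
  let ?WS = "\<Union>\<nu>\<in>dual_space ?o. weight_space ?o scale' \<sigma> \<nu>"
  have weightW: "W.span ?WS = UNIV"
    using W.generated_weight_span[OF w(1)] W_total assms(2) dual_oh by blast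
  \<comment> \<open>a basis of a weight space embeds into one weight space of the big module\<close>
  have 1: "bounded_module ?o scale' \<sigma>" if bV: "bounded_module ?h scale \<rho>"
  proof -
    obtain d where d: "\<And>\<mu>. \<mu> \<in> dual_space ?h \<Longrightarrow>
        finite_dim scale (weight_space ?h scale \<rho> \<mu>) \<and> multiplicity ?h scale \<rho> \<mu> \<le> d"
      using bV by (auto simp: bounded_module_def)
    have "finite_dim scale' (weight_space ?o scale' \<sigma> \<nu>) \<and> multiplicity ?o scale' \<sigma> \<nu> \<le> d"
      if \<nu>: "\<nu> \<in> dual_space ?o" for \<nu>
    proof -
      obtain B where B: "B \<subseteq> weight_space ?o scale' \<sigma> \<nu>" "W.independent B"
        "weight_space ?o scale' \<sigma> \<nu> \<subseteq> W.span B" "card B = W.dim (weight_space ?o scale' \<sigma> \<nu>)"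
        by (rule W.basis_exists)
      have "V.independent (\<phi> ` B)"
        using \<phi>(1) B(2) inj_on_subset[OF \<phi>(2)] by (intro L.linear_independent_injective_image) auto
      moreover have "\<phi> ` B \<subseteq> weight_space ?h scale \<rho> (extend_weight m V.\<Lambda>\<^sub>D \<nu>)"
        using up B(1) by blast
      ultimately have "finite (\<phi> ` B) \<and> card (\<phi> ` B) \<le> d"
        using d[OF extend_weight_dual[OF \<nu>]] V.vector_space_axioms
        unfolding multiplicity_def by (intro independent_card_bound) blast+
      moreover have "inj_on \<phi> B" using inj_on_subset[OF \<phi>(2)] by blast
      ultimately have "finite B" "card B \<le> d" by (simp_all add: finite_image_iff card_image)
      then show ?thesis using B(3,4) by (auto simp: finite_dim_def multiplicity_def)
    qed
    then show ?thesis using weightW by (auto simp: bounded_module_def weight_module_def)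
  qed
  \<comment> \<open>a basis of weight vectors is moved to the top layer, then lowered\<close>
  have 2: "bounded_module ?h scale \<rho> \<and>
      module_degree ?h scale \<rho> \<le> 2 ^ (2 * m) * module_degree ?o scale' \<sigma>"
    if bW: "bounded_module ?o scale' \<sigma>"
  proof -
    define d where "d = module_degree ?o scale' \<sigma>"
    obtain B where B: "B \<subseteq> ?WS" "W.independent B" "?WS \<subseteq> W.span B"
      by (rule W.maximal_independent_subset)
    have B_span: "W.span B = UNIV"
      using W.span_minimal[OF B(3) W.subspace_span] unfolding weightW by (rule top_le)
    have wb: "weight_bounded ?h scale \<rho> d (\<phi> ` B)"
      unfolding weight_bounded_def
    proof (intro conjI ballI)
      show "\<phi> ` B \<subseteq> (\<Union>\<mu>\<in>dual_space ?h. weight_space ?h scale \<rho> \<mu>)"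
      proof
        fix x assume "x \<in> \<phi> ` B"
        then obtain b \<nu> where "x = \<phi> b" "\<nu> \<in> dual_space ?o" "b \<in> weight_space ?o scale' \<sigma> \<nu>"
          using B(1) by auto
        then show "x \<in> (\<Union>\<mu>\<in>dual_space ?h. weight_space ?h scale \<rho> \<mu>)"
          using up[of b \<nu>] extend_weight_dual[of \<nu> m "V.\<Lambda>\<^sub>D"] by auto
      qed
      fix \<mu> assume \<mu>: "\<mu> \<in> dual_space ?h"
      let ?B = "B \<inter> weight_space ?o scale' \<sigma> \<mu>"
      have \<mu>o: "\<mu> \<in> dual_space ?o" using \<mu> dual_oh by blast
      have "W.independent ?B" using B(2) by (rule W.independent_mono) simp
      then have fin: "finite ?B \<and> card ?B \<le> d"
        using bW \<mu>o multiplicity_le_degree[OF bW \<mu>o] W.vector_space_axioms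
        by (intro independent_card_bound[of scale' ?B "weight_space ?o scale' \<sigma> \<mu>"])
          (auto simp: bounded_module_def multiplicity_def d_def)
      have sub: "\<phi> ` B \<inter> weight_space ?h scale \<rho> \<mu> - {0} \<subseteq> \<phi> ` ?B"
      proof
        fix x assume x: "x \<in> \<phi> ` B \<inter> weight_space ?h scale \<rho> \<mu> - {0}"
        then obtain b where b: "b \<in> B" "x = \<phi> b" by auto
        then have "b \<in> weight_space ?o scale' \<sigma> \<mu>" using x oh[of \<mu>] by (intro down) auto
        then show "x \<in> \<phi> ` ?B" using b by blast
      qed
      show "finite (\<phi> ` B \<inter> weight_space ?h scale \<rho> \<mu> - {0})"
        using fin finite_subset[OF sub] by blast
      show "card (\<phi> ` B \<inter> weight_space ?h scale \<rho> \<mu> - {0}) \<le> d"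
        using card_mono[OF finite_imageI[of ?B \<phi>] sub] card_image_le[of ?B \<phi>] fin by linarith
    qed
    have "\<phi> ` UNIV = V.span (\<phi> ` B)" unfolding B_span[symmetric] by (rule L.linear_span_image[OF \<phi>(1), symmetric])
    then have top: "V.top_layer = V.span (\<phi> ` B)" using \<phi>(3) by simp
    let ?S = "V.lowered (\<phi> ` B) m"
    have S: "weight_bounded ?h scale \<rho> (2 ^ m * d) ?S"
      by (rule V.weight_bounded_lowered[OF wb]) (use \<phi>(3) in auto)
    have S_span: "V.span ?S = UNIV"
      by (rule V.span_lowered) (use V_total top in \<open>auto simp: V.top_layer_def\<close>)
    have lin: "Vector_Spaces.linear scale scale (\<rho> H)" if "H \<in> ?h" for H
      using V.linear_act[OF cartan_osp[OF that]] .
    note bound = weight_bounded_spanning[OF V.vector_space_axioms lin S S_span]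
    have "weight_module ?h scale \<rho>"
    proof -
      have "?S \<subseteq> (\<Union>\<mu>\<in>dual_space ?h. weight_space ?h scale \<rho> \<mu>)"
        using S unfolding weight_bounded_def by blast
      from V.span_mono[OF this] show ?thesis using S_span by (auto simp: weight_module_def)
    qed
    then have "bounded_module ?h scale \<rho>" using bound unfolding bounded_module_def by blast
    moreover have "module_degree ?h scale \<rho> \<le> 2 ^ m * d"
      by (rule degree_le[OF bound(2) assms(2)])
    moreover have "2 ^ m * d \<le> 2 ^ (2 * m) * d" by (intro mult_right_mono power_increasing) auto
    ultimately show ?thesis unfolding d_def by linarith
  qed
  show ?thesis using 1 2 by blast
qed

end
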